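(* Let $n\ge 1$ and let $G$ be a loopless graph on the vertex set $[n+1]$ in which the only edges allowed to have multiplicity greater than $1$ are those of the form $(1,l)$. Then $$\operatorname{vol}(\mathcal{F}_{\tilde G})=|\mathrm{InSeq}(\mathcal{T}(G))|,$$ where the cardinality is counted with multiplicity. Furthermore, $|\mathrm{InSeq}(\mathcal{T}(G))|$ is characterized as follows: writing $(a_{i,1},\dots,a_{i,i})$ for the indegree sequences (of vertices $2,\dots,i+1$) of the leaves of $\mathcal{T}(G[i+1])$, $i\in[n]$, the elements of $\mathrm{InSeq}(\mathcal{T}(G))$, with multiplicity, correspond to the integer arrays $(a_{i,j})_{1\le j\le i\le n}$ (with $(a_{n,1},\dots,a_{n,n})$ being the element of $\mathrm{InSeq}(\mathcal{T}(G))$) such that - $a_{1,1}=|E(G[2])|$; - for $1\le j<i\le n$: $a_{i,j}\in\{0,1,\ldots,a_{i-1,j}\}$ if $(j+1,i+1)\in E(G)$; - for $1\le j<i\le n$: $a_{i,j}=a_{i-1,j}$ if $(j+1,i+1)\notin E(G)$; - for $2\le i\le n$: $a_{i,i}=|E(G[i+1])|-\sum_{k=1}^{i-1}a_{i,k}$. In particular $\operatorname{vol}(\mathcal{F}_{\tilde G})$ equals the number of such arrays.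
   Context: Graphs may have multiple edges (distinct parallel edges are different elements of the edge multiset); vertex sets are totally ordered; an edge is written $(i,j)$ with $i<j$, $i$ being its initial and $j$ its final vertex. $[N]=\{1,\dots,N\}$. $G[i]$ is the restriction of $G$ to the vertex set $[i]$, and $|E(\cdot)|$ counts edges with multiplicity. For $G=([n+1],E)$, $\tilde G$ is the graph on $[n+1]\cup\{s,t\}$, with $s$ smaller and $t$ larger than all of $[n+1]$, and edge multiset $E\cup\{(s,i),(i,t): i\in[n+1]\}$. The flow polytope $\mathcal{F}_H$ of a graph $H$ with smallest vertex $s$ and largest vertex $t$ is the set of functions $f:E(H)\to\mathbb{R}_{\ge0}$ such that the total $f$-value of edges with initial vertex $s$ is $1$, the total $f$-value of edges with final vertex $t$ is $1$, and at every other vertex the total incoming $f$-value equals the total outgoing $f$-value. $\operatorname{vol}$ is normalized volume (with respect to the integer lattice in the affine hull, a unimodular simplex having volume $1$). Reduction: if a graph $G_0$ has edges $(i,j),(j,k)$ with $i<j<k$, it reduces to $G_1$, with $E(G_1)=E(G_0)\setminus\{(j,k)\}\cup\{(i,k)\}$, and $G_2$, with $E(G_2)=E(G_0)\setminus\{(i,j)\}\cup\{(i,k)\}$ (as multisets, removing/adding one copy). A reduction tree of $G$ is a binary tree with root labeled $G$ in which each node labeled by a graph admitting a reduction has two children labeled by the $G_1,G_2$ of a chosen reduction; leaves are labeled by graphs admitting no reduction. The indegree sequence of a graph on $[N+1]$ is $(\mathrm{indeg}(2),\ldots,\mathrm{indeg}(N+1))$, and $\mathrm{InSeq}(\mathcal{T})$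 is the multiset of indegree sequences of the graphs labeling the leaves of a reduction tree $\mathcal{T}$. The particular reduction trees $\mathcal{T}(G[i])$ used are constructed recursively. $\mathcal{T}(G[2])$ is the single node $G[2]$. Given $\mathcal{T}(G[i])$, add the vertex $i+1$ and all edges of $G$ with final vertex $i+1$ to every graph in $\mathcal{T}(G[i])$; then, starting from each graph labeling a leaf of $\mathcal{T}(G[i])$, go through the vertices $v<i+1$ such that $(v,i+1)$ is an edge of $G$, in increasing order, and at each such $v$ perform all possible reductions involving only edges incident to $v$: if $v$ has $a\ge1$ incoming edges, it has the single outgoing edge $(v,i+1)$, and one repeatedly reduces a remaining incoming edge of $v$ with $(v,i+1)$, until no such reduction is possible, obtaining $a+1$ graphs; if $v$ has no incoming edges nothing is done. The result is $\mathcal{T}(G[i+1])$, and $\mathcal{T}(G)=\mathcal{T}(G[n+1])$. *)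

theory Defs
  imports "HOL-Analysis.Analysis" "HOL-Analysis.Finite_Function_Topology" "HOL-Library.Multiset"
begin

section \<open>Multigraphs\<close>

text \<open>An edge is a pair of its initial and its final vertex.\<close>

record multigraph =
  verts :: "nat set"
  edges :: "(nat \<times> nat) multiset"

definition multigraph_on :: "nat set \<Rightarrow> multigraph \<Rightarrow> bool" where
  "multigraph_on V G \<longleftrightarrow> verts G = V \<and> (\<forall>(i, j)\<in>#edges G. i \<in> V \<and> j \<in> V \<and> i \<le> j)"

definition loopless :: "multigraph \<Rightarrow> bool" where
  "loopless G \<longleftrightarrow> (\<forall>(i, j)\<in>#edges G. i \<noteq> j)"

definition restrict_verts :: "multigraph \<Rightarrow> nat set \<Rightarrow> multigraph" where
  "restrict_verts G V =
     \<lparr>verts = verts G \<inter> V, edges = {# e \<in># edges G. fst e \<in> V \<and> snd e \<in> V #}\<rparr>"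

definition initial_graph :: "multigraph \<Rightarrow> nat \<Rightarrow> multigraph" where
  "initial_graph G i = restrict_verts G {1..i}"

definition indegree :: "multigraph \<Rightarrow> nat \<Rightarrow> nat" where
  "indegree G v = size {# e \<in># edges G. snd e = v #}"

text \<open>For a graph on \<open>{1..N+1}\<close> this is \<open>[indeg 2, \<dots>, indeg (N+1)]\<close>.\<close>

definition indegree_sequence :: "multigraph \<Rightarrow> nat list" where
  "indegree_sequence G = map (indegree G) (sorted_list_of_set (verts G - {1}))"

text \<open>The source is \<open>0\<close>, so this is meant for graphs whose vertices are positive.\<close>

definition augment :: "multigraph \<Rightarrow> multigraph" where
  "augment G = (let s = 0; t = Suc (Max (verts G)) in
     \<lparr>verts = {s} \<union> verts G \<union> {t},
      edges = edges G + mset_set ({s} \<times> verts G) + mset_set (verts G \<times> {t})\<rparr>)"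


section \<open>Flow polytopes\<close>

text \<open>
  Parallel edges have to be told apart: the copies of an edge \<open>e\<close> of multiplicity \<open>m\<close> are
  \<open>(e, 0), \<dots>, (e, m - 1)\<close>.
\<close>

definition arcs :: "multigraph \<Rightarrow> ((nat \<times> nat) \<times> nat) set" where
  "arcs G = {(e, k). k < count (edges G) e}"

definition outflow :: "multigraph \<Rightarrow> (((nat \<times> nat) \<times> nat) \<Rightarrow>\<^sub>0 real) \<Rightarrow> nat \<Rightarrow> real" where
  "outflow H f v = (\<Sum>a | a \<in> arcs H \<and> fst (fst a) = v. Poly_Mapping.lookup f a)"

definition inflow :: "multigraph \<Rightarrow> (((nat \<times> nat) \<times> nat) \<Rightarrow>\<^sub>0 real) \<Rightarrow> nat \<Rightarrow> real" where
  "inflow H f v = (\<Sum>a | a \<in> arcs H \<and> snd (fst a) = v. Poly_Mapping.lookup f a)"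

text \<open>
  Real functions on the finite set \<open>arcs H\<close> are represented as finitely supported functions
  that vanish outside \<open>arcs H\<close>, since these form a real vector space.
\<close>

definition flow_polytope :: "multigraph \<Rightarrow> (((nat \<times> nat) \<times> nat) \<Rightarrow>\<^sub>0 real) set" where
  "flow_polytope H =
     {f. Poly_Mapping.keys f \<subseteq> arcs H \<and> (\<forall>a\<in>arcs H. Poly_Mapping.lookup f a \<ge> 0) \<and>
         outflow H f (Min (verts H)) = 1 \<and> inflow H f (Max (verts H)) = 1 \<and>
         (\<forall>v\<in>verts H - {Min (verts H), Max (verts H)}. inflow H f v = outflow H f v)}"


section \<open>Normalized volume\<close>

definition integer_points :: "('a \<Rightarrow>\<^sub>0 real) set" where
  "integer_points = {f. \<forall>x. Poly_Mapping.lookup f x \<in> \<int>}"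

definition affine_chart ::
    "nat \<Rightarrow> 'v::real_vector \<Rightarrow> (nat \<Rightarrow> 'v) \<Rightarrow> (nat \<Rightarrow> real) \<Rightarrow> 'v" where
  "affine_chart d p b x = p + (\<Sum>k<d. x k *\<^sub>R b k)"

text \<open>
  A lattice frame of \<open>P\<close> identifies the affine hull of \<open>P\<close> with \<open>\<real>\<^sup>d\<close> in such a way that the
  integer points of the hull correspond to those of \<open>\<real>\<^sup>d\<close>; vectors of \<open>\<real>\<^sup>d\<close> are extensional
  functions on \<open>{..<d}\<close>.
\<close>

definition lattice_frame ::
    "('a \<Rightarrow>\<^sub>0 real) set \<Rightarrow> nat \<Rightarrow> ('a \<Rightarrow>\<^sub>0 real) \<Rightarrow> (nat \<Rightarrow> 'a \<Rightarrow>\<^sub>0 real) \<Rightarrow> bool" where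
  "lattice_frame P d p b \<longleftrightarrow>
     bij_betw (affine_chart d p b) ({..<d} \<rightarrow>\<^sub>E UNIV) (affine hull P) \<and>
     bij_betw (affine_chart d p b) ({..<d} \<rightarrow>\<^sub>E \<int>) (affine hull P \<inter> integer_points)"

text \<open>
  Two lattice frames differ by an affine unimodular map, so the value below does not depend on
  the frame. The factor \<open>fact d\<close> gives unimodular simplices volume 1. The value is
  unspecified when the affine hull contains no integer point or is not a rational subspace,
  which does not happen for lattice polytopes.
\<close>

definition normalized_volume :: "('a \<Rightarrow>\<^sub>0 real) set \<Rightarrow> real" where
  "normalized_volume P =
     (THE v. \<exists>d p b. lattice_frame P d p b \<and>
        v = fact d * measure (Pi\<^sub>M {..<d} (\<lambda>_. lborel))
                       {x \<in> {..<d} \<rightarrow>\<^sub>E UNIV. affine_chart d p b x \<in> P})"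


section \<open>Binary trees\<close>

datatype 'a btree = Leaf 'a | Node 'a "'a btree" "'a btree"

fun leaves :: "'a btree \<Rightarrow> 'a multiset" where
  "leaves (Leaf x) = {#x#}"
| "leaves (Node x l r) = leaves l + leaves r"

text \<open>The position of a leaf is the path to it from the root; \<open>False\<close> leads to the left child.\<close>

fun leaf_paths :: "'a btree \<Rightarrow> bool list set" where
  "leaf_paths (Leaf x) = {[]}"
| "leaf_paths (Node x l r) = Cons False ` leaf_paths l \<union> Cons True ` leaf_paths r"

text \<open>
  The label of the leaf that a path runs into. The path may extend beyond that leaf, so that a
  leaf of a tree grown out of \<open>T\<close> determines the leaf of \<open>T\<close> above it. A path ending at an inner
  node yields the label of that node; this case is irrelevant.
\<close>

fun leaf_along :: "'a btree \<Rightarrow> bool list \<Rightarrow> 'a" where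
  "leaf_along (Leaf x) \<pi> = x"
| "leaf_along (Node x l r) [] = x"
| "leaf_along (Node x l r) (c # \<pi>) = leaf_along (if c then r else l) \<pi>"

text \<open>\<open>grow R T T'\<close>: \<open>T'\<close> arises from \<open>T\<close> by replacing each leaf labelled \<open>x\<close> by some tree \<open>t\<close>
  with \<open>R x t\<close>; the choices made at different leaves are independent.\<close>

inductive grow :: "('a \<Rightarrow> 'a btree \<Rightarrow> bool) \<Rightarrow> 'a btree \<Rightarrow> 'a btree \<Rightarrow> bool"
  for R where
  grow_Leaf: "R x t \<Longrightarrow> grow R (Leaf x) t"
| grow_Node: "grow R l l' \<Longrightarrow> grow R r r' \<Longrightarrow> grow R (Node x l r) (Node x l' r')"


section \<open>Reduction trees\<close>

definition reducible_at :: "multigraph \<Rightarrow> nat \<Rightarrow> nat \<Rightarrow> nat \<Rightarrow> bool" where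
  "reducible_at H u v w \<longleftrightarrow> u < v \<and> v < w \<and> (u, v) \<in># edges H \<and> (v, w) \<in># edges H"

definition reduct1 :: "multigraph \<Rightarrow> nat \<Rightarrow> nat \<Rightarrow> nat \<Rightarrow> multigraph" where
  "reduct1 H u v w = H\<lparr>edges := edges H - {#(v, w)#} + {#(u, w)#}\<rparr>"

definition reduct2 :: "multigraph \<Rightarrow> nat \<Rightarrow> nat \<Rightarrow> nat \<Rightarrow> multigraph" where
  "reduct2 H u v w = H\<lparr>edges := edges H - {#(u, v)#} + {#(u, w)#}\<rparr>"

text \<open>
  \<open>vertex_reductions v H T\<close>: \<open>T\<close> is a tree with root \<open>H\<close> obtained by performing reductions whose
  two edges are both incident to \<open>v\<close> (hence with \<open>v\<close> as middle vertex) until none is possible.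
  The order in which the incoming edges of \<open>v\<close> are used is left open.
\<close>

inductive vertex_reductions :: "nat \<Rightarrow> multigraph \<Rightarrow> multigraph btree \<Rightarrow> bool"
  for v where
  stop: "(\<And>u w. \<not> reducible_at H u v w) \<Longrightarrow> vertex_reductions v H (Leaf H)"
| reduce: "reducible_at H u v w \<Longrightarrow>
     vertex_reductions v (reduct1 H u v w) T1 \<Longrightarrow>
     vertex_reductions v (reduct2 H u v w) T2 \<Longrightarrow>
     vertex_reductions v H (Node H T1 T2)"

inductive process_verts :: "nat list \<Rightarrow> multigraph btree \<Rightarrow> multigraph btree \<Rightarrow> bool" where
  process_Nil: "process_verts [] T T"
| process_Cons: "grow (vertex_reductions v) T T' \<Longrightarrow> process_verts vs T' T'' \<Longrightarrow>
     process_verts (v # vs) T T''"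

definition add_vertex :: "multigraph \<Rightarrow> nat \<Rightarrow> multigraph \<Rightarrow> multigraph" where
  "add_vertex G w H =
     \<lparr>verts = insert w (verts H), edges = edges H + {# e \<in># edges G. snd e = w #}\<rparr>"

definition next_tree ::
    "multigraph \<Rightarrow> nat \<Rightarrow> multigraph btree \<Rightarrow> multigraph btree \<Rightarrow> bool" where
  "next_tree G i T T' \<longleftrightarrow>
     process_verts (filter (\<lambda>v. (v, i + 1) \<in># edges G) [1..<i + 1])
       (map_btree (add_vertex G (i + 1)) T) T'"

text \<open>
  \<open>T i\<close> is the tree of the graph induced by \<open>G\<close> on \<open>{1..i}\<close>, for \<open>i = 2, \<dots>, n + 1\<close>. This is a
  predicate because the construction involves choices (see \<open>vertex_reductions\<close>); the lemma
  \<open>ex_tree_construction\<close> below shows that it can always be carried out.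
\<close>

definition tree_construction :: "multigraph \<Rightarrow> nat \<Rightarrow> (nat \<Rightarrow> multigraph btree) \<Rightarrow> bool" where
  "tree_construction G n T \<longleftrightarrow>
     T 2 = Leaf (initial_graph G 2) \<and> (\<forall>i\<in>{2..n}. next_tree G i (T i) (T (i + 1)))"

definition InSeq :: "multigraph btree \<Rightarrow> nat list multiset" where
  "InSeq T = image_mset indegree_sequence (leaves T)"

lemma ex_vertex_reductions: "\<exists>T. vertex_reductions v H T"
proof (induction "size {# e \<in># edges H. fst e = v \<or> snd e = v #}" arbitrary: H rule: less_induct)
  case less
  show ?case
  proof (cases "\<exists>u w. reducible_at H u v w")
    case False
    then show ?thesis
      using stop by blast
  next
    case True
    then obtain u w where red: "reducible_at H u v w"
      by blast
    then have uvw: "u < v" "v < w" "(u, v) \<in># edges H" "(v, w) \<in># edges H"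
      by (auto simp: reducible_at_def)
    have decr: "size {# e \<in># edges H - {#x#} + {#(u, w)#}. fst e = v \<or> snd e = v #}
        < size {# e \<in># edges H. fst e = v \<or> snd e = v #}"
      if x: "x \<in># edges H" "fst x = v \<or> snd x = v" for x
    proof -
      obtain M where M: "edges H = add_mset x M"
        using multi_member_split[OF x(1)] by blast
      show ?thesis
        using uvw(1,2) x(2) by (simp add: M)
    qed
    obtain T1 where "vertex_reductions v (reduct1 H u v w) T1"
      using less[of "reduct1 H u v w"] decr[OF uvw(4)] by (auto simp: reduct1_def)
    moreover obtain T2 where "vertex_reductions v (reduct2 H u v w) T2"
      using less[of "reduct2 H u v w"] decr[OF uvw(3)] by (auto simp: reduct2_def)
    ultimately show ?thesis
      using reduce[OF red] by blast
  qed
qed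

lemma ex_grow: "(\<And>x. \<exists>t. R x t) \<Longrightarrow> \<exists>T'. grow R T T'"
  by (induction T) (meson grow.intros)+

lemma ex_process_verts: "\<exists>T'. process_verts vs T T'"
  by (induction vs arbitrary: T) (meson process_verts.intros ex_grow ex_vertex_reductions)+

lemma ex_tree_construction: "\<exists>T. tree_construction G n T"
proof -
  have "\<exists>f. \<forall>k. (k = 0 \<longrightarrow> f k = Leaf (initial_graph G 2)) \<and> next_tree G (k + 2) (f k) (f (Suc k))"
    using dependent_nat_choice[of "\<lambda>k T. k = 0 \<longrightarrow> T = Leaf (initial_graph G 2)"
        "\<lambda>k T T'. next_tree G (k + 2) T T'"] ex_process_verts
    unfolding next_tree_def by simp
  then obtain f where f: "f 0 = Leaf (initial_graph G 2)"
    "\<And>k. next_tree G (k + 2) (f k) (f (Suc k))"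
    by blast
  have "next_tree G i (f (i - 2)) (f (i + 1 - 2))" if "i \<in> {2..n}" for i
  proof -
    have "i - 2 + 2 = i" "i + 1 - 2 = Suc (i - 2)"
      using that by auto
    then show ?thesis
      using f(2)[of "i - 2"] by metis
  qed
  then have "tree_construction G n (\<lambda>i. f (i - 2))"
    using f(1) by (simp add: tree_construction_def)
  then show ?thesis
    by blast
qed


section \<open>Arrays of indegrees\<close>

text \<open>
  Row \<open>i\<close> of the array of a leaf of \<open>T (n + 1)\<close>, given by its position, is the indegree sequence
  of the leaf of \<open>T (i + 1)\<close> above it. Arrays are extended by 0 outside of their index set.
\<close>

definition leaf_array ::
    "nat \<Rightarrow> (nat \<Rightarrow> multigraph btree) \<Rightarrow> bool list \<Rightarrow> nat \<Rightarrow> nat \<Rightarrow> int" where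
  "leaf_array n T \<pi> i j =
     (if 1 \<le> j \<and> j \<le> i \<and> i \<le> n
      then int (indegree_sequence (leaf_along (T (i + 1)) \<pi>) ! (j - 1)) else 0)"

definition indegree_arrays :: "multigraph \<Rightarrow> nat \<Rightarrow> (nat \<Rightarrow> nat \<Rightarrow> int) set" where
  "indegree_arrays G n = {a.
     (\<forall>i j. \<not> (1 \<le> j \<and> j \<le> i \<and> i \<le> n) \<longrightarrow> a i j = 0) \<and>
     a 1 1 = int (size (edges (initial_graph G 2))) \<and>
     (\<forall>i j. 1 \<le> j \<and> j < i \<and> i \<le> n \<longrightarrow>
        (if (j + 1, i + 1) \<in># edges G then a i j \<in> {0..a (i - 1) j} else a i j = a (i - 1) j)) \<and>
     (\<forall>i\<in>{2..n}. a i i = int (size (edges (initial_graph G (i + 1)))) - (\<Sum>k=1..i - 1. a i k))}"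

end

theory Submission
  imports Defs
begin

text \<open>
  \<^bold>\<open>The volume.\<close> Let \<open>L(N)\<close> be the number of integral flows of strength \<open>N\<close> on the augmented graph. A
  reduction at \<open>(i, j), (j, k)\<close> is a case distinction on the two flow values: if the value \<open>x\<close> on
  \<open>(i, j)\<close> is at least the value \<open>y\<close> on \<open>(j, k)\<close>, then \<open>y\<close> units may be sent along a new edge
  \<open>(i, k)\<close> instead, which empties \<open>(j, k)\<close>; if \<open>x < y\<close>, the same is done with \<open>x\<close> units and
  \<open>(i, j)\<close> is emptied. So \<open>L\<close> is additive under reductions, up to the flows with \<open>x = y\<close>, which are
  flows on a graph with one edge less (\<open>card_flows_exchange\<close>). With \<open>d = |E| + n\<close> the correction is
  \<open>O(N^(d-1))\<close>. A graph at a leaf of the tree has no path with two edges, so a flow on it is a free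
  distribution of \<open>N\<close> units over \<open>d + 1\<close> routes, and \<open>L(N)\<close> is the binomial coefficient
  \<open>(N + d choose d)\<close> (\<open>card_network_flows_alternating\<close>). Hence \<open>L(N) / N^d\<close> tends to the number of leaves
  divided by \<open>d!\<close> (\<open>flow_count_limit\<close>).

  It remains to compare \<open>L(N)\<close> with the Lebesgue measure of the polytope in a lattice frame. The
  measure of the \<open>N\<close>-fold dilate differs from its number of lattice points only through unit cubes that
  meet the boundary. Adding a fixed multiple of an integral flow that is positive on all arcs
  moves these cubes into a slightly larger dilate, so that for some constant \<open>C\<close> the measure lies
  between \<open>L(N) / (N + C)^d\<close> and \<open>L(N + C) / N^d\<close>. The numbers \<open>L(N)\<close> do not refer to the frame. The
  same argument therefore shows that all lattice frames yield the same volume, without any change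
  of variables, and also that they have the same dimension (\<open>dimension_and_volume_from_counts\<close>,
  \<open>normalized_volume_slice\<close>).

  \<^bold>\<open>The arrays.\<close> When the vertex \<open>w\<close> is added, a vertex \<open>v\<close> with an edge \<open>(v, w)\<close> and \<open>a > 0\<close> incoming edges
  has no other outgoing edge. Reducing an incoming edge with \<open>(v, w)\<close> either uses up \<open>(v, w)\<close>, which ends
  the process at \<open>v\<close>, or removes that incoming edge. So the final indegree of \<open>v\<close> takes each value in
  \<open>{0..a}\<close> at exactly one leaf (\<open>vertex_reductions_unique_leaf\<close>). A reduction at \<open>v\<close> changes no
  indegrees but those of \<open>v\<close> and \<open>w\<close>, so the choices at different vertices are independent, and the
  indegree of \<open>w\<close> is determined by the total number of edges. Row by row this
  gives the bijection between leaves and arrays (\<open>next_tree_paths\<close>, \<open>leaf_array_bij\<close>).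
\<close>

section \<open>Dimension and volume from point counts\<close>

text \<open>
  If \<open>d < D\<close>, then \<open>lower\<close> bounds \<open>P N / N^D\<close> by a null sequence. If \<open>D < d\<close>, then \<open>upper\<close> forces \<open>\<mu> = 0\<close>, and \<open>lower\<close>
  makes \<open>P\<close> vanish. For \<open>d = D\<close> both bounds tend to \<open>c\<close>.
\<close>

lemma dimension_and_volume_from_counts:
  fixes P :: "nat \<Rightarrow> nat" and \<mu> c :: real and C d D :: nat
  assumes upper: "\<And>N. N > 0 \<Longrightarrow> \<mu> \<le> real (P (N + C)) / real N ^ d"
    and lower: "\<And>N. N > 0 \<Longrightarrow> real (P N) \<le> \<mu> * real (N + C) ^ d"
    and \<mu>: "\<mu> \<ge> 0"
    and lim: "(\<lambda>N. real (P N) / real N ^ D) \<longlonglongrightarrow> c" and c: "c > 0"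
  shows "d = D \<and> \<mu> = c"
proof -
  have ratio: "(\<lambda>N. real (N + C) / real N) \<longlonglongrightarrow> 1"
  proof (rule Lim_transform_eventually)
    show "(\<lambda>N. 1 + real C * (1 / real N)) \<longlonglongrightarrow> 1"
      by (rule tendsto_eq_rhs[OF tendsto_add[OF tendsto_const
            tendsto_mult[OF tendsto_const lim_1_over_n]]]) simp
    show "\<forall>\<^sub>F N in sequentially. 1 + real C * (1 / real N) = real (N + C) / real N"
      by (intro eventually_sequentiallyI[of 1]) (simp add: field_simps)
  qed
  have "d \<le> D"
  proof (rule ccontr)
    assume "\<not> d \<le> D"
    have "\<mu> \<le> (real (P (N + C)) / real (N + C) ^ D) * (real (N + C) / real N) ^ D * (1 / real N)"
      if "N > 0" for N
    proof -
      have "\<mu> \<le> real (P (N + C)) / real N ^ d"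
        by (rule upper[OF that])
      also have "\<dots> \<le> real (P (N + C)) / real N ^ Suc D"
        using \<open>\<not> d \<le> D\<close> that by (intro divide_left_mono power_increasing) auto
      also have "\<dots> = (real (P (N + C)) / real (N + C) ^ D) * (real (N + C) / real N) ^ D * (1 / real N)"
        using that by (simp add: power_divide mult.commute)
      finally show ?thesis .
    qed
    then have le: "\<forall>\<^sub>F N in sequentially.
        \<mu> \<le> (real (P (N + C)) / real (N + C) ^ D) * (real (N + C) / real N) ^ D * (1 / real N)"
      by (intro eventually_sequentiallyI[of 1]) simp
    have "(\<lambda>N. (real (P (N + C)) / real (N + C) ^ D) * (real (N + C) / real N) ^ D * (1 / real N))
        \<longlonglongrightarrow> c * 1 ^ D * 0"
      using LIMSEQ_ignore_initial_segment[OF lim, of C] by (intro tendsto_intros ratio lim_1_over_n) simp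
    then have "\<mu> \<le> c * 1 ^ D * 0"
      by (rule tendsto_le[OF sequentially_bot _ tendsto_const le])
    then have "\<mu> = 0"
      using \<mu> by simp
    then have "\<forall>\<^sub>F N in sequentially. real (P N) / real N ^ D \<le> 0"
      using lower by (intro eventually_sequentiallyI[of 1]) fastforce
    then have "c \<le> 0"
      by (rule tendsto_le[OF sequentially_bot tendsto_const lim])
    then show False
      using c by simp
  qed
  moreover have "D \<le> d"
  proof (rule ccontr)
    assume "\<not> D \<le> d"
    have "real (P N) / real N ^ D \<le> (\<mu> * (real (N + C) / real N) ^ d) * (1 / real N)"
      if "N > 0" for N
    proof -
      have "real (P N) / real N ^ D \<le> (\<mu> * real (N + C) ^ d) / real N ^ D"
        using lower[OF that] by (intro divide_right_mono) auto
      also have "\<dots> \<le> (\<mu> * real (N + C) ^ d) / real N ^ Suc d"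
        using \<open>\<not> D \<le> d\<close> that \<mu> by (intro divide_left_mono power_increasing) auto
      finally show ?thesis
        by (simp add: power_divide mult.commute)
    qed
    then have le: "\<forall>\<^sub>F N in sequentially.
        real (P N) / real N ^ D \<le> (\<mu> * (real (N + C) / real N) ^ d) * (1 / real N)"
      by (intro eventually_sequentiallyI[of 1]) simp
    have "(\<lambda>N. (\<mu> * (real (N + C) / real N) ^ d) * (1 / real N)) \<longlonglongrightarrow> (\<mu> * 1 ^ d) * 0"
      by (intro tendsto_intros ratio lim_1_over_n)
    then have "c \<le> (\<mu> * 1 ^ d) * 0"
      by (rule tendsto_le[OF sequentially_bot _ lim le])
    then show False
      using c by simp
  qed
  ultimately have D: "D = d"
    by simp
  note lim = lim[unfolded D]
  have "c \<le> \<mu> * 1 ^ d"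
  proof (rule tendsto_le[OF _ _ lim])
    show "(\<lambda>N. \<mu> * (real (N + C) / real N) ^ d) \<longlonglongrightarrow> \<mu> * 1 ^ d"
      by (intro tendsto_intros ratio)
    show "\<forall>\<^sub>F N in sequentially. real (P N) / real N ^ d \<le> \<mu> * (real (N + C) / real N) ^ d"
      using lower by (intro eventually_sequentiallyI[of 1]) (simp add: power_divide divide_right_mono)
  qed auto
  moreover have "\<mu> \<le> c * 1 ^ d"
  proof (rule tendsto_le[OF _ _ tendsto_const])
    show "(\<lambda>N. (real (P (N + C)) / real (N + C) ^ d) * (real (N + C) / real N) ^ d)
        \<longlonglongrightarrow> c * 1 ^ d"
      using LIMSEQ_ignore_initial_segment[OF lim, of C] by (intro tendsto_intros ratio) simp
    show "\<forall>\<^sub>F N in sequentially. \<mu> \<le> (real (P (N + C)) / real (N + C) ^ d) *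
        (real (N + C) / real N) ^ d"
      using upper by (intro eventually_sequentiallyI[of 1]) (auto simp: power_divide)
  qed auto
  ultimately show ?thesis
    using D by simp
qed

section \<open>Lattice frames of dilated polytopes\<close>

abbreviation "lookup \<equiv> Poly_Mapping.lookup"
abbreviation "keys \<equiv> Poly_Mapping.keys"
abbreviation "single \<equiv> Poly_Mapping.single"

lemma lookup_scaleR: "lookup (r *\<^sub>R f) a = r *\<^sub>R lookup f a"
proof -
  have "finite {i. r *\<^sub>R lookup f i \<noteq> 0}"
    by (rule finite_subset[OF _ finite_lookup[of f]]) auto
  then show ?thesis
    by (simp add: scaleR_poly_mapping_def)
qed

lemma lookup_affine_chart:
  fixes p :: "'a \<Rightarrow>\<^sub>0 real"
  shows "lookup (affine_chart d p b x) a =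
    lookup p a + (\<Sum>k<d. x k * lookup (b k) a)"
  by (simp add: affine_chart_def lookup_add lookup_sum lookup_scaleR)

text \<open>
  Polytopes in standard form: the nonnegative solutions of linear equations \<open>l i f = w i\<close> that are
  supported on \<open>A\<close>. The integral point \<open>g\<close> of the \<open>g0\<close>-th dilate is positive on all of \<open>A\<close>. Its multiples push points with slightly
  negative coordinates back into a larger dilate, at an additive cost in the dilation factor.
\<close>

locale dilated_slices =
  fixes A :: "'a set" and l :: "'i \<Rightarrow> ('a \<Rightarrow>\<^sub>0 real) \<Rightarrow> real" and w :: "'i \<Rightarrow> real"
    and g :: "'a \<Rightarrow>\<^sub>0 real" and g0 :: nat
  assumes finite_A: "finite A"
    and linear_l: "\<And>i. linear (l i)"
    and g0_pos: "g0 > 0"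
    and keys_g: "keys g \<subseteq> A"
    and l_g: "\<And>i. l i g = real g0 * w i"
    and g_int: "g \<in> integer_points"
    and g_ge_1: "\<And>a. a \<in> A \<Longrightarrow> lookup g a \<ge> 1"
begin

definition plane :: "real \<Rightarrow> ('a \<Rightarrow>\<^sub>0 real) set" where
  "plane r = {f. keys f \<subseteq> A \<and> (\<forall>i. l i f = r * w i)}"

definition slice :: "real \<Rightarrow> ('a \<Rightarrow>\<^sub>0 real) set" where
  "slice r = {f \<in> plane r. \<forall>a\<in>A. 0 \<le> lookup f a}"

lemma plane_add: "x \<in> plane r \<Longrightarrow> y \<in> plane s \<Longrightarrow> x + y \<in> plane (r + s)"
  using keys_add[of x y] linear_add[OF linear_l]
  by (auto simp: plane_def algebra_simps)

lemma plane_scale: "x \<in> plane r \<Longrightarrow> c *\<^sub>R x \<in> plane (c * r)"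
  using linear_scale[OF linear_l]
  by (auto simp: plane_def in_keys_iff lookup_scaleR)

lemma plane_diff: "x \<in> plane r \<Longrightarrow> y \<in> plane s \<Longrightarrow> x - y \<in> plane (r - s)"
  using plane_add[of x r "(-1) *\<^sub>R y" "(-1) * s"] plane_scale[of y s "-1"] by simp

lemma zero_plane: "0 \<in> plane 0"
  using linear_0[OF linear_l] by (simp add: plane_def)

lemma plane_sum: "(\<And>k. k \<in> K \<Longrightarrow> x k \<in> plane 0) \<Longrightarrow> (\<Sum>k\<in>K. x k) \<in> plane 0"
  by (induction K rule: infinite_finite_induct) (use plane_add[of _ 0 _ 0] zero_plane in auto)

lemma g_plane: "g \<in> plane (real g0)"
  using keys_g l_g by (simp add: plane_def)

text \<open>
  A point \<open>f\<close> of the plane lies on a line through two points of the polytope: moving from \<open>f\<close> far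
  enough towards the positive point \<open>g / g0\<close> makes all coordinates nonnegative.
\<close>

lemma affine_hull_slice: "affine hull slice 1 = plane 1"
proof
  have "u *\<^sub>R x + v *\<^sub>R y \<in> plane 1" if "x \<in> plane 1" "y \<in> plane 1" "u + v = 1" for x y u v
    using plane_add[OF plane_scale[OF that(1), of u] plane_scale[OF that(2), of v]] that(3) by simp
  then have "affine (plane 1)"
    by (simp add: affine_def)
  then show "affine hull slice 1 \<subseteq> plane 1"
    by (intro hull_minimal) (auto simp: slice_def)
  show "plane 1 \<subseteq> affine hull slice 1"
  proof
    fix f assume f: "f \<in> plane 1"
    define h where "h = (1 / real g0) *\<^sub>R g"
    have h: "h \<in> plane 1"
      using plane_scale[OF g_plane, of "1 / real g0"] g0_pos by (simp add: h_def)
    have h_ge: "lookup h a \<ge> 1 / real g0" if "a \<in> A" for a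
      using g_ge_1[OF that] g0_pos by (simp add: h_def lookup_scaleR divide_simps)
    then have h_slice: "h \<in> slice 1"
      using h g0_pos by (force simp: slice_def intro: order_trans[rotated])
    define t where "t = real g0 * (\<Sum>a\<in>A. \<bar>lookup f a\<bar>)"
    have t: "t \<ge> 0"
      by (simp add: t_def sum_nonneg)
    define y where "y = (1 / (1 + t)) *\<^sub>R (f + t *\<^sub>R h)"
    have "f + t *\<^sub>R h \<in> plane (1 + t)"
      using plane_add[OF f plane_scale[OF h, of t]] by simp
    then have "y \<in> plane 1"
      using plane_scale[of "f + t *\<^sub>R h" "1 + t" "1 / (1 + t)"] t by (simp add: y_def)
    moreover have "0 \<le> lookup y a" if "a \<in> A" for a
    proof -
      have "\<bar>lookup f a\<bar> \<le> (\<Sum>a\<in>A. \<bar>lookup f a\<bar>)"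
        using that finite_A by (intro member_le_sum) auto
      also have "\<dots> = t * (1 / real g0)"
        using g0_pos by (simp add: t_def)
      also have "\<dots> \<le> t * lookup h a"
        using h_ge[OF that] t by (intro mult_left_mono) auto
      finally have "0 \<le> lookup f a + t * lookup h a"
        by linarith
      then show ?thesis
        using t by (simp add: y_def lookup_scaleR lookup_add)
    qed
    ultimately have y: "y \<in> slice 1"
      by (simp add: slice_def)
    have "(1 + t) *\<^sub>R y + (- t) *\<^sub>R h \<in> affine hull slice 1"
      using h_slice y by (intro mem_affine) (auto simp: hull_inc)
    moreover have "(1 + t) *\<^sub>R y + (- t) *\<^sub>R h = f"
      using t by (simp add: y_def)
    ultimately show "f \<in> affine hull slice 1"
      by simp
  qed
qed

lemma integer_points_add: "x \<in> integer_points \<Longrightarrow> y \<in> integer_points \<Longrightarrow> x + y \<in> integer_points"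
  for x y :: "'a \<Rightarrow>\<^sub>0 real"
  by (simp add: integer_points_def lookup_add)

lemma integer_points_diff: "x \<in> integer_points \<Longrightarrow> y \<in> integer_points \<Longrightarrow> x - y \<in> integer_points"
  for x y :: "'a \<Rightarrow>\<^sub>0 real"
  by (simp add: integer_points_def lookup_minus)

lemma integer_points_scale: "x \<in> integer_points \<Longrightarrow> c \<in> \<int> \<Longrightarrow> c *\<^sub>R x \<in> integer_points"
  for x :: "'a \<Rightarrow>\<^sub>0 real"
  by (simp add: integer_points_def lookup_scaleR)

lemma integer_points_sum: "(\<And>k. k \<in> K \<Longrightarrow> x k \<in> integer_points) \<Longrightarrow> (\<Sum>k\<in>K. x k) \<in> integer_points"
  for x :: "'k \<Rightarrow> 'a \<Rightarrow>\<^sub>0 real"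
  by (auto simp: integer_points_def lookup_sum intro!: Ints_sum)

text \<open>
  If a solution of the equations is determined by its coordinates in \<open>B\<close>, and if there are integral
  directions dual to these coordinates, then the coordinates in \<open>B\<close> form a lattice frame.
\<close>

lemma lattice_frame_free_coordinates:
  assumes "B \<subseteq> A" and e: "bij_betw e {..<d} B"
    and p: "p \<in> plane 1 \<inter> integer_points" "\<And>a. a \<in> B \<Longrightarrow> lookup p a = 0"
    and v: "\<And>a. a \<in> B \<Longrightarrow> v a \<in> plane 0 \<inter> integer_points"
    and delta: "\<And>a a'. a \<in> B \<Longrightarrow> a' \<in> B \<Longrightarrow> lookup (v a) a' = (if a' = a then 1 else 0)"
    and determined: "\<And>f. f \<in> plane 0 \<Longrightarrow> (\<And>a. a \<in> B \<Longrightarrow> lookup f a = 0) \<Longrightarrow> f = 0"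
  shows "lattice_frame (slice 1) d p (v \<circ> e)"
proof -
  let ?c = "affine_chart d p (v \<circ> e)"
  have e_in: "e k \<in> B" if "k < d" for k
    using bij_betwE[OF e] that by simp
  have coord: "lookup (?c x) (e k) = x k" if "k < d" for x k
  proof -
    have "(\<Sum>j<d. x j * lookup ((v \<circ> e) j) (e k)) = (\<Sum>j<d. if j = k then x j else 0)"
      using e_in that inj_onD[OF bij_betw_imp_inj_on[OF e]] by (intro sum.cong) (auto simp: delta)
    then show ?thesis
      using that p(2)[OF e_in[OF that]] by (simp add: lookup_affine_chart)
  qed
  have in_plane: "?c x \<in> plane 1" for x
  proof -
    have "(\<Sum>k<d. x k *\<^sub>R (v \<circ> e) k) \<in> plane 0"
      using v e_in plane_scale[of "v _" 0] by (intro plane_sum) auto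
    then show ?thesis
      using plane_add[of p 1 _ 0] p(1) by (simp add: affine_chart_def)
  qed
  have in_int: "?c x \<in> integer_points" if "x \<in> {..<d} \<rightarrow>\<^sub>E \<int>" for x
    unfolding affine_chart_def using p(1) v e_in that
    by (intro integer_points_add integer_points_sum integer_points_scale) (auto simp: PiE_iff)
  have inj: "inj_on ?c ({..<d} \<rightarrow>\<^sub>E X)" for X
  proof (rule inj_onI)
    fix x y assume x: "x \<in> {..<d} \<rightarrow>\<^sub>E X" and y: "y \<in> {..<d} \<rightarrow>\<^sub>E X" and eq: "?c x = ?c y"
    show "x = y"
    proof (rule PiE_ext[OF x y])
      fix k assume "k \<in> {..<d}"
      then show "x k = y k"
        using coord[of k x] coord[of k y] eq by simp
    qed
  qed
  have surj: "\<exists>x\<in>{..<d} \<rightarrow>\<^sub>E UNIV. f = ?c x \<and> (\<forall>k<d. x k = lookup f (e k))"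
    if f: "f \<in> plane 1" for f
  proof -
    define x where "x = (\<lambda>k\<in>{..<d}. lookup f (e k))"
    have "f - ?c x = 0"
    proof (rule determined)
      show "f - ?c x \<in> plane 0"
        using plane_diff[OF f in_plane[of x]] by simp
      fix a assume "a \<in> B"
      then obtain k where "k < d" "a = e k"
        using e by (auto simp: bij_betw_def)
      then show "lookup (f - ?c x) a = 0"
        using coord[of k x] by (simp add: lookup_minus x_def)
    qed
    then show ?thesis
      by (intro bexI[of _ x]) (auto simp: x_def)
  qed
  have "?c ` ({..<d} \<rightarrow>\<^sub>E UNIV) = plane 1"
    using surj in_plane by blast
  moreover have "?c ` ({..<d} \<rightarrow>\<^sub>E \<int>) = plane 1 \<inter> integer_points"
  proof
    show "?c ` ({..<d} \<rightarrow>\<^sub>E \<int>) \<subseteq> plane 1 \<inter> integer_points"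
      using in_plane in_int by blast
    show "plane 1 \<inter> integer_points \<subseteq> ?c ` ({..<d} \<rightarrow>\<^sub>E \<int>)"
    proof
      fix f assume f: "f \<in> plane 1 \<inter> integer_points"
      then obtain x where "x \<in> {..<d} \<rightarrow>\<^sub>E UNIV" "f = ?c x" "\<forall>k<d. x k = lookup f (e k)"
        using surj by blast
      then show "f \<in> ?c ` ({..<d} \<rightarrow>\<^sub>E \<int>)"
        using f by (intro image_eqI[of _ _ x]) (auto simp: integer_points_def PiE_iff)
    qed
  qed
  ultimately show ?thesis
    using inj by (simp add: lattice_frame_def affine_hull_slice bij_betw_def)
qed

definition point_count :: "nat \<Rightarrow> nat" where
  "point_count N = card (slice (real N) \<inter> integer_points)"

context
  fixes d p b
  assumes frame: "lattice_frame (slice 1) d p b"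
    and finite_points: "\<And>N. finite (slice (real N) \<inter> integer_points)"
begin

lemma chart_bij: "bij_betw (affine_chart d p b) ({..<d} \<rightarrow>\<^sub>E UNIV) (plane 1)"
  and chart_bij_int: "bij_betw (affine_chart d p b) ({..<d} \<rightarrow>\<^sub>E \<int>) (plane 1 \<inter> integer_points)"
  using frame by (auto simp: lattice_frame_def affine_hull_slice)

lemma base_in: "p \<in> plane 1 \<inter> integer_points"
proof -
  have "affine_chart d p b (\<lambda>k\<in>{..<d}. 0) \<in> plane 1 \<inter> integer_points"
    by (rule bij_betwE[OF chart_bij_int, rule_format]) auto
  moreover have "affine_chart d p b (\<lambda>k\<in>{..<d}. 0) = p"
    by (simp add: affine_chart_def)
  ultimately show ?thesis
    by simp
qed

lemma direction_in:
  assumes "k < d"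
  shows "b k \<in> plane 0 \<inter> integer_points"
proof -
  let ?e = "\<lambda>j\<in>{..<d}. if j = k then 1 else 0 :: real"
  have "affine_chart d p b ?e \<in> plane 1 \<inter> integer_points"
    by (rule bij_betwE[OF chart_bij_int, rule_format]) auto
  moreover have "affine_chart d p b ?e = p + b k"
  proof -
    have "(\<Sum>j<d. ?e j *\<^sub>R b j) = (\<Sum>j<d. if j = k then b k else 0)"
      by (rule sum.cong) auto
    then show ?thesis
      using assms by (simp add: affine_chart_def)
  qed
  ultimately show ?thesis
    using base_in plane_diff[of "p + b k" 1 p 1] integer_points_diff[of "p + b k" p] by auto
qed

text \<open>
  Bounds the change of a coordinate within a unit cube of the chart.
\<close>

definition margin :: nat where
  "margin = nat \<lceil>\<Sum>a\<in>A. \<Sum>k<d. \<bar>lookup (b k) a\<bar>\<rceil>"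

lemma margin:
  assumes "a \<in> A"
  shows "(\<Sum>k<d. \<bar>lookup (b k) a\<bar>) \<le> real margin"
proof -
  let ?h = "\<lambda>a. (\<Sum>k<d. \<bar>lookup (b k) a\<bar>)"
  have "?h a \<le> (\<Sum>a\<in>A. ?h a)"
    using assms finite_A by (intro member_le_sum) (auto intro!: sum_nonneg)
  also have "\<dots> \<le> real margin"
    unfolding margin_def by linarith
  finally show ?thesis .
qed

lemma margin_combination:
  assumes "a \<in> A" "\<And>k. k < d \<Longrightarrow> 0 \<le> t k \<and> t k \<le> M"  "M \<ge> 0"
  shows "\<bar>\<Sum>k<d. t k * lookup (b k) a\<bar> \<le> M * real margin"
proof -
  have "\<bar>\<Sum>k<d. t k * lookup (b k) a\<bar> \<le> (\<Sum>k<d. \<bar>t k * lookup (b k) a\<bar>)"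
    by (rule sum_abs)
  also have "\<dots> \<le> (\<Sum>k<d. M * \<bar>lookup (b k) a\<bar>)"
    using assms(2) by (intro sum_mono) (auto simp: abs_mult intro!: mult_right_mono)
  also have "\<dots> \<le> M * real margin"
    unfolding sum_distrib_left[symmetric] using margin[OF assms(1)] assms(3)
    by (intro mult_left_mono) auto
  finally show ?thesis .
qed

text \<open>
  The chart scaled to the \<open>r\<close>-th dilate, whose base point is \<open>r p\<close>: a vector \<open>m\<close> corresponds to the
  point \<open>m / r\<close> of the original chart.
\<close>

definition lattice_point :: "real \<Rightarrow> (nat \<Rightarrow> real) \<Rightarrow> 'a \<Rightarrow>\<^sub>0 real" where
  "lattice_point r m = r *\<^sub>R p + (\<Sum>k<d. m k *\<^sub>R b k)"

lemma lookup_lattice_point: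
  "lookup (lattice_point r m) a =
    r * lookup p a + (\<Sum>k<d. m k * lookup (b k) a)"
  by (simp add: lattice_point_def lookup_add lookup_sum lookup_scaleR)

lemma lattice_point_eq_chart: "lattice_point r m = (r - 1) *\<^sub>R p + affine_chart d p b m"
  by (simp add: lattice_point_def affine_chart_def algebra_simps)

lemma lattice_point_plane: "lattice_point r m \<in> plane r"
  unfolding lattice_point_def
  using plane_add[OF plane_scale[of p 1 r] plane_sum[of "{..<d}" "\<lambda>k. m k *\<^sub>R b k"]]
    plane_scale[of "b _" 0] base_in direction_in by force

lemma lattice_point_int:
  assumes "r \<in> \<int>" "\<And>k. k < d \<Longrightarrow> m k \<in> \<int>"
  shows "lattice_point r m \<in> integer_points"
  unfolding lattice_point_def
  using assms base_in direction_in
  by (intro integer_points_add integer_points_sum integer_points_scale) auto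

lemma inj_lattice_point: "inj_on (lattice_point r) ({..<d} \<rightarrow>\<^sub>E UNIV)"
  using bij_betw_imp_inj_on[OF chart_bij] by (auto simp: inj_on_def lattice_point_eq_chart)

lemma inj_lattice_point_shift: "inj_on (\<lambda>m. lattice_point r m + c *\<^sub>R g) ({..<d} \<rightarrow>\<^sub>E \<int>)"
  by (rule inj_onI) (use inj_lattice_point[of r] PiE_mono[of "{..<d}" "\<lambda>_. \<int>" "\<lambda>_. UNIV"] in
    \<open>auto dest!: inj_onD\<close>)

lemma lattice_point_surj:
  assumes "z \<in> plane r \<inter> integer_points" "r \<in> \<int>"
  shows "\<exists>m\<in>{..<d} \<rightarrow>\<^sub>E \<int>. z = lattice_point r m"
proof -
  have "z - (r - 1) *\<^sub>R p \<in> plane 1 \<inter> integer_points"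
    using assms base_in plane_diff[of z r "(r - 1) *\<^sub>R p" "r - 1"] plane_scale[of p 1 "r - 1"]
    by (auto intro!: integer_points_diff integer_points_scale)
  then obtain m where "m \<in> {..<d} \<rightarrow>\<^sub>E \<int>" "affine_chart d p b m = z - (r - 1) *\<^sub>R p"
    using chart_bij_int unfolding bij_betw_def by (metis (no_types, lifting) imageE)
  then show ?thesis
    by (intro bexI[of _ m]) (auto simp: lattice_point_eq_chart)
qed

text \<open>
  Adding \<open>c\<close> copies of \<open>g\<close> turns lattice points with coordinates at least \<open>-c\<close> into nonnegative
  ones.
\<close>

lemma card_lattice_points_le:
  assumes "S \<subseteq> {..<d} \<rightarrow>\<^sub>E \<int>"
    and "\<And>m a. m \<in> S \<Longrightarrow> a \<in> A \<Longrightarrow> - real c \<le> lookup (lattice_point (real N) m) a"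
  shows "finite S \<and> card S \<le> point_count (N + c * g0)"
proof -
  let ?f = "\<lambda>m. lattice_point (real N) m + real c *\<^sub>R g"
  have inj: "inj_on ?f S"
    by (rule inj_on_subset[OF inj_lattice_point_shift assms(1)])
  have "?f m \<in> slice (real (N + c * g0)) \<inter> integer_points" if m: "m \<in> S" for m
  proof -
    have "?f m \<in> plane (real (N + c * g0))"
      using plane_add[OF lattice_point_plane plane_scale[OF g_plane]] by simp
    moreover have "?f m \<in> integer_points"
      using m assms(1) g_int
      by (intro integer_points_add lattice_point_int integer_points_scale) (auto simp: PiE_iff)
    moreover have "0 \<le> lookup (?f m) a" if "a \<in> A" for a
    proof -
      have "real c \<le> real c * lookup g a"
        using mult_left_mono[OF g_ge_1[OF that], of "real c"] by simp
      then show ?thesis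
        using assms(2)[OF m that] by (simp add: lookup_add lookup_scaleR)
    qed
    ultimately show ?thesis
      by (simp add: slice_def)
  qed
  then have "?f ` S \<subseteq> slice (real (N + c * g0)) \<inter> integer_points"
    by blast
  then show ?thesis
    unfolding point_count_def
    using inj_on_finite[OF inj _ finite_points] card_inj_on_le[OF inj _ finite_points] by blast
qed

definition chart_region :: "(nat \<Rightarrow> real) set" where
  "chart_region = {x \<in> {..<d} \<rightarrow>\<^sub>E UNIV. affine_chart d p b x \<in> slice 1}"

lemma chart_region_eq:
  "chart_region = {x \<in> {..<d} \<rightarrow>\<^sub>E UNIV. \<forall>a\<in>A. 0 \<le> lookup (affine_chart d p b x) a}"
  using bij_betwE[OF chart_bij] by (auto simp: chart_region_def slice_def)

abbreviation lebesgue_d :: "(nat \<Rightarrow> real) measure" where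
  "lebesgue_d \<equiv> Pi\<^sub>M {..<d} (\<lambda>_. lborel)"

lemma chart_region_sets [measurable]: "chart_region \<in> sets lebesgue_d"
proof -
  have "chart_region = {x \<in> space lebesgue_d. \<forall>a\<in>A. 0 \<le> lookup p a +
      (\<Sum>k<d. x k * lookup (b k) a)}"
    by (simp add: chart_region_eq space_PiM lookup_affine_chart)
  also have "\<dots> \<in> sets lebesgue_d"
    using finite_A by (auto intro!: sets.sets_Collect_finite_All' simp: )
  finally show ?thesis .
qed

definition grid_cube :: "nat \<Rightarrow> (nat \<Rightarrow> real) \<Rightarrow> (nat \<Rightarrow> real) set" where
  "grid_cube N m = (\<Pi>\<^sub>E k\<in>{..<d}. {m k / real N..<(m k + 1) / real N})"

lemma grid_cube_sets [measurable]: "grid_cube N m \<in> sets lebesgue_d"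
  unfolding grid_cube_def by (intro sets_PiM_I_finite) auto

lemma emeasure_grid_cube: "N > 0 \<Longrightarrow> emeasure lebesgue_d (grid_cube N m) = ennreal ((1 / real N) ^ d)"
proof -
  assume N: "N > 0"
  interpret product_sigma_finite "\<lambda>_::nat. lborel"
    by unfold_locales
  have "emeasure lebesgue_d (grid_cube N m) =
      (\<Prod>k<d. emeasure lborel {m k / real N..<(m k + 1) / real N})"
    unfolding grid_cube_def by (intro emeasure_PiM) auto
  also have "\<dots> = (\<Prod>k<d. ennreal (1 / real N))"
    using N by (intro prod.cong) (auto simp: divide_right_mono add_divide_distrib)
  finally show ?thesis
    by (simp add: ennreal_power)
qed

text \<open>
  The grid cubes that meet the polytope cover it. After scaling by \<open>N\<close>, the coordinates of their
  corners are at least \<open>-margin\<close>.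
\<close>

lemma emeasure_region_le:
  assumes "N > 0"
  shows "emeasure lebesgue_d chart_region \<le>
    ennreal (real (point_count (N + margin * g0)) * (1 / real N) ^ d)"
proof -
  define S where "S = {m \<in> {..<d} \<rightarrow>\<^sub>E \<int>.
    \<forall>a\<in>A. - real margin \<le> lookup (lattice_point (real N) m) a}"
  have S: "finite S" "card S \<le> point_count (N + margin * g0)"
    using card_lattice_points_le[of S margin N] by (auto simp: S_def)
  have "chart_region \<subseteq> (\<Union>m\<in>S. grid_cube N m)"
  proof
    fix x assume x: "x \<in> chart_region"
    define m where "m = (\<lambda>k\<in>{..<d}. real_of_int \<lfloor>real N * x k\<rfloor>)"
    have "x \<in> grid_cube N m"
    proof -
      have "m k / real N \<le> x k \<and> x k < (m k + 1) / real N" if "k < d" for k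
        using assms that by (auto simp: m_def divide_simps mult.commute)
      moreover have "x \<in> extensional {..<d}"
        using x by (simp add: chart_region_def PiE_iff)
      ultimately show ?thesis
        by (simp add: grid_cube_def PiE_iff)
    qed
    moreover have "m \<in> S"
    proof -
      have "- real margin \<le> lookup (lattice_point (real N) m) a" if a: "a \<in> A" for a
      proof -
        let ?t = "\<lambda>k. real N * x k - m k"
        have "\<bar>\<Sum>k<d. ?t k * lookup (b k) a\<bar> \<le> 1 * real margin"
          using a by (intro margin_combination) (auto simp: m_def, linarith)
        moreover have "lookup (lattice_point (real N) m) a =
            real N * lookup (affine_chart d p b x) a -
            (\<Sum>k<d. ?t k * lookup (b k) a)"
          by (simp add: lookup_lattice_point lookup_affine_chart algebra_simps sum_distrib_left
              sum_subtractf)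
        moreover have "0 \<le> real N * lookup (affine_chart d p b x) a"
          using x a by (simp add: chart_region_eq)
        ultimately show ?thesis
          by linarith
      qed
      then show ?thesis
        by (auto simp: S_def m_def)
    qed
    ultimately show "x \<in> (\<Union>m\<in>S. grid_cube N m)"
      by blast
  qed
  then have "emeasure lebesgue_d chart_region \<le> emeasure lebesgue_d (\<Union>m\<in>S. grid_cube N m)"
    using S by (intro emeasure_mono sets.finite_UN) auto
  also have "\<dots> \<le> (\<Sum>m\<in>S. emeasure lebesgue_d (grid_cube N m))"
    using S by (intro emeasure_subadditive_finite) auto
  also have "\<dots> = ennreal (real (card S) * (1 / real N) ^ d)"
    using assms by (simp add: emeasure_grid_cube ennreal_mult ennreal_of_nat_eq_real_of_nat)
  also have "\<dots> \<le> ennreal (real (point_count (N + margin * g0)) * (1 / real N) ^ d)"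
    using S by (intro ennreal_leI mult_right_mono) auto
  finally show ?thesis .
qed

lemma disjoint_grid_cubes:
  assumes "N > 0" "m \<in> {..<d} \<rightarrow>\<^sub>E \<int>" "m' \<in> {..<d} \<rightarrow>\<^sub>E \<int>" "m \<noteq> m'"
  shows "grid_cube N m \<inter> grid_cube N m' = {}"
proof -
  have "m = m'" if x: "x \<in> grid_cube N m" "x \<in> grid_cube N m'" for x
  proof (rule PiE_ext[OF assms(2,3)])
    fix k assume k: "k \<in> {..<d}"
    have floor: "y k = real_of_int \<lfloor>real N * x k\<rfloor>" if "y \<in> {..<d} \<rightarrow>\<^sub>E \<int>" "x \<in> grid_cube N y" for y
    proof -
      have "y k \<in> \<int>"
        using that k by (auto simp: PiE_iff)
      then obtain i where i: "y k = of_int i"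
        by (rule Ints_cases)
      have "y k / real N \<le> x k" "x k < (y k + 1) / real N"
        using that k by (auto simp: grid_cube_def PiE_iff)
      then have "real_of_int i \<le> real N * x k" "real N * x k < real_of_int i + 1"
        using assms(1) by (auto simp: i divide_simps mult.commute)
      then show ?thesis
        using i by (simp add: floor_unique)
    qed
    show "m k = m' k"
      using floor[of m] floor[of m'] x assms by simp
  qed
  then show ?thesis
    using assms(4) by blast
qed

text \<open>
  A grid cube lies inside the polytope if, after scaling, the coordinates of its corner are at least
  \<open>margin\<close>. Such corners arise from the points of the \<open>N\<close>-th dilate by adding
  \<open>margin\<close> copies of \<open>g\<close>.
\<close>

lemma region_le_emeasure:
  assumes "N + margin * g0 > 0"
  shows "ennreal (real (point_count N) * (1 / real (N + margin * g0)) ^ d) \<le>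
    emeasure lebesgue_d chart_region"
proof -
  let ?N = "N + margin * g0"
  define S where "S = {m \<in> {..<d} \<rightarrow>\<^sub>E \<int>.
    lattice_point (real ?N) m - real margin *\<^sub>R g \<in> slice (real N) \<inter> integer_points}"
  have S: "finite S \<and> point_count N \<le> card S"
  proof
    have inj: "inj_on (\<lambda>m. lattice_point (real ?N) m - real margin *\<^sub>R g) S"
      using inj_on_subset[OF inj_lattice_point_shift[of "real ?N" "- real margin"], of S]
      by (auto simp: S_def)
    show fin: "finite S"
      by (rule inj_on_finite[OF inj _ finite_points[of N]]) (auto simp: S_def)
    have "slice (real N) \<inter> integer_points \<subseteq> (\<lambda>m. lattice_point (real ?N) m - real margin *\<^sub>R g) ` S"
    proof
      fix z assume z: "z \<in> slice (real N) \<inter> integer_points"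
      have "z + real margin *\<^sub>R g \<in> plane (real ?N) \<inter> integer_points"
        using z g_int plane_add[of z "real N" "real margin *\<^sub>R g" "real margin * real g0"]
          plane_scale[OF g_plane, of "real margin"]
        by (auto simp: slice_def intro!: integer_points_add integer_points_scale)
      then obtain m where "m \<in> {..<d} \<rightarrow>\<^sub>E \<int>" "z + real margin *\<^sub>R g = lattice_point (real ?N) m"
        using lattice_point_surj[of _ "real ?N"] by auto
      moreover from this have "z = lattice_point (real ?N) m - real margin *\<^sub>R g"
        by (simp add: algebra_simps)
      ultimately show "z \<in> (\<lambda>m. lattice_point (real ?N) m - real margin *\<^sub>R g) ` S"
        using z by (auto simp: S_def)
    qed
    then show "point_count N \<le> card S"
      unfolding point_count_def using fin by (rule surj_card_le[rotated])
  qed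
  have "(\<Union>m\<in>S. grid_cube ?N m) \<subseteq> chart_region"
  proof
    fix x assume "x \<in> (\<Union>m\<in>S. grid_cube ?N m)"
    then obtain m where m: "m \<in> S" and x: "x \<in> grid_cube ?N m"
      by blast
    have "0 \<le> lookup (affine_chart d p b x) a" if a: "a \<in> A" for a
    proof -
      let ?t = "\<lambda>k. real ?N * x k - m k"
      have "0 \<le> ?t k \<and> ?t k \<le> 1" if "k < d" for k
      proof -
        have "m k / real ?N \<le> x k" "x k < (m k + 1) / real ?N"
          using x that by (auto simp: grid_cube_def PiE_iff)
        moreover have "0 < real ?N"
          using assms by (simp only: of_nat_0_less_iff)
        ultimately have "m k \<le> x k * real ?N" "x k * real ?N < m k + 1"
          by (simp_all only: pos_divide_le_eq pos_less_divide_eq)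
        then show ?thesis
          by (simp add: mult.commute)
      qed
      then have "\<bar>\<Sum>k<d. ?t k * lookup (b k) a\<bar> \<le> 1 * real margin"
        using a by (intro margin_combination) auto
      moreover have "real ?N * lookup (affine_chart d p b x) a =
          lookup (lattice_point (real ?N) m) a +
          (\<Sum>k<d. ?t k * lookup (b k) a)"
        by (simp add: lookup_lattice_point lookup_affine_chart algebra_simps sum_distrib_left
            sum_subtractf sum.distrib)
      moreover have "real margin \<le> lookup (lattice_point (real ?N) m) a"
      proof -
        have "0 \<le> lookup (lattice_point (real ?N) m - real margin *\<^sub>R g) a"
          using m a by (simp add: S_def slice_def)
        moreover have "real margin \<le> real margin * lookup g a"
          using mult_left_mono[OF g_ge_1[OF a], of "real margin"] by simp
        ultimately show ?thesis
          by (simp add: lookup_minus lookup_scaleR)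
      qed
      ultimately have "0 \<le> real ?N * lookup (affine_chart d p b x) a"
        by linarith
      then show ?thesis
        using assms by (metis mult_pos_neg not_less of_nat_0_less_iff)
    qed
    then show "x \<in> chart_region"
      using x by (auto simp: chart_region_eq grid_cube_def PiE_iff)
  qed
  then have *: "emeasure lebesgue_d (\<Union>m\<in>S. grid_cube ?N m) \<le> emeasure lebesgue_d chart_region"
    by (intro emeasure_mono) auto
  have "ennreal (real (point_count N) * (1 / real ?N) ^ d) \<le> ennreal (real (card S) * (1 / real ?N) ^ d)"
    using S by (intro ennreal_leI mult_right_mono) auto
  also have "\<dots> = (\<Sum>m\<in>S. emeasure lebesgue_d (grid_cube ?N m))"
    unfolding emeasure_grid_cube[OF assms]
    by (simp add: ennreal_mult ennreal_of_nat_eq_real_of_nat)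
  also have "\<dots> = emeasure lebesgue_d (\<Union>m\<in>S. grid_cube ?N m)"
    using S disjoint_grid_cubes[OF assms]
    by (intro sum_emeasure) (auto simp: disjoint_family_on_def S_def)
  also note *
  finally show ?thesis .
qed

text \<open>
  The limit \<open>c\<close> and its exponent \<open>D\<close> are independent of the frame, hence so are the dimension and the
  measure of the region.
\<close>

lemma volume_eq_limit:
  assumes lim: "(\<lambda>N. real (point_count N) / real N ^ D) \<longlonglongrightarrow> c" and c: "c > 0"
  shows "d = D \<and> measure lebesgue_d chart_region = c"
proof -
  define C where "C = margin * g0"
  define \<mu> where "\<mu> = measure lebesgue_d chart_region"
  have "emeasure lebesgue_d chart_region < \<infinity>"
    by (rule le_less_trans[OF emeasure_region_le[of 1]]) auto
  then have \<mu>: "emeasure lebesgue_d chart_region = ennreal \<mu>" "\<mu> \<ge> 0"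
    by (simp_all add: \<mu>_def emeasure_eq_ennreal_measure)
  have upper: "\<mu> \<le> real (point_count (N + C)) / real N ^ d" if "N > 0" for N
  proof -
    have "\<mu> \<le> real (point_count (N + C)) * (1 / real N) ^ d"
    proof (rule iffD1[OF ennreal_le_iff])
      show "ennreal \<mu> \<le> ennreal (real (point_count (N + C)) * (1 / real N) ^ d)"
        using emeasure_region_le[OF that] unfolding \<mu>(1) C_def .
    qed simp
    then show ?thesis
      by (simp add: power_one_over)
  qed
  have lower: "real (point_count N) \<le> \<mu> * real (N + C) ^ d" if "N > 0" for N
  proof -
    have "real (point_count N) * (1 / real (N + C)) ^ d \<le> \<mu>"
    proof (rule iffD1[OF ennreal_le_iff[OF \<mu>(2)]])
      show "ennreal (real (point_count N) * (1 / real (N + C)) ^ d) \<le> ennreal \<mu>"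
        using region_le_emeasure[OF trans_less_add1[OF that]] unfolding \<mu>(1) C_def .
    qed
    then have "real (point_count N) / real (N + C) ^ d \<le> \<mu>"
      by (simp only: power_one_over mult_1_right times_divide_eq_right)
    moreover have "0 < real (N + C) ^ d"
      using that by simp
    ultimately show ?thesis
      by (simp only: pos_divide_le_eq)
  qed
  show ?thesis
    using dimension_and_volume_from_counts[OF upper lower \<mu>(2) lim c] unfolding \<mu>_def .
qed

end

theorem normalized_volume_slice:
  assumes "\<And>N. finite (slice (real N) \<inter> integer_points)"
    and "(\<lambda>N. real (point_count N) / real N ^ D) \<longlonglongrightarrow> c" and "c > 0"
    and "lattice_frame (slice 1) D p b"
  shows "normalized_volume (slice 1) = fact D * c"
  unfolding normalized_volume_def
proof (rule the_equality)
  show "\<exists>d p b. lattice_frame (slice 1) d p b \<and> fact D * c =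
      fact d * measure (Pi\<^sub>M {..<d} (\<lambda>_. lborel)) {x \<in> {..<d} \<rightarrow>\<^sub>E UNIV. affine_chart d p b x \<in> slice 1}"
    using volume_eq_limit[OF assms(4,1,2,3)] assms(4)
    by (intro exI[of _ D] exI[of _ p] exI[of _ b]) (simp add: chart_region_def[OF assms(4,1)])
next
  fix v assume "\<exists>d p b. lattice_frame (slice 1) d p b \<and> v =
      fact d * measure (Pi\<^sub>M {..<d} (\<lambda>_. lborel)) {x \<in> {..<d} \<rightarrow>\<^sub>E UNIV. affine_chart d p b x \<in> slice 1}"
  then obtain d p b where *: "lattice_frame (slice 1) d p b" "v =
      fact d * measure (Pi\<^sub>M {..<d} (\<lambda>_. lborel)) {x \<in> {..<d} \<rightarrow>\<^sub>E UNIV. affine_chart d p b x \<in> slice 1}"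
    by blast
  have "d = D" "measure (Pi\<^sub>M {..<d} (\<lambda>_. lborel))
      {x \<in> {..<d} \<rightarrow>\<^sub>E UNIV. affine_chart d p b x \<in> slice 1} = c"
    using volume_eq_limit[OF *(1) assms(1,2,3)] unfolding chart_region_def[OF *(1) assms(1)]
    by blast+
  then show "v = fact D * c"
    using *(2) by metis
qed

end

section \<open>Counting integral flows\<close>

definition arcs_of :: "(nat \<times> nat) multiset \<Rightarrow> ((nat \<times> nat) \<times> nat) set" where
  "arcs_of M = {(e, k). k < count M e}"

definition incidence :: "(nat \<times> nat) \<times> nat \<Rightarrow> nat \<Rightarrow> real" where
  "incidence a v = (if fst (fst a) = v then 1 else 0) - (if snd (fst a) = v then 1 else 0)"

text \<open>
  Here \<open>inc a v\<close> is the contribution of one unit on the arc \<open>a\<close> to the net outflow of the vertex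
  \<open>v\<close>.
\<close>

definition flows :: "('a \<Rightarrow> 'v \<Rightarrow> real) \<Rightarrow> 'a set \<Rightarrow> ('v \<Rightarrow> real) \<Rightarrow> ('a \<Rightarrow> nat) set" where
  "flows inc A y = {f. (\<forall>a. a \<notin> A \<longrightarrow> f a = 0) \<and> (\<forall>v. (\<Sum>a\<in>A. real (f a) * inc a v) = y v)}"

lemma arcs_of_conv_Sigma: "arcs_of M = Sigma (set_mset M) (\<lambda>e. {..<count M e})"
  by (auto simp: arcs_of_def not_in_iff intro: ccontr)

lemma mem_arcs_of: "(e, k) \<in> arcs_of M \<Longrightarrow> e \<in># M"
  by (simp add: arcs_of_conv_Sigma)

lemma finite_arcs_of [simp]: "finite (arcs_of M)"
  by (simp add: arcs_of_conv_Sigma)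

lemma card_arcs_of: "card (arcs_of M) = size M"
  by (simp add: arcs_of_conv_Sigma size_multiset_overloaded_eq)

lemma arcs_of_add_mset: "arcs_of (add_mset e M) = insert (e, count M e) (arcs_of M)"
  by (auto simp: arcs_of_def split: if_splits)

lemma arcs_of_fresh: "(e, count M e) \<notin> arcs_of M"
  by (simp add: arcs_of_def)

text \<open>
  The arc \<open>\<gamma>\<close> is a shortcut for \<open>\<alpha>\<close> followed by \<open>\<beta>\<close>. Moving \<open>min (f \<alpha>) (f \<beta>)\<close> units to the shortcut
  empties \<open>\<beta>\<close> if \<open>f \<beta> \<le> f \<alpha>\<close>, and it empties \<open>\<alpha>\<close> but not \<open>\<beta>\<close> if \<open>f \<alpha> < f \<beta>\<close>. The last set on the right
  consists of the flows of the second kind and of those that vanish on \<open>\<beta>\<close>, which are counted on the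
  left.
\<close>

lemma card_flows_exchange:
  assumes A: "finite A" and fresh: "\<alpha> \<notin> A" "\<beta> \<notin> A" "\<gamma> \<notin> A"
    and distinct: "\<alpha> \<noteq> \<beta>" "\<alpha> \<noteq> \<gamma>" "\<beta> \<noteq> \<gamma>"
    and composite: "\<And>v. inc \<gamma> v = inc \<alpha> v + inc \<beta> v"
    and finite: "finite (flows inc (insert \<alpha> (insert \<beta> A)) y)" "finite (flows inc (insert \<beta> (insert \<gamma> A)) y)"
  shows "card (flows inc (insert \<alpha> (insert \<beta> A)) y) + card (flows inc (insert \<gamma> A) y) =
    card (flows inc (insert \<alpha> (insert \<gamma> A)) y) + card (flows inc (insert \<beta> (insert \<gamma> A)) y)"
proof -
  let ?X0 = "flows inc (insert \<alpha> (insert \<beta> A)) y"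
  let ?X1 = "flows inc (insert \<alpha> (insert \<gamma> A)) y"
  let ?X2 = "flows inc (insert \<beta> (insert \<gamma> A)) y"
  define S where "S f v = (\<Sum>a\<in>A. real (f a) * inc a v)" for f v
  have S_upd: "S (f(x := k)) = S f" if "x \<notin> A" for f x k
    using that by (auto simp: S_def fun_eq_iff intro!: sum.cong)
  have in_flows: "f \<in> flows inc (insert \<epsilon> (insert \<delta> A)) y \<longleftrightarrow>
      (\<forall>a. a \<notin> insert \<epsilon> (insert \<delta> A) \<longrightarrow> f a = 0) \<and>
      (\<forall>v. real (f \<epsilon>) * inc \<epsilon> v + (real (f \<delta>) * inc \<delta> v + S f v) = y v)"
    if "\<epsilon> \<noteq> \<delta>" "\<epsilon> \<notin> A" "\<delta> \<notin> A" for f \<epsilon> \<delta>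
    using that A by (simp add: flows_def S_def)
  note flow_simps = in_flows S_upd fresh distinct distinct[symmetric] composite fun_upd_twist
  have "bij_betw (\<lambda>f. f(\<alpha> := f \<alpha> - f \<beta>, \<beta> := 0, \<gamma> := f \<beta>)) {f \<in> ?X0. f \<beta> \<le> f \<alpha>} ?X1"
    by (rule bij_betw_byWitness[where f' = "\<lambda>f. f(\<alpha> := f \<alpha> + f \<gamma>, \<beta> := f \<gamma>, \<gamma> := 0)"])
      (auto simp: flow_simps fun_eq_iff of_nat_diff algebra_simps)
  then have 1: "card {f \<in> ?X0. f \<beta> \<le> f \<alpha>} = card ?X1"
    by (rule bij_betw_same_card)
  have "bij_betw (\<lambda>f. f(\<alpha> := 0, \<beta> := f \<beta> - f \<alpha>, \<gamma> := f \<alpha>)) {f \<in> ?X0. f \<alpha> < f \<beta>} {f \<in> ?X2. 0 < f \<beta>}"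
    by (rule bij_betw_byWitness[where f' = "\<lambda>f. f(\<alpha> := f \<gamma>, \<beta> := f \<beta> + f \<gamma>, \<gamma> := 0)"])
      (auto simp: flow_simps fun_eq_iff of_nat_diff algebra_simps)
  then have 2: "card {f \<in> ?X0. f \<alpha> < f \<beta>} = card {f \<in> ?X2. 0 < f \<beta>}"
    by (rule bij_betw_same_card)
  have 3: "{f \<in> ?X2. f \<beta> = 0} = flows inc (insert \<gamma> A) y"
  proof (intro set_eqI iffI)
    fix f assume f: "f \<in> {f \<in> ?X2. f \<beta> = 0}"
    then have "f a = 0" if "a \<notin> insert \<gamma> A" for a
      using that by (cases "a = \<beta>") (auto simp: flows_def)
    moreover have "(\<Sum>a\<in>insert \<gamma> A. real (f a) * inc a v) = y v" for v
    proof -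
      have "real (f \<beta>) * inc \<beta> v + (real (f \<gamma>) * inc \<gamma> v + S f v) = y v"
        using f in_flows[of \<beta> \<gamma> f] distinct fresh by blast
      then show ?thesis
        using f A fresh by (simp add: S_def)
    qed
    ultimately show "f \<in> flows inc (insert \<gamma> A) y"
      by (simp add: flows_def)
  next
    fix f assume f: "f \<in> flows inc (insert \<gamma> A) y"
    then have "f \<beta> = 0"
      using fresh distinct by (auto simp: flows_def)
    moreover have "real (f \<gamma>) * inc \<gamma> v + S f v = y v" for v
      using f A fresh by (simp add: flows_def S_def)
    moreover have "f a = 0" if "a \<notin> insert \<beta> (insert \<gamma> A)" for a
      using f that by (simp add: flows_def)
    ultimately show "f \<in> {f \<in> ?X2. f \<beta> = 0}"
      using in_flows[of \<beta> \<gamma> f] distinct fresh by simp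
  qed
  have "?X0 \<inter> {f. f \<beta> \<le> f \<alpha>} = {f \<in> ?X0. f \<beta> \<le> f \<alpha>}" "?X0 - {f. f \<beta> \<le> f \<alpha>} = {f \<in> ?X0. f \<alpha> < f \<beta>}"
    by auto
  then have "card ?X0 = card {f \<in> ?X0. f \<beta> \<le> f \<alpha>} + card {f \<in> ?X0. f \<alpha> < f \<beta>}"
    using card_Int_Diff[OF finite(1), of "{f. f \<beta> \<le> f \<alpha>}"] by (simp only:)
  moreover have "?X2 \<inter> {f. f \<beta> = 0} = {f \<in> ?X2. f \<beta> = 0}" "?X2 - {f. f \<beta> = 0} = {f \<in> ?X2. 0 < f \<beta>}"
    by auto
  then have "card ?X2 = card {f \<in> ?X2. f \<beta> = 0} + card {f \<in> ?X2. 0 < f \<beta>}"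
    using card_Int_Diff[OF finite(2), of "{f. f \<beta> = 0}"] by (simp only:)
  ultimately show ?thesis
    unfolding 1 2 3 by (simp only: add.assoc add.commute add.left_commute)
qed

definition internal :: "nat \<Rightarrow> (nat \<times> nat) multiset \<Rightarrow> bool" where
  "internal n M \<longleftrightarrow> (\<forall>(u, v)\<in>#M. 1 \<le> u \<and> u < v \<and> v \<le> n + 1)"

text \<open>
  The edges of the graph on \<open>{1..n + 1}\<close> augmented by the source \<open>0\<close> and the sink \<open>n + 2\<close>.
\<close>

definition network :: "nat \<Rightarrow> (nat \<times> nat) multiset \<Rightarrow> (nat \<times> nat) multiset" where
  "network n M = M + mset_set ({0} \<times> {1..n + 1}) + mset_set ({1..n + 1} \<times> {n + 2})"

abbreviation source_arc :: "nat \<Rightarrow> (nat \<times> nat) \<times> nat" where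
  "source_arc i \<equiv> ((0, i), 0)"

abbreviation sink_arc :: "nat \<Rightarrow> nat \<Rightarrow> (nat \<times> nat) \<times> nat" where
  "sink_arc n i \<equiv> ((i, n + 2), 0)"

lemma arcs_of_internal: "internal n M \<Longrightarrow> ((u, v), k) \<in> arcs_of M \<Longrightarrow> 1 \<le> u \<and> u < v \<and> v \<le> n + 1"
proof -
  assume "internal n M" "((u, v), k) \<in> arcs_of M"
  moreover from this have "(u, v) \<in># M"
    by (blast dest: mem_arcs_of)
  ultimately show ?thesis
    by (auto simp: internal_def)
qed

lemma arcs_of_network:
  assumes "internal n M"
  shows "arcs_of (network n M) = arcs_of M \<union> (source_arc ` {1..n + 1} \<union> sink_arc n ` {1..n + 1})"
proof -
  have M0: "count M (u, v) = 0" if "u = 0 \<or> v = n + 2" for u v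
    using assms that by (auto simp: internal_def count_eq_zero_iff)
  show ?thesis
  proof (rule set_eqI)
    fix a :: "(nat \<times> nat) \<times> nat"
    obtain u v k where a: "a = ((u, v), k)"
      by (metis surj_pair)
    show "a \<in> arcs_of (network n M) \<longleftrightarrow>
        a \<in> arcs_of M \<union> (source_arc ` {1..n + 1} \<union> sink_arc n ` {1..n + 1})"
    proof (cases "u = 0 \<or> v = n + 2")
      case True
      then show ?thesis
        using M0[OF True] by (cases "k = 0") (auto simp: a arcs_of_def network_def count_mset_set' image_iff)
    next
      case False
      then show ?thesis
        by (auto simp: a arcs_of_def network_def count_mset_set' image_iff)
    qed
  qed
qed

lemma sum_network:
  fixes h :: "(nat \<times> nat) \<times> nat \<Rightarrow> 'a :: comm_monoid_add"
  assumes "internal n M"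
  shows "(\<Sum>a\<in>arcs_of (network n M). h a) =
    (\<Sum>a\<in>arcs_of M. h a) + ((\<Sum>i=1..n + 1. h (source_arc i)) + (\<Sum>i=1..n + 1. h (sink_arc n i)))"
proof -
  have disj: "arcs_of M \<inter> (source_arc ` {1..n + 1} \<union> sink_arc n ` {1..n + 1}) = {}"
    using arcs_of_internal[OF assms] by fastforce
  have disj': "source_arc ` {1..n + 1} \<inter> sink_arc n ` {1..n + 1} = {}"
    by auto
  have inj: "inj_on source_arc {1..n + 1}" "inj_on (sink_arc n) {1..n + 1}"
    by (auto simp: inj_on_def)
  have 1: "(\<Sum>a\<in>arcs_of (network n M). h a) =
      (\<Sum>a\<in>arcs_of M. h a) + (\<Sum>a\<in>source_arc ` {1..n + 1} \<union> sink_arc n ` {1..n + 1}. h a)"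
    unfolding arcs_of_network[OF assms] by (rule sum.union_disjoint[OF _ _ disj]) simp_all
  have 2: "(\<Sum>a\<in>source_arc ` {1..n + 1} \<union> sink_arc n ` {1..n + 1}. h a) =
      (\<Sum>a\<in>source_arc ` {1..n + 1}. h a) + (\<Sum>a\<in>sink_arc n ` {1..n + 1}. h a)"
    by (rule sum.union_disjoint[OF _ _ disj']) simp_all
  have 3: "(\<Sum>a\<in>source_arc ` {1..n + 1}. h a) = (\<Sum>i=1..n + 1. h (source_arc i))"
    by (rule sum.reindex[OF inj(1), unfolded comp_def])
  have 4: "(\<Sum>a\<in>sink_arc n ` {1..n + 1}. h a) = (\<Sum>i=1..n + 1. h (sink_arc n i))"
    by (rule sum.reindex[OF inj(2), unfolded comp_def])
  show ?thesis
    unfolding 1 2 3 4 ..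
qed

lemma net_network:
  fixes f :: "(nat \<times> nat) \<times> nat \<Rightarrow> real"
  assumes "internal n M"
  shows "(\<Sum>a\<in>arcs_of (network n M). f a * incidence a v) =
    (if v = 0 then \<Sum>i=1..n + 1. f (source_arc i)
     else if v = n + 2 then - (\<Sum>i=1..n + 1. f (sink_arc n i))
     else if v \<le> n + 1 then
       (\<Sum>a\<in>arcs_of M. f a * incidence a v) - f (source_arc v) + f (sink_arc n v)
     else 0)"
proof -
  have M0: "(\<Sum>a\<in>arcs_of M. f a * incidence a v) = 0" if "v = 0 \<or> v > n + 1"
    using that arcs_of_internal[OF assms]
    by (intro sum.neutral) (fastforce simp: incidence_def)
  have source: "(\<Sum>i=1..n + 1. f (source_arc i) * incidence (source_arc i) v) =
      (if v = 0 then \<Sum>i=1..n + 1. f (source_arc i) else if v \<le> n + 1 then - f (source_arc v) else 0)"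
  proof (cases "v = 0")
    case True
    then show ?thesis
      by (auto simp: incidence_def intro!: sum.cong)
  next
    case False
    then have "(\<Sum>i=1..n + 1. f (source_arc i) * incidence (source_arc i) v) =
        (\<Sum>i=1..n + 1. if i = v then - f (source_arc v) else 0)"
      by (intro sum.cong) (auto simp: incidence_def)
    then show ?thesis
      using False by auto
  qed
  have sink: "(\<Sum>i=1..n + 1. f (sink_arc n i) * incidence (sink_arc n i) v) =
      (if v = n + 2 then - (\<Sum>i=1..n + 1. f (sink_arc n i)) else if 1 \<le> v \<and> v \<le> n + 1 then f (sink_arc n v) else 0)"
  proof (cases "v = n + 2")
    case True
    then have "(\<Sum>i=1..n + 1. f (sink_arc n i) * incidence (sink_arc n i) v) = (\<Sum>i=1..n + 1. - f (sink_arc n i))"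
      by (intro sum.cong) (auto simp: incidence_def)
    then show ?thesis
      using True by (simp add: sum_negf)
  next
    case False
    then have "(\<Sum>i=1..n + 1. f (sink_arc n i) * incidence (sink_arc n i) v) =
        (\<Sum>i=1..n + 1. if i = v then f (sink_arc n v) else 0)"
      by (intro sum.cong) (auto simp: incidence_def)
    then show ?thesis
      using False by auto
  qed
  show ?thesis
    unfolding sum_network[OF assms] source sink using M0 by auto
qed

text \<open>
  The net outflow of each vertex for a flow of strength 1.
\<close>

definition demand :: "nat \<Rightarrow> nat \<Rightarrow> real" where
  "demand n v = (if v = 0 then 1 else if v = n + 2 then - 1 else 0)"

definition network_flows :: "nat \<Rightarrow> (nat \<times> nat) multiset \<Rightarrow> nat \<Rightarrow> ((nat \<times> nat) \<times> nat \<Rightarrow> nat) set" where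
  "network_flows n M N = flows incidence (arcs_of (network n M)) (\<lambda>v. real N * demand n v)"

lemma network_flows_outside: "f \<in> network_flows n M N \<Longrightarrow> a \<notin> arcs_of (network n M) \<Longrightarrow> f a = 0"
  unfolding network_flows_def flows_def by blast

text \<open>
  Conservation at the vertices \<open>1, \<dots>, n + 1\<close> determines the sink arcs, and the strength of the flow
  determines one source arc. The remaining arcs can be chosen as coordinates.
\<close>

definition free_arcs :: "nat \<Rightarrow> (nat \<times> nat) multiset \<Rightarrow> ((nat \<times> nat) \<times> nat) set" where
  "free_arcs n M = arcs_of M \<union> source_arc ` {2..n + 1}"

lemma card_free_arcs: "internal n M \<Longrightarrow> finite (free_arcs n M) \<and> card (free_arcs n M) = size M + n"
proof -
  assume M: "internal n M"
  have "arcs_of M \<inter> source_arc ` {2..n + 1} = {}"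
    using arcs_of_internal[OF M] by fastforce
  moreover have "card (source_arc ` {2..n + 1}) = n"
    by (subst card_image) (auto simp: inj_on_def)
  ultimately show ?thesis
    by (simp add: free_arcs_def card_Un_disjoint card_arcs_of)
qed

lemma free_arcs_subset: "internal n M \<Longrightarrow> free_arcs n M \<subseteq> arcs_of (network n M)"
  unfolding free_arcs_def by (subst arcs_of_network) auto

lemma determined_by_free_arcs:
  fixes f :: "(nat \<times> nat) \<times> nat \<Rightarrow> real"
  assumes M: "internal n M"
    and net: "\<And>v. (\<Sum>a\<in>arcs_of (network n M). f a * incidence a v) = 0"
    and free: "\<And>a. a \<in> free_arcs n M \<Longrightarrow> f a = 0"
    and a: "a \<in> arcs_of (network n M)"
  shows "f a = 0"
proof -
  have M0: "(\<Sum>a\<in>arcs_of M. f a * incidence a v) = 0" for v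
    using free by (intro sum.neutral) (auto simp: free_arcs_def)
  have "(\<Sum>i=1..n + 1. f (source_arc i)) = f (source_arc 1) + (\<Sum>i=2..n + 1. f (source_arc i))"
    by (subst sum.atLeast_Suc_atMost) (auto simp: numeral_2_eq_2)
  moreover have "(\<Sum>i=2..n + 1. f (source_arc i)) = 0"
    using free by (intro sum.neutral) (auto simp: free_arcs_def)
  ultimately have "f (source_arc 1) = 0"
    using net[of 0] unfolding net_network[OF M] by simp
  then have source: "f (source_arc i) = 0" if "i \<in> {1..n + 1}" for i
    using that free[of "source_arc i"] by (cases "i = 1") (auto simp: free_arcs_def)
  have "f (sink_arc n i) = 0" if "i \<in> {1..n + 1}" for i
    using that net[of i] source[OF that] M0 unfolding net_network[OF M] by simp
  then have "f a = 0" if "a \<in> source_arc ` {1..n + 1} \<union> sink_arc n ` {1..n + 1}"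
    using that source by blast
  moreover have "f a = 0" if "a \<in> arcs_of M"
    using free that by (simp add: free_arcs_def)
  ultimately show ?thesis
    using a unfolding arcs_of_network[OF M] by blast
qed

text \<open>
  Sum the net outflow weighted by the vertex number. Every arc increases the number by at least 1,
  and the total increase is that of \<open>N\<close> routes from \<open>0\<close> to \<open>n + 2\<close>.
\<close>

lemma network_flows_bound:
  assumes M: "internal n M" and f: "f \<in> network_flows n M N"
  shows "f a \<le> N * (n + 2)"
proof -
  let ?A = "arcs_of (network n M)"
  have ends: "fst (fst a) < snd (fst a) \<and> snd (fst a) \<le> n + 2" if "a \<in> ?A" for a
  proof (cases "a \<in> arcs_of M")
    case True
    then show ?thesis
      using arcs_of_internal[OF M, of "fst (fst a)" "snd (fst a)" "snd a"] by simp
  next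
    case False
    then show ?thesis
      using that unfolding arcs_of_network[OF M] by auto
  qed
  have "(\<Sum>v\<le>n + 2. real v * (\<Sum>a\<in>?A. real (f a) * incidence a v)) =
      (\<Sum>v\<le>n + 2. if v = n + 2 then - real (N * (n + 2)) else 0)"
    using f by (intro sum.cong) (auto simp: network_flows_def flows_def demand_def algebra_simps)
  also have "\<dots> = - real (N * (n + 2))"
    by simp
  also have "(\<Sum>v\<le>n + 2. real v * (\<Sum>a\<in>?A. real (f a) * incidence a v)) =
      (\<Sum>a\<in>?A. real (f a) * (\<Sum>v\<le>n + 2. real v * incidence a v))"
    unfolding sum_distrib_left by (subst sum.swap) (simp only: mult.left_commute)
  also have "\<dots> = (\<Sum>a\<in>?A. - (real (f a) * (real (snd (fst a)) - real (fst (fst a)))))"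
  proof (rule sum.cong[OF refl])
    fix a assume a: "a \<in> ?A"
    have "(\<Sum>v\<le>n + 2. real v * incidence a v) =
        (\<Sum>v\<le>n + 2. (if v = fst (fst a) then real v else 0) - (if v = snd (fst a) then real v else 0))"
      by (intro sum.cong) (auto simp: incidence_def)
    also have "\<dots> = real (fst (fst a)) - real (snd (fst a))"
      using ends[OF a] by (simp add: sum_subtractf del: sum.atMost_Suc)
    finally have *: "(\<Sum>v\<le>n + 2. real v * incidence a v) = real (fst (fst a)) - real (snd (fst a))" .
    show "real (f a) * (\<Sum>v\<le>n + 2. real v * incidence a v) =
        - (real (f a) * (real (snd (fst a)) - real (fst (fst a))))"
      unfolding * by (simp add: algebra_simps)
  qed
  finally have total: "(\<Sum>a\<in>?A. real (f a) * (real (snd (fst a)) - real (fst (fst a)))) = real (N * (n + 2))"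
    by (simp add: sum_negf)
  show ?thesis
  proof (cases "a \<in> ?A")
    case True
    have nonneg: "0 \<le> real (f a) * (real (snd (fst a)) - real (fst (fst a)))" if "a \<in> ?A" for a
      using ends[OF that] by simp
    have "real (f a) * 1 \<le> real (f a) * (real (snd (fst a)) - real (fst (fst a)))"
      using ends[OF True] by (intro mult_left_mono) auto
    also have "\<dots> \<le> real (N * (n + 2))"
      unfolding total[symmetric] using True nonneg by (intro member_le_sum) auto
    finally show ?thesis
      by (simp only: mult_1_right of_nat_le_iff)
  next
    case False
    then show ?thesis
      using network_flows_outside[OF f] by simp
  qed
qed

text \<open>
  The exponent is the number of free arcs. It drops with the number of edges, which makes the
  correction term in \<open>network_flows_reduction\<close> negligible.
\<close>

lemma card_network_flows_le:
  assumes M: "internal n M"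
  shows "finite (network_flows n M N) \<and> card (network_flows n M N) \<le> (N * (n + 2) + 1) ^ (size M + n)"
proof -
  let ?B = "free_arcs n M" and ?A = "arcs_of (network n M)"
  let ?S = "?B \<rightarrow>\<^sub>E {..N * (n + 2)}"
  have "inj_on (\<lambda>f. restrict f ?B) (network_flows n M N)"
  proof (rule inj_onI)
    fix f g assume f: "f \<in> network_flows n M N" and g: "g \<in> network_flows n M N"
      and eq: "restrict f ?B = restrict g ?B"
    have "real (f a) - real (g a) = 0" if "a \<in> ?A" for a
    proof (rule determined_by_free_arcs[OF M _ _ that])
      show "(\<Sum>a\<in>?A. (real (f a) - real (g a)) * incidence a v) = 0" for v
        using f g by (simp add: network_flows_def flows_def left_diff_distrib sum_subtractf)
      show "real (f a) - real (g a) = 0" if "a \<in> ?B" for a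
        using fun_cong[OF eq, of a] that by simp
    qed
    moreover have "f a = 0" "g a = 0" if "a \<notin> ?A" for a
      using network_flows_outside f g that by blast+
    ultimately show "f = g"
      by (metis ext eq_iff_diff_eq_0 of_nat_eq_iff)
  qed
  moreover have "(\<lambda>f. restrict f ?B) ` network_flows n M N \<subseteq> ?S"
    using network_flows_bound[OF M] by auto
  moreover have "finite ?S" "card ?S = (N * (n + 2) + 1) ^ (size M + n)"
    using card_free_arcs[OF M] by (auto simp: card_PiE finite_PiE)
  ultimately show ?thesis
    by (metis card_inj_on_le inj_on_finite)
qed

lemma network_flows_reduction:
  assumes M: "internal n (M + {#(i, j), (j, k)#})"
  shows "card (network_flows n (M + {#(i, j), (j, k)#}) N) + card (network_flows n (M + {#(i, k)#}) N) =
    card (network_flows n (M + {#(i, j), (i, k)#}) N) + card (network_flows n (M + {#(j, k), (i, k)#}) N)"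
proof -
  have ijk: "i < j" "j < k"
    using M by (auto simp: internal_def)
  let ?W = "network n M"
  have net: "network n (M + X) = X + ?W" for X
    by (simp add: network_def algebra_simps)
  have two: "network_flows n (M + {#e, e'#}) N =
      flows incidence (insert (e, count ?W e) (insert (e', count ?W e') (arcs_of ?W))) (\<lambda>v. real N * demand n v)"
    if "e \<noteq> e'" for e e'
    using that unfolding network_flows_def net by (simp add: arcs_of_add_mset)
  have one: "network_flows n (M + {#e#}) N =
      flows incidence (insert (e, count ?W e) (arcs_of ?W)) (\<lambda>v. real N * demand n v)" for e
    unfolding network_flows_def net by (simp add: arcs_of_add_mset)
  have "internal n (M + {#(j, k), (i, k)#})"
    using M ijk by (auto simp: internal_def)
  then have finite: "finite (network_flows n (M + {#(i, j), (j, k)#}) N)"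
      "finite (network_flows n (M + {#(j, k), (i, k)#}) N)"
    using card_network_flows_le M by blast+
  have distinct: "(i, j) \<noteq> (j, k)" "(i, j) \<noteq> (i, k)" "(j, k) \<noteq> (i, k)"
    using ijk by auto
  show ?thesis
    unfolding two[OF distinct(1)] two[OF distinct(2)] two[OF distinct(3)] one
    by (rule card_flows_exchange)
      (use distinct finite two in \<open>auto simp: arcs_of_fresh incidence_def\<close>)
qed

text \<open>
  Splitting off one element of \<open>B\<close> and summing over its value leads to the hockey-stick identity for
  binomial coefficients.
\<close>

lemma card_weak_compositions:
  fixes B :: "'a set"
  assumes "finite B" "B \<noteq> {}"
  shows "finite {h. (\<forall>a. a \<notin> B \<longrightarrow> h a = 0) \<and> (\<Sum>a\<in>B. h a) = (N::nat)} \<and>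
    card {h. (\<forall>a. a \<notin> B \<longrightarrow> h a = 0) \<and> (\<Sum>a\<in>B. h a) = N} = (card B - 1 + N) choose N"
  using assms
proof (induction B arbitrary: N rule: finite_ne_induct)
  case (singleton b)
  have "{h. (\<forall>a. a \<notin> {b} \<longrightarrow> h a = 0) \<and> (\<Sum>a\<in>{b}. h a) = N} = {\<lambda>a. if a = b then N else 0}"
    by (auto simp: fun_eq_iff)
  then show ?case
    by simp
next
  case (insert b B)
  define H where "H B N = {h. (\<forall>a. a \<notin> B \<longrightarrow> h a = 0) \<and> (\<Sum>a\<in>B. h a) = N}" for B :: "'a set" and N :: nat
  have IH: "finite (H B N)" "card (H B N) = (card B - 1 + N) choose N" for N
    using insert.IH[of N] by (auto simp: H_def)
  define s where "s h = (\<Sum>a\<in>B. h a)" for h :: "'a \<Rightarrow> nat"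
  have s_upd: "s (h(b := x)) = s h" for h x
    unfolding s_def by (rule sum.cong) (use insert.hyps in auto)
  have in_H: "h \<in> H B m \<longleftrightarrow> (\<forall>a. a \<notin> B \<longrightarrow> h a = 0) \<and> s h = m"
    "h \<in> H (insert b B) m \<longleftrightarrow> (\<forall>a. a \<notin> insert b B \<longrightarrow> h a = 0) \<and> h b + s h = m" for h m
    using insert.hyps by (auto simp: H_def s_def)
  have "bij_betw (\<lambda>(m, h). h(b := N - m)) (SIGMA m:{..N}. H B m) (H (insert b B) N)"
    by (rule bij_betw_byWitness[where f' = "\<lambda>h. (N - h b, h(b := 0))"])
      (use insert.hyps in \<open>auto simp: in_H s_upd fun_eq_iff\<close>)
  then have "finite (H (insert b B) N) \<and> card (H (insert b B) N) = card (SIGMA m:{..N}. H B m)"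
    using IH(1) bij_betw_finite bij_betw_same_card by fastforce
  moreover have "card (SIGMA m:{..N}. H B m) = (\<Sum>m\<le>N. (card B - 1 + m) choose m)"
    using IH by (subst card_SigmaI) auto
  moreover have "\<dots> = Suc (card B - 1 + N) choose N"
    by (rule sum_choose_lower)
  moreover have "Suc (card B - 1 + N) = card (insert b B) - 1 + N"
    using insert.hyps by (simp add: Suc_diff_le card_gt_0_iff Suc_leI)
  ultimately have "finite (H (insert b B) N) \<and> card (H (insert b B) N) = (card (insert b B) - 1 + N) choose N"
    by metis
  then show ?case
    unfolding H_def .
qed

lemma binomial_asymptotics: "(\<lambda>N. real ((D + N) choose N) / real N ^ D) \<longlonglongrightarrow> 1 / fact D"
proof (induction D)
  case 0
  then show ?case by simp
next
  case (Suc D)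
  have "(\<lambda>N. 1 + real (D + 1) * (1 / real N)) \<longlonglongrightarrow> 1 + real (D + 1) * 0"
    by (intro tendsto_intros lim_1_over_n)
  then have "(\<lambda>N. (1 + real (D + 1) * (1 / real N)) * (real ((D + N) choose N) / real N ^ D) / real (D + 1))
      \<longlonglongrightarrow> (1 + real (D + 1) * 0) * (1 / fact D) / real (D + 1)"
    by (intro tendsto_intros Suc.IH) simp_all
  then have *: "(\<lambda>N. (1 + real (D + 1) * (1 / real N)) * (real ((D + N) choose N) / real N ^ D) / real (D + 1))
      \<longlonglongrightarrow> 1 / fact (Suc D)"
    by (simp add: field_simps)
  show ?case
  proof (rule Lim_transform_eventually[OF *], rule eventually_sequentiallyI[of 1])
    fix N :: nat assume N: "1 \<le> N"
    have "Suc (D + N) * ((D + N) choose D) = (Suc (D + N) choose Suc D) * Suc D"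
      by (rule Suc_times_binomial_eq)
    moreover have "(D + N) choose D = (D + N) choose N"
      "Suc (D + N) choose Suc D = (Suc D + N) choose N"
      using binomial_symmetric[of D "D + N"] binomial_symmetric[of "Suc D" "Suc D + N"] by auto
    ultimately have "real (Suc (D + N)) * real ((D + N) choose N) = real ((Suc D + N) choose N) * real (Suc D)"
      by (metis of_nat_mult)
    then have "real ((Suc D + N) choose N) = real (Suc (D + N)) * real ((D + N) choose N) / real (Suc D)"
      by (simp add: field_simps)
    then show "(1 + real (D + 1) * (1 / real N)) * (real ((D + N) choose N) / real N ^ D) / real (D + 1) =
        real ((Suc D + N) choose N) / real N ^ Suc D"
      using N by (simp only:) (simp add: field_simps)
  qed
qed

definition alternating :: "(nat \<times> nat) multiset \<Rightarrow> bool" where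
  "alternating M \<longleftrightarrow> (\<forall>u v w. (u, v) \<in># M \<longrightarrow> (v, w) \<notin># M)"

text \<open>
  Without paths of length two inside the graph there is one route for each edge and one for each
  vertex, and the routes can be used independently. In terms of arcs: what remains of a source arc
  after its vertex has supplied its outgoing edges is arbitrary, and so are the values on the
  edges. Vertices with incoming edges have no outgoing ones, so the remainder is never negative.
\<close>

lemma card_network_flows_alternating:
  assumes M: "internal n M" and alt: "alternating M"
  shows "card (network_flows n M N) = (size M + n + N) choose N"
proof -
  define V where "V = {1..n + 1}"
  define B where "B = arcs_of M \<union> source_arc ` V"
  define H where "H = {h. (\<forall>a. a \<notin> B \<longrightarrow> h a = 0) \<and> (\<Sum>a\<in>B. h a) = N}"
  define out_sum where "out_sum h i = (\<Sum>a | a \<in> arcs_of M \<and> fst (fst a) = i. h a)" for h :: "_ \<Rightarrow> nat" and i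
  define in_sum where "in_sum h i = (\<Sum>a | a \<in> arcs_of M \<and> snd (fst a) = i. h a)" for h :: "_ \<Rightarrow> nat" and i
  let ?A = "arcs_of (network n M)"
  have A: "?A = B \<union> sink_arc n ` V"
    using arcs_of_network[OF M] by (auto simp: B_def V_def)
  have disj: "source_arc i \<notin> arcs_of M" "sink_arc n i \<notin> arcs_of M" "sink_arc n i \<notin> source_arc ` V" if "i \<in> V" for i
    using arcs_of_internal[OF M] that by (fastforce simp: V_def)+
  have sum_B: "(\<Sum>a\<in>B. h a) = (\<Sum>a\<in>arcs_of M. h a) + (\<Sum>i\<in>V. h (source_arc i))" for h :: "_ \<Rightarrow> nat"
  proof -
    have "arcs_of M \<inter> source_arc ` V = {}"
      using disj by auto
    then show ?thesis
      unfolding B_def by (subst sum.union_disjoint) (auto simp: V_def sum.reindex inj_on_def)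
  qed
  have net_M: "(\<Sum>a\<in>arcs_of M. real (h a) * incidence a v) = real (out_sum h v) - real (in_sum h v)" for h v
  proof -
    have "(\<Sum>a\<in>arcs_of M. real (h a) * incidence a v) =
        (\<Sum>a\<in>arcs_of M. (if fst (fst a) = v then real (h a) else 0) - (if snd (fst a) = v then real (h a) else 0))"
      by (intro sum.cong) (auto simp: incidence_def)
    then show ?thesis
      by (simp add: sum_subtractf out_sum_def in_sum_def sum.If_cases Int_def)
  qed
  have out_total: "(\<Sum>i\<in>V. out_sum h i) = (\<Sum>a\<in>arcs_of M. h a)" for h
    unfolding out_sum_def
    by (rule sum.group[of _ _ "\<lambda>a. fst (fst a)"]) (use arcs_of_internal[OF M] in \<open>fastforce simp: V_def\<close>)+
  have in_total: "(\<Sum>i\<in>V. in_sum h i) = (\<Sum>a\<in>arcs_of M. h a)" for h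
    unfolding in_sum_def
    by (rule sum.group[of _ _ "\<lambda>a. snd (fst a)"]) (use arcs_of_internal[OF M] in \<open>fastforce simp: V_def\<close>)+
  have flow_iff: "f \<in> network_flows n M N \<longleftrightarrow> (\<forall>a. a \<notin> ?A \<longrightarrow> f a = 0) \<and>
      (\<Sum>i\<in>V. f (source_arc i)) = N \<and> (\<Sum>i\<in>V. f (sink_arc n i)) = N \<and>
      (\<forall>i\<in>V. out_sum f i + f (sink_arc n i) = in_sum f i + f (source_arc i))" for f
  proof -
    have "(\<forall>v. (\<Sum>a\<in>?A. real (f a) * incidence a v) = real N * demand n v) \<longleftrightarrow>
        (\<Sum>i\<in>V. f (source_arc i)) = N \<and> (\<Sum>i\<in>V. f (sink_arc n i)) = N \<and>
        (\<forall>i\<in>V. out_sum f i + f (sink_arc n i) = in_sum f i + f (source_arc i))" (is "?L \<longleftrightarrow> ?R")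
    proof
      assume L: ?L
      have "real (\<Sum>i\<in>V. f (source_arc i)) = real N"
        using spec[OF L, of 0] unfolding net_network[OF M] demand_def V_def by simp
      moreover have "real (\<Sum>i\<in>V. f (sink_arc n i)) = real N"
        using spec[OF L, of "n + 2"] unfolding net_network[OF M] demand_def V_def by simp
      moreover have "real (out_sum f i + f (sink_arc n i)) = real (in_sum f i + f (source_arc i))" if "i \<in> V" for i
        using spec[OF L, of i] that unfolding net_network[OF M] demand_def V_def net_M by auto
      ultimately show ?R
        by (simp only: of_nat_eq_iff) blast
    next
      assume R: ?R
      then have "real (\<Sum>i\<in>V. f (source_arc i)) = real N" "real (\<Sum>i\<in>V. f (sink_arc n i)) = real N"
        by (simp_all only:)
      moreover have "real (out_sum f i) - real (in_sum f i) - real (f (source_arc i)) +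
          real (f (sink_arc n i)) = 0" if "i \<in> V" for i
      proof -
        have "real (out_sum f i + f (sink_arc n i)) = real (in_sum f i + f (source_arc i))"
          using R that by (simp only:)
        then show ?thesis
          by simp
      qed
      ultimately show ?L
        unfolding net_network[OF M] demand_def V_def net_M by auto
    qed
    then show ?thesis
      by (simp add: network_flows_def flows_def)
  qed
  \<comment> \<open>\<open>\<phi>\<close> extracts the multiplicities of the routes from a flow, \<open>\<psi>\<close> superposes the routes.\<close>
  define \<phi> where "\<phi> f = (\<lambda>a. if a \<in> source_arc ` V then f a - out_sum f (snd (fst a))
    else if a \<in> arcs_of M then f a else 0)" for f
  define \<psi> where "\<psi> h = (\<lambda>a. if a \<in> source_arc ` V then h a + out_sum h (snd (fst a))
    else if a \<in> sink_arc n ` V then h (source_arc (fst (fst a))) + in_sum h (fst (fst a)) else h a)" for h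
  have on_M: "\<phi> f a = f a" "\<psi> f a = f a" if "a \<in> arcs_of M" for f a
    using that disj by (auto simp: \<phi>_def \<psi>_def)
  have sums: "out_sum (\<phi> f) i = out_sum f i" "out_sum (\<psi> f) i = out_sum f i"
    "in_sum (\<phi> f) i = in_sum f i" "in_sum (\<psi> f) i = in_sum f i"
    "(\<Sum>a\<in>arcs_of M. \<phi> f a) = (\<Sum>a\<in>arcs_of M. f a)" for f i
    unfolding out_sum_def in_sum_def using on_M by (auto intro!: sum.cong)
  have at_source: "\<phi> f (source_arc i) = f (source_arc i) - out_sum f i"
    "\<psi> f (source_arc i) = f (source_arc i) + out_sum f i" if "i \<in> V" for f i
    using that by (auto simp: \<phi>_def \<psi>_def)
  have at_sink: "\<psi> f (sink_arc n i) = f (source_arc i) + in_sum f i" if "i \<in> V" for f i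
    using that disj(3)[OF that] by (auto simp: \<psi>_def)
  have out_le: "out_sum f i \<le> f (source_arc i)" if f: "f \<in> network_flows n M N" and i: "i \<in> V" for f i
  proof (cases "\<exists>a\<in>arcs_of M. snd (fst a) = i")
    case True
    then obtain u where "(u, i) \<in># M"
      by (force dest: mem_arcs_of)
    then have "{a \<in> arcs_of M. fst (fst a) = i} = {}"
      using alt by (force dest!: mem_arcs_of simp: alternating_def)
    then show ?thesis
      by (simp add: out_sum_def del: Collect_empty_eq)
  next
    case False
    then have "in_sum f i = 0"
      by (auto simp: in_sum_def)
    then show ?thesis
      using f i unfolding flow_iff by (metis add_0 le_add1)
  qed
  have "bij_betw \<phi> (network_flows n M N) H"
  proof (rule bij_betw_byWitness[where f' = \<psi>])
    show "\<forall>f\<in>network_flows n M N. \<psi> (\<phi> f) = f"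
    proof (intro ballI ext)
      fix f a assume f: "f \<in> network_flows n M N"
      consider i where "i \<in> V" "a = source_arc i" | i where "i \<in> V" "a = sink_arc n i"
        | "a \<in> arcs_of M" | "a \<notin> ?A"
        unfolding A B_def by blast
      then show "\<psi> (\<phi> f) a = f a"
      proof cases
        case 1
        then show ?thesis
          using out_le[OF f] by (simp add: at_source sums)
      next
        case 2
        then have "out_sum f i + f (sink_arc n i) = in_sum f i + f (source_arc i)"
          using f unfolding flow_iff by blast
        moreover have "\<psi> (\<phi> f) (sink_arc n i) = (f (source_arc i) - out_sum f i) + in_sum f i"
          unfolding at_sink[OF 2(1)] at_source(1)[OF 2(1)] sums ..
        ultimately show ?thesis
          unfolding 2(2) using out_le[OF f 2(1)] by linarith
      next
        case 3
        then show ?thesis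
          by (simp add: on_M)
      next
        case 4
        then have "\<psi> (\<phi> f) a = \<phi> f a" "\<phi> f a = 0"
          unfolding A B_def by (auto simp: \<psi>_def \<phi>_def)
        then show ?thesis
          using 4 network_flows_outside[OF f] by simp
      qed
    qed
    show "\<forall>h\<in>H. \<phi> (\<psi> h) = h"
    proof (intro ballI ext)
      fix h a assume h: "h \<in> H"
      consider i where "i \<in> V" "a = source_arc i" | "a \<in> arcs_of M" | "a \<notin> B"
        unfolding B_def by blast
      then show "\<phi> (\<psi> h) a = h a"
      proof cases
        case 1
        then show ?thesis
          by (simp add: at_source sums)
      next
        case 2
        then show ?thesis
          by (simp add: on_M)
      next
        case 3
        show ?thesis
        proof -
          have "h a = 0"
            using h 3 unfolding H_def by blast
          then show ?thesis
            using 3 by (simp add: \<phi>_def B_def)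
        qed
      qed
    qed
    show "\<phi> ` network_flows n M N \<subseteq> H"
    proof
      fix h assume "h \<in> \<phi> ` network_flows n M N"
      then obtain f where f: "f \<in> network_flows n M N" and h: "h = \<phi> f"
        by blast
      have "(\<Sum>i\<in>V. \<phi> f (source_arc i)) + (\<Sum>i\<in>V. out_sum f i) = (\<Sum>i\<in>V. f (source_arc i))"
        unfolding sum.distrib[symmetric] using out_le[OF f] by (intro sum.cong) (auto simp: at_source)
      then have "(\<Sum>a\<in>B. \<phi> f a) = N"
        using f unfolding sum_B sums out_total flow_iff by simp
      then show "h \<in> H"
        by (auto simp: H_def h) (auto simp: \<phi>_def B_def)
    qed
    show "\<psi> ` H \<subseteq> network_flows n M N"
    proof
      fix f assume "f \<in> \<psi> ` H"
      then obtain h where h: "h \<in> H" and f: "f = \<psi> h"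
        by blast
      have total: "(\<Sum>a\<in>arcs_of M. h a) + (\<Sum>i\<in>V. h (source_arc i)) = N"
        using h by (simp add: H_def sum_B)
      have "(\<Sum>i\<in>V. \<psi> h (source_arc i)) = N" "(\<Sum>i\<in>V. \<psi> h (sink_arc n i)) = N"
      proof -
        have "(\<Sum>i\<in>V. \<psi> h (source_arc i)) = (\<Sum>i\<in>V. h (source_arc i) + out_sum h i)"
          by (rule sum.cong[OF refl at_source(2)])
        then show "(\<Sum>i\<in>V. \<psi> h (source_arc i)) = N"
          using total by (simp add: sum.distrib out_total)
        have "(\<Sum>i\<in>V. \<psi> h (sink_arc n i)) = (\<Sum>i\<in>V. h (source_arc i) + in_sum h i)"
          by (rule sum.cong[OF refl at_sink])
        then show "(\<Sum>i\<in>V. \<psi> h (sink_arc n i)) = N"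
          unfolding sum.distrib in_total using total by simp
      qed
      moreover have "\<psi> h a = 0" if "a \<notin> ?A" for a
      proof -
        have "h a = 0"
          using h that unfolding H_def A by blast
        then show ?thesis
          using that unfolding A by (auto simp: \<psi>_def B_def)
      qed
      moreover have "out_sum (\<psi> h) i + \<psi> h (sink_arc n i) = in_sum (\<psi> h) i + \<psi> h (source_arc i)"
        if "i \<in> V" for i
        unfolding sums at_source(2)[OF that] at_sink[OF that] by simp
      ultimately show "f \<in> network_flows n M N"
        unfolding flow_iff f by blast
    qed
  qed
  then have "card (network_flows n M N) = card H"
    by (rule bij_betw_same_card)
  moreover have "finite B" "B \<noteq> {}" "card B = size M + n + 1"
  proof -
    have "arcs_of M \<inter> source_arc ` V = {}"
      using disj by auto
    then show "card B = size M + n + 1"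
      by (simp add: B_def card_Un_disjoint card_arcs_of card_image inj_on_def V_def)
  qed (auto simp: B_def V_def)
  ultimately show ?thesis
    using card_weak_compositions[of B N] by (simp add: H_def)
qed

section \<open>Paths in grown trees\<close>

lemma finite_leaf_paths: "finite (leaf_paths T)"
  by (induction T) auto

lemma leaves_conv_paths: "leaves T = image_mset (leaf_along T) (mset_set (leaf_paths T))"
proof (induction T)
  case (Leaf x)
  show ?case by simp
next
  case (Node x l r)
  have inj: "inj_on (Cons c) S" for c :: bool and S
    by (auto simp: inj_on_def)
  have "mset_set (Cons False ` leaf_paths l \<union> Cons True ` leaf_paths r) =
      mset_set (Cons False ` leaf_paths l) + mset_set (Cons True ` leaf_paths r)"
    by (rule mset_set_Union) (auto simp: finite_leaf_paths)
  also have "\<dots> = image_mset (Cons False) (mset_set (leaf_paths l)) + image_mset (Cons True) (mset_set (leaf_paths r))"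
    by (simp only: image_mset_mset_set[OF inj])
  finally have "image_mset (leaf_along (Node x l r)) (mset_set (leaf_paths (Node x l r))) =
      image_mset (leaf_along l) (mset_set (leaf_paths l)) + image_mset (leaf_along r) (mset_set (leaf_paths r))"
    by (simp add: multiset.map_comp comp_def)
  then show ?case
    using Node by simp
qed

lemma leaf_along_append: "\<pi> \<in> leaf_paths T \<Longrightarrow> leaf_along T (\<pi> @ \<rho>) = leaf_along T \<pi>"
  by (induction T arbitrary: \<pi>) auto

lemma leaf_paths_map: "leaf_paths (map_btree f T) = leaf_paths T"
  by (induction T) auto

lemma leaf_along_map: "leaf_along (map_btree f T) \<pi> = f (leaf_along T \<pi>)"
  by (induction T \<pi> rule: leaf_along.induct) auto

lemma leaves_map: "leaves (map_btree f T) = image_mset f (leaves T)"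
  by (induction T) auto

lemma leaf_along_in_leaves: "\<pi> \<in> leaf_paths T \<Longrightarrow> leaf_along T \<pi> \<in># leaves T"
  by (auto simp: leaves_conv_paths finite_leaf_paths)

text \<open>
  The tree \<open>s \<pi>\<close> is what replaces the leaf at \<open>\<pi>\<close>.
\<close>

lemma grow_paths:
  assumes "grow R T T'"
  obtains s where "\<And>\<pi>. \<pi> \<in> leaf_paths T \<Longrightarrow> R (leaf_along T \<pi>) (s \<pi>)"
    and "leaf_paths T' = {\<pi> @ \<rho> | \<pi> \<rho>. \<pi> \<in> leaf_paths T \<and> \<rho> \<in> leaf_paths (s \<pi>)}"
    and "\<And>\<pi> \<rho>. \<pi> \<in> leaf_paths T \<Longrightarrow> leaf_along T' (\<pi> @ \<rho>) = leaf_along (s \<pi>) \<rho>"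
proof -
  from assms have "\<exists>s. (\<forall>\<pi>\<in>leaf_paths T. R (leaf_along T \<pi>) (s \<pi>)) \<and>
      leaf_paths T' = {\<pi> @ \<rho> | \<pi> \<rho>. \<pi> \<in> leaf_paths T \<and> \<rho> \<in> leaf_paths (s \<pi>)} \<and>
      (\<forall>\<pi>\<in>leaf_paths T. \<forall>\<rho>. leaf_along T' (\<pi> @ \<rho>) = leaf_along (s \<pi>) \<rho>)"
  proof induction
    case (grow_Leaf x t)
    then show ?case
      by (intro exI[of _ "\<lambda>_. t"]) auto
  next
    case (grow_Node l l' r r' x)
    obtain sl where l: "\<forall>\<pi>\<in>leaf_paths l. R (leaf_along l \<pi>) (sl \<pi>)"
        "leaf_paths l' = {\<pi> @ \<rho> | \<pi> \<rho>. \<pi> \<in> leaf_paths l \<and> \<rho> \<in> leaf_paths (sl \<pi>)}"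
        "\<forall>\<pi>\<in>leaf_paths l. \<forall>\<rho>. leaf_along l' (\<pi> @ \<rho>) = leaf_along (sl \<pi>) \<rho>"
      using grow_Node.IH(1) by (elim exE conjE)
    obtain sr where r: "\<forall>\<pi>\<in>leaf_paths r. R (leaf_along r \<pi>) (sr \<pi>)"
        "leaf_paths r' = {\<pi> @ \<rho> | \<pi> \<rho>. \<pi> \<in> leaf_paths r \<and> \<rho> \<in> leaf_paths (sr \<pi>)}"
        "\<forall>\<pi>\<in>leaf_paths r. \<forall>\<rho>. leaf_along r' (\<pi> @ \<rho>) = leaf_along (sr \<pi>) \<rho>"
      using grow_Node.IH(2) by (elim exE conjE)
    define s where "s \<pi> = (if hd \<pi> then sr (tl \<pi>) else sl (tl \<pi>))" for \<pi>
    have "leaf_paths (Node x l' r') = {\<pi> @ \<rho> | \<pi> \<rho>. \<pi> \<in> leaf_paths (Node x l r) \<and> \<rho> \<in> leaf_paths (s \<pi>)}"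
      (is "?L = ?R")
    proof
      show "?L \<subseteq> ?R"
      proof
        fix \<sigma> assume "\<sigma> \<in> ?L"
        then consider \<pi> \<rho> where "\<sigma> = (False # \<pi>) @ \<rho>" "\<pi> \<in> leaf_paths l" "\<rho> \<in> leaf_paths (sl \<pi>)"
          | \<pi> \<rho> where "\<sigma> = (True # \<pi>) @ \<rho>" "\<pi> \<in> leaf_paths r" "\<rho> \<in> leaf_paths (sr \<pi>)"
          using l(2) r(2) by auto
        then show "\<sigma> \<in> ?R"
        proof cases
          case 1
          then show ?thesis
            by (intro CollectI exI[of _ "False # \<pi>"] exI[of _ \<rho>]) (auto simp: s_def)
        next
          case 2
          then show ?thesis
            by (intro CollectI exI[of _ "True # \<pi>"] exI[of _ \<rho>]) (auto simp: s_def)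
        qed
      qed
      show "?R \<subseteq> ?L"
      proof
        fix \<sigma> assume "\<sigma> \<in> ?R"
        then obtain \<pi> \<rho> where *: "\<sigma> = \<pi> @ \<rho>" "\<pi> \<in> leaf_paths (Node x l r)" "\<rho> \<in> leaf_paths (s \<pi>)"
          by blast
        from *(2) consider \<pi>' where "\<pi> = False # \<pi>'" "\<pi>' \<in> leaf_paths l"
          | \<pi>' where "\<pi> = True # \<pi>'" "\<pi>' \<in> leaf_paths r"
          by auto
        then show "\<sigma> \<in> ?L"
        proof cases
          case 1
          then have "\<pi>' @ \<rho> \<in> leaf_paths l'"
            using *(3) unfolding l(2) by (auto simp: s_def)
          then show ?thesis
            using 1 *(1) by simp
        next
          case 2
          then have "\<pi>' @ \<rho> \<in> leaf_paths r'"
            using *(3) unfolding r(2) by (auto simp: s_def)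
          then show ?thesis
            using 2 *(1) by simp
        qed
      qed
    qed
    moreover have "R (leaf_along (Node x l r) \<pi>) (s \<pi>)" if "\<pi> \<in> leaf_paths (Node x l r)" for \<pi>
      using that l(1) r(1) by (auto simp: s_def)
    moreover have "leaf_along (Node x l' r') (\<pi> @ \<rho>) = leaf_along (s \<pi>) \<rho>"
      if "\<pi> \<in> leaf_paths (Node x l r)" for \<pi> \<rho>
      using that l(3) r(3) by (auto simp: s_def)
    ultimately show ?case
      by (intro exI[of _ s] conjI ballI allI)
  qed
  then obtain s where s: "\<forall>\<pi>\<in>leaf_paths T. R (leaf_along T \<pi>) (s \<pi>)"
      "leaf_paths T' = {\<pi> @ \<rho> | \<pi> \<rho>. \<pi> \<in> leaf_paths T \<and> \<rho> \<in> leaf_paths (s \<pi>)}"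
      "\<forall>\<pi>\<in>leaf_paths T. \<forall>\<rho>. leaf_along T' (\<pi> @ \<rho>) = leaf_along (s \<pi>) \<rho>"
    by (elim exE conjE)
  show ?thesis
    by (rule that[OF bspec[OF s(1)] s(2) spec[OF bspec[OF s(3)]]])
qed

lemma process_verts_Node:
  "process_verts vs l l' \<Longrightarrow> process_verts vs r r' \<Longrightarrow> process_verts vs (Node x l r) (Node x l' r')"
proof (induction vs arbitrary: l r)
  case Nil
  then have "l = l'" "r = r'"
    by (auto elim: process_verts.cases)
  then show ?case
    by (simp add: process_Nil)
next
  case (Cons v vs)
  from Cons.prems(1) obtain l1 where "grow (vertex_reductions v) l l1" "process_verts vs l1 l'"
    by (cases rule: process_verts.cases) auto
  moreover from Cons.prems(2) obtain r1 where "grow (vertex_reductions v) r r1" "process_verts vs r1 r'"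
    by (cases rule: process_verts.cases) auto
  ultimately show ?case
    using Cons.IH by (blast intro: process_Cons grow_Node)
qed

text \<open>
  Processing all leaves vertex by vertex is the same as processing each leaf on its own through all
  vertices.
\<close>

lemma process_verts_iff_grow:
  "process_verts vs T T' \<longleftrightarrow> grow (\<lambda>H t. process_verts vs (Leaf H) t) T T'"
proof
  assume "grow (\<lambda>H t. process_verts vs (Leaf H) t) T T'"
  then show "process_verts vs T T'"
    by induction (auto intro: process_verts_Node)
next
  show "process_verts vs T T' \<Longrightarrow> grow (\<lambda>H t. process_verts vs (Leaf H) t) T T'"
  proof (induction T arbitrary: T')
    case (Leaf H)
    then show ?case
      by (rule grow_Leaf)
  next
    case (Node x l r)
    have "\<exists>l' r'. T' = Node x l' r' \<and> process_verts vs l l' \<and> process_verts vs r r'"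
      using Node.prems
    proof (induction vs arbitrary: l r)
      case Nil
      then show ?case
        by (auto elim: process_verts.cases intro: process_Nil)
    next
      case (Cons v vs)
      from Cons.prems obtain T1 where T1: "grow (vertex_reductions v) (Node x l r) T1" "process_verts vs T1 T'"
        by (cases rule: process_verts.cases) auto
      from T1(1) obtain l1 r1 where "T1 = Node x l1 r1" "grow (vertex_reductions v) l l1" "grow (vertex_reductions v) r r1"
        by (cases rule: grow.cases) auto
      then show ?case
        using Cons.IH T1(2) by (blast intro: process_Cons)
    qed
    then show ?case
      using Node.IH by (auto intro: grow_Node)
  qed
qed

section \<open>Degrees in a reduction tree\<close>

definition out_edges :: "multigraph \<Rightarrow> nat \<Rightarrow> (nat \<times> nat) multiset" where
  "out_edges H v = {# e \<in># edges H. fst e = v #}"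

text \<open>
  Exactly at such vertices no reduction is possible.
\<close>

definition alternates_at :: "multigraph \<Rightarrow> nat \<Rightarrow> bool" where
  "alternates_at H v \<longleftrightarrow> indegree H v = 0 \<or> out_edges H v = {#}"

definition ordered_to :: "nat \<Rightarrow> multigraph \<Rightarrow> bool" where
  "ordered_to w H \<longleftrightarrow> (\<forall>(u, v)\<in>#edges H. 1 \<le> u \<and> u < v \<and> v \<le> w)"

lemma indegree_eq_0_iff: "indegree H v = 0 \<longleftrightarrow> (\<forall>u. (u, v) \<notin># edges H)"
  by (auto simp: indegree_def filter_mset_eq_mempty_iff)

lemma out_edges_eq_empty_iff: "out_edges H v = {#} \<longleftrightarrow> (\<forall>w. (v, w) \<notin># edges H)"
  by (auto simp: out_edges_def filter_mset_eq_mempty_iff)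

lemma out_edges_last: "ordered_to w H \<Longrightarrow> out_edges H w = {#}"
  by (auto simp: out_edges_eq_empty_iff ordered_to_def)

text \<open>
  Both reducts result from replacing one of the two edges by \<open>(u, w)\<close>.
\<close>

lemma reduct_splits:
  assumes "reducible_at H u v w"
  obtains M where "edges H = add_mset (u, v) (add_mset (v, w) M)"
    "edges (reduct1 H u v w) = add_mset (u, v) (add_mset (u, w) M)"
    "edges (reduct2 H u v w) = add_mset (v, w) (add_mset (u, w) M)"
proof -
  have uvw: "u < v" "v < w" "(u, v) \<in># edges H" "(v, w) \<in># edges H"
    using assms by (auto simp: reducible_at_def)
  obtain M' where M': "edges H = add_mset (u, v) M'"
    using multi_member_split[OF uvw(3)] by blast
  have "(v, w) \<in># M'"
    using uvw(1,4) unfolding M' by auto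
  from multi_member_split[OF this] obtain M where M: "M' = add_mset (v, w) M"
    by blast
  have H: "edges H = add_mset (u, v) (add_mset (v, w) M)"
    by (simp only: M' M)
  have "edges H - {#(v, w)#} = add_mset (u, v) M" "edges H - {#(u, v)#} = add_mset (v, w) M"
    using uvw unfolding H by auto
  then have "edges (reduct1 H u v w) = add_mset (u, v) (add_mset (u, w) M)"
    "edges (reduct2 H u v w) = add_mset (v, w) (add_mset (u, w) M)"
    by (simp_all add: reduct1_def reduct2_def add_mset_commute[of "(u, w)"])
  with H show ?thesis
    by (rule that)
qed

lemma irreducible_if_alternates: "alternates_at H v \<Longrightarrow> \<not> reducible_at H u v w"
  unfolding reducible_at_def alternates_at_def indegree_eq_0_iff out_edges_eq_empty_iff by blast

lemma alternates_if_irreducible: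
  assumes "ordered_to x H" "\<And>u w. \<not> reducible_at H u v w"
  shows "alternates_at H v"
proof (rule ccontr)
  assume "\<not> alternates_at H v"
  then obtain u w where "(u, v) \<in># edges H" "(v, w) \<in># edges H"
    unfolding alternates_at_def indegree_eq_0_iff out_edges_eq_empty_iff by blast
  moreover from this have "u < v" "v < w"
    using assms(1) unfolding ordered_to_def by fastforce+
  ultimately show False
    using assms(2) unfolding reducible_at_def by blast
qed

lemma vertex_reductions_Leaf:
  assumes "vertex_reductions v H t" "alternates_at H v"
  shows "t = Leaf H"
  using assms(1)
proof (cases rule: vertex_reductions.cases)
  case (reduce u w T1 T2)
  then show ?thesis
    using irreducible_if_alternates[OF assms(2)] by blast
qed

text \<open>
  Each reduction at \<open>v\<close> involves the single outgoing edge \<open>(v, w)\<close> and adds an edge \<open>(u, w)\<close> where \<open>u\<close>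
  already has an outgoing edge. If the graph alternates at such a \<open>u\<close>, then \<open>u\<close> has no incoming edge,
  so the graph still alternates there. The vertices after \<open>v\<close> other than \<open>w\<close> are not
  affected, so that they remain ready for processing.
\<close>

lemma vertex_reductions_leaves:
  assumes "vertex_reductions v H t" "ordered_to w H"
    and "indegree H v = 0 \<or> out_edges H v = {#(v, w)#}"
    and "K \<in># leaves t"
  shows "ordered_to w K \<and> verts K = verts H \<and> size (edges K) = size (edges H) \<and>
    (\<forall>x. x \<noteq> v \<and> x \<noteq> w \<longrightarrow> indegree K x = indegree H x) \<and> indegree K v \<le> indegree H v \<and>
    (\<forall>x>v. out_edges K x = out_edges H x) \<and>
    (\<forall>x. x = v \<or> alternates_at H x \<longrightarrow> alternates_at K x)"
  using assms
proof (induction rule: vertex_reductions.induct)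
  case (stop H)
  then have "alternates_at H v"
    by (intro alternates_if_irreducible)
  then show ?case
    using stop by auto
next
  case (reduce H u x T1 T2)
  obtain M where M: "edges H = add_mset (u, v) (add_mset (v, x) M)"
    "edges (reduct1 H u v x) = add_mset (u, v) (add_mset (u, x) M)"
    "edges (reduct2 H u v x) = add_mset (v, x) (add_mset (u, x) M)"
    using reduct_splits[OF reduce.hyps(1)] by blast
  have uvx: "u < v" "v < x"
    using reduce.hyps(1) by (auto simp: reducible_at_def)
  have "out_edges H v = {#(v, w)#}"
    using reduce.prems(2) M(1) by (auto simp: indegree_def)
  then have x: "x = w" and M_out: "{# e \<in># M. fst e = v #} = {#}"
    using uvx by (auto simp: out_edges_def M(1))
  note Mw = M[unfolded x]
  have H1: "ordered_to w (reduct1 H u v x)" "verts (reduct1 H u v x) = verts H"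
    and H2: "ordered_to w (reduct2 H u v x)" "verts (reduct2 H u v x) = verts H"
    using reduce.prems(1) unfolding ordered_to_def M by (auto simp: reduct1_def reduct2_def)
  have alt: "alternates_at (reduct1 H u v x) y \<and> alternates_at (reduct2 H u v x) y"
    if "alternates_at H y" "y \<noteq> v" for y
  proof (cases "y = w")
    case True
    then show ?thesis
      using out_edges_last[OF H1(1)] out_edges_last[OF H2(1)] by (simp add: alternates_at_def)
  next
    case False
    then show ?thesis
      using that uvx unfolding alternates_at_def indegree_eq_0_iff out_edges_eq_empty_iff x Mw by auto
  qed
  have ready2: "indegree (reduct2 H u v x) v = 0 \<or> out_edges (reduct2 H u v x) v = {#(v, w)#}"
    using uvx M_out unfolding x by (auto simp: out_edges_def Mw(3))
  from reduce.prems(3) consider "K \<in># leaves T1" | "K \<in># leaves T2"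
    by auto
  then show ?case
  proof cases
    case 1
    have alt1: "alternates_at (reduct1 H u v x) v"
      using uvx M_out by (simp add: alternates_at_def out_edges_def M(2))
    then have "K = reduct1 H u v x"
      using vertex_reductions_Leaf[OF reduce.hyps(2)] 1 by simp
    then show ?thesis
      using H1 alt alt1 uvx unfolding x by (auto simp: indegree_def out_edges_def Mw)
  next
    case 2
    have "indegree (reduct2 H u v x) y = indegree H y" if "y \<noteq> v" "y \<noteq> w" for y
      using that unfolding x by (simp add: indegree_def Mw)
    moreover have "indegree (reduct2 H u v x) v \<le> indegree H v"
      using uvx by (simp add: indegree_def M)
    moreover have "out_edges (reduct2 H u v x) y = out_edges H y" if "y > v" for y
      using that uvx by (simp add: out_edges_def M)
    moreover have "size (edges (reduct2 H u v x)) = size (edges H)"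
      by (simp add: M)
    moreover note IH = reduce.IH(2)[OF H2(1) ready2 2]
    moreover have "alternates_at K y" if "y = v \<or> alternates_at H y" for y
      using IH alt[of y] that by (cases "y = v") simp_all
    ultimately show ?thesis
      using H2(2) by simp
  qed
qed

lemma ex1_leaf_path_Node_left:
  assumes "\<exists>!\<pi>. \<pi> \<in> leaf_paths l \<and> Q (leaf_along l \<pi>)"
    and none: "\<And>\<pi>. \<pi> \<in> leaf_paths r \<Longrightarrow> \<not> Q (leaf_along r \<pi>)"
  shows "\<exists>!\<pi>. \<pi> \<in> leaf_paths (Node x l r) \<and> Q (leaf_along (Node x l r) \<pi>)"
proof -
  obtain \<pi> where \<pi>: "\<pi> \<in> leaf_paths l" "Q (leaf_along l \<pi>)"
    and unique: "\<And>\<pi>'. \<pi>' \<in> leaf_paths l \<Longrightarrow> Q (leaf_along l \<pi>') \<Longrightarrow> \<pi>' = \<pi>"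
    using assms(1) by (auto elim!: ex1E)
  show ?thesis
  proof (rule ex1I)
    show "False # \<pi> \<in> leaf_paths (Node x l r) \<and> Q (leaf_along (Node x l r) (False # \<pi>))"
      using \<pi> by simp
    fix \<sigma> assume "\<sigma> \<in> leaf_paths (Node x l r) \<and> Q (leaf_along (Node x l r) \<sigma>)"
    then show "\<sigma> = False # \<pi>"
      using none by (auto dest: unique)
  qed
qed

lemma ex1_leaf_path_Node_right:
  assumes "\<exists>!\<pi>. \<pi> \<in> leaf_paths r \<and> Q (leaf_along r \<pi>)"
    and none: "\<And>\<pi>. \<pi> \<in> leaf_paths l \<Longrightarrow> \<not> Q (leaf_along l \<pi>)"
  shows "\<exists>!\<pi>. \<pi> \<in> leaf_paths (Node x l r) \<and> Q (leaf_along (Node x l r) \<pi>)"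
proof -
  obtain \<pi> where \<pi>: "\<pi> \<in> leaf_paths r" "Q (leaf_along r \<pi>)"
    and unique: "\<And>\<pi>'. \<pi>' \<in> leaf_paths r \<Longrightarrow> Q (leaf_along r \<pi>') \<Longrightarrow> \<pi>' = \<pi>"
    using assms(1) by (auto elim!: ex1E)
  show ?thesis
  proof (rule ex1I)
    show "True # \<pi> \<in> leaf_paths (Node x l r) \<and> Q (leaf_along (Node x l r) (True # \<pi>))"
      using \<pi> by simp
    fix \<sigma> assume "\<sigma> \<in> leaf_paths (Node x l r) \<and> Q (leaf_along (Node x l r) \<sigma>)"
    then show "\<sigma> = True # \<pi>"
      using none by (auto dest: unique)
  qed
qed

text \<open>
  The left child of a reduction cannot be reduced at \<open>v\<close> any further and keeps the current indegree
  of \<open>v\<close>; the right child continues with an indegree smaller by one. So the leaves carry the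
  indegrees \<open>a, a - 1, \<dots>, 0\<close> from left to right.
\<close>

lemma vertex_reductions_unique_leaf:
  assumes "vertex_reductions v H t" "ordered_to w H"
    and "indegree H v = 0 \<or> out_edges H v = {#(v, w)#}" and "c \<le> indegree H v"
  shows "\<exists>!\<pi>. \<pi> \<in> leaf_paths t \<and> indegree (leaf_along t \<pi>) v = c"
  using assms
proof (induction arbitrary: c rule: vertex_reductions.induct)
  case (stop H)
  then have "alternates_at H v"
    by (intro alternates_if_irreducible)
  then have "indegree H v = 0"
    using stop.prems(2) by (auto simp: alternates_at_def)
  then show ?case
    using stop by auto
next
  case (reduce H u x T1 T2)
  obtain M where M: "edges H = add_mset (u, v) (add_mset (v, x) M)"
    "edges (reduct1 H u v x) = add_mset (u, v) (add_mset (u, x) M)"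
    "edges (reduct2 H u v x) = add_mset (v, x) (add_mset (u, x) M)"
    using reduct_splits[OF reduce.hyps(1)] by blast
  have uvx: "u < v" "v < x"
    using reduce.hyps(1) by (auto simp: reducible_at_def)
  have "out_edges H v = {#(v, w)#}"
    using reduce.prems(2) M(1) by (auto simp: indegree_def)
  then have x: "x = w" and M_out: "{# e \<in># M. fst e = v #} = {#}"
    using uvx by (auto simp: out_edges_def M(1))
  note Mw = M[unfolded x]
  have H2: "ordered_to w (reduct2 H u v x)"
    using reduce.prems(1) unfolding ordered_to_def M by auto
  have ready2: "indegree (reduct2 H u v x) v = 0 \<or> out_edges (reduct2 H u v x) v = {#(v, w)#}"
    using uvx M_out unfolding x by (auto simp: out_edges_def Mw(3))
  have deg1: "indegree (reduct1 H u v x) v = indegree H v"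
    and deg2: "Suc (indegree (reduct2 H u v x) v) = indegree H v"
    using uvx by (auto simp: indegree_def M)
  have "alternates_at (reduct1 H u v x) v"
    using uvx M_out by (simp add: alternates_at_def out_edges_def M(2))
  then have T1: "T1 = Leaf (reduct1 H u v x)"
    using vertex_reductions_Leaf[OF reduce.hyps(2)] by simp
  have T2_le: "indegree (leaf_along T2 \<pi>) v \<le> indegree (reduct2 H u v x) v" if "\<pi> \<in> leaf_paths T2" for \<pi>
    using vertex_reductions_leaves[OF reduce.hyps(3) H2 ready2 leaf_along_in_leaves[OF that]] by blast
  show ?case
  proof (cases "c = indegree H v")
    case True
    show ?thesis
    proof (rule ex1_leaf_path_Node_left)
      show "\<exists>!\<pi>. \<pi> \<in> leaf_paths T1 \<and> indegree (leaf_along T1 \<pi>) v = c"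
        using deg1 True by (simp add: T1)
      show "indegree (leaf_along T2 \<pi>) v \<noteq> c" if "\<pi> \<in> leaf_paths T2" for \<pi>
        using T2_le[OF that] deg2 True by simp
    qed
  next
    case False
    show ?thesis
    proof (rule ex1_leaf_path_Node_right)
      show "\<exists>!\<pi>. \<pi> \<in> leaf_paths T2 \<and> indegree (leaf_along T2 \<pi>) v = c"
        using reduce.prems(3) deg2 False by (intro reduce.IH(2)[OF H2 ready2]) simp
      show "indegree (leaf_along T1 \<pi>) v \<noteq> c" if "\<pi> \<in> leaf_paths T1" for \<pi>
        using that deg1 False by (simp add: T1)
    qed
  qed
qed

lemma process_verts_Cons_leaf:
  assumes "process_verts (v # vs) (Leaf H) t"
  obtains s where "vertex_reductions v H s" "grow (\<lambda>K t. process_verts vs (Leaf K) t) s t"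
proof -
  from assms obtain s where s: "grow (vertex_reductions v) (Leaf H) s" "process_verts vs s t"
    by (cases rule: process_verts.cases) auto
  from s(1) have "vertex_reductions v H s"
    by (cases rule: grow.cases)
  then show ?thesis
    using s(2) unfolding process_verts_iff_grow[of vs s t] by (rule that)
qed

lemma process_verts_leaves:
  assumes "process_verts vs (Leaf H) t" "ordered_to w H" "sorted_wrt (<) vs"
    and "\<And>v. v \<in> set vs \<Longrightarrow> v < w \<and> (indegree H v = 0 \<or> out_edges H v = {#(v, w)#})"
    and "\<sigma> \<in> leaf_paths t" and "K = leaf_along t \<sigma>"
  shows "ordered_to w K \<and> verts K = verts H \<and> size (edges K) = size (edges H) \<and>
    (\<forall>x. x \<notin> set vs \<and> x \<noteq> w \<longrightarrow> indegree K x = indegree H x) \<and>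
    (\<forall>x\<in>set vs. indegree K x \<le> indegree H x) \<and>
    (\<forall>x. x \<in> set vs \<or> alternates_at H x \<longrightarrow> alternates_at K x)"
  using assms
proof (induction vs arbitrary: H t \<sigma> K)
  case Nil
  then have "t = Leaf H"
    by (auto elim: process_verts.cases)
  then show ?case
    using Nil by simp
next
  case (Cons v vs)
  obtain s where s: "vertex_reductions v H s" "grow (\<lambda>K t. process_verts vs (Leaf K) t) s t"
    by (rule process_verts_Cons_leaf[OF Cons.prems(1)])
  obtain f where f: "\<And>\<pi>. \<pi> \<in> leaf_paths s \<Longrightarrow> process_verts vs (Leaf (leaf_along s \<pi>)) (f \<pi>)"
    "leaf_paths t = {\<pi> @ \<rho> | \<pi> \<rho>. \<pi> \<in> leaf_paths s \<and> \<rho> \<in> leaf_paths (f \<pi>)}"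
    "\<And>\<pi> \<rho>. \<pi> \<in> leaf_paths s \<Longrightarrow> leaf_along t (\<pi> @ \<rho>) = leaf_along (f \<pi>) \<rho>"
    by (rule grow_paths[OF s(2)], rule that)
  obtain \<pi> \<rho> where \<pi>: "\<sigma> = \<pi> @ \<rho>" "\<pi> \<in> leaf_paths s" "\<rho> \<in> leaf_paths (f \<pi>)"
    using Cons.prems(5) f(2) by blast
  define L where "L = leaf_along s \<pi>"
  have v: "v < w" "indegree H v = 0 \<or> out_edges H v = {#(v, w)#}" "v \<notin> set vs"
    using Cons.prems(3,4) by auto
  note L = vertex_reductions_leaves[OF s(1) Cons.prems(2) v(2) leaf_along_in_leaves[OF \<pi>(2)], folded L_def]
  have K: "K = leaf_along (f \<pi>) \<rho>"
    using f(3)[OF \<pi>(2)] Cons.prems(6) \<pi>(1) by simp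
  have ready: "x < w \<and> (indegree L x = 0 \<or> out_edges L x = {#(x, w)#})" if "x \<in> set vs" for x
    using that L Cons.prems(3) Cons.prems(4)[of x] by auto
  have "ordered_to w L" "sorted_wrt (<) vs"
    using L Cons.prems(3) by auto
  note IH = Cons.IH[OF f(1)[OF \<pi>(2), folded L_def] this ready \<pi>(3) K]
  show ?case
  proof (intro conjI allI ballI impI)
    show "ordered_to w K" "verts K = verts H" "size (edges K) = size (edges H)"
      using IH L by simp_all
    show "indegree K x = indegree H x" if "x \<notin> set (v # vs) \<and> x \<noteq> w" for x
      using IH L that by simp
    show "indegree K x \<le> indegree H x" if "x \<in> set (v # vs)" for x
    proof (cases "x = v")
      case True
      then show ?thesis
        using IH L v by simp
    next
      case False
      then have "x \<in> set vs" "x \<noteq> w"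
        using that ready by auto
      then have "indegree K x \<le> indegree L x" "indegree L x = indegree H x"
        using IH L False by blast+
      then show ?thesis
        by simp
    qed
    show "alternates_at K x" if "x \<in> set (v # vs) \<or> alternates_at H x" for x
      using IH L that by auto
  qed
qed

lemma ex1_conjE: "\<exists>!x. P x \<and> Q x \<Longrightarrow> \<exists>x. P x \<and> Q x \<and> (\<forall>y. P y \<longrightarrow> Q y \<longrightarrow> y = x)"
  by blast

text \<open>
  Processing later vertices does not change the indegree of \<open>v\<close> any more, so the path to a leaf with
  prescribed indegrees is found one vertex at a time.
\<close>

lemma process_verts_unique_leaf:
  assumes "process_verts vs (Leaf H) t" "ordered_to w H" "sorted_wrt (<) vs"
    and "\<And>v. v \<in> set vs \<Longrightarrow> v < w \<and> (indegree H v = 0 \<or> out_edges H v = {#(v, w)#})"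
    and "\<And>v. v \<in> set vs \<Longrightarrow> c v \<le> indegree H v"
  shows "\<exists>!\<sigma>. \<sigma> \<in> leaf_paths t \<and> (\<forall>v\<in>set vs. indegree (leaf_along t \<sigma>) v = c v)"
  using assms
proof (induction vs arbitrary: H t)
  case Nil
  then have "t = Leaf H"
    by (auto elim: process_verts.cases)
  then show ?case
    by simp
next
  case (Cons v vs)
  obtain s where s: "vertex_reductions v H s" "grow (\<lambda>K t. process_verts vs (Leaf K) t) s t"
    by (rule process_verts_Cons_leaf[OF Cons.prems(1)])
  obtain f where f: "\<And>\<pi>. \<pi> \<in> leaf_paths s \<Longrightarrow> process_verts vs (Leaf (leaf_along s \<pi>)) (f \<pi>)"
    "leaf_paths t = {\<pi> @ \<rho> | \<pi> \<rho>. \<pi> \<in> leaf_paths s \<and> \<rho> \<in> leaf_paths (f \<pi>)}"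
    "\<And>\<pi> \<rho>. \<pi> \<in> leaf_paths s \<Longrightarrow> leaf_along t (\<pi> @ \<rho>) = leaf_along (f \<pi>) \<rho>"
    by (rule grow_paths[OF s(2)], rule that)
  have v: "v < w" "indegree H v = 0 \<or> out_edges H v = {#(v, w)#}" "v \<notin> set vs"
    using Cons.prems(3,4) by auto
  note L = vertex_reductions_leaves[OF s(1) Cons.prems(2) v(2) leaf_along_in_leaves]
  have sorted: "sorted_wrt (<) vs"
    using Cons.prems(3) by simp
  have ready: "x < w \<and> (indegree (leaf_along s \<pi>) x = 0 \<or> out_edges (leaf_along s \<pi>) x = {#(x, w)#})"
    and bound: "c x \<le> indegree (leaf_along s \<pi>) x" if x: "x \<in> set vs" and \<pi>: "\<pi> \<in> leaf_paths s" for x \<pi>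
  proof -
    have x': "v < x" "x \<in> set (v # vs)"
      using x Cons.prems(3) by simp_all
    then have "x < w"
      using Cons.prems(4) by blast
    then have "indegree (leaf_along s \<pi>) x = indegree H x" "out_edges (leaf_along s \<pi>) x = out_edges H x"
      using L[OF \<pi>] x'(1) by simp_all
    then show "x < w \<and> (indegree (leaf_along s \<pi>) x = 0 \<or> out_edges (leaf_along s \<pi>) x = {#(x, w)#})"
      "c x \<le> indegree (leaf_along s \<pi>) x"
      using Cons.prems(4)[OF x'(2)] Cons.prems(5)[OF x'(2)] by simp_all
  qed
  have unchanged: "indegree (leaf_along (f \<pi>) \<rho>) v = indegree (leaf_along s \<pi>) v"
    if "\<pi> \<in> leaf_paths s" "\<rho> \<in> leaf_paths (f \<pi>)" for \<pi> \<rho>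
    using process_verts_leaves[OF f(1)[OF that(1)] conjunct1[OF L[OF that(1)]] sorted ready[OF _ that(1)] that(2) refl] v
    by blast
  obtain \<pi> where \<pi>: "\<pi> \<in> leaf_paths s" "indegree (leaf_along s \<pi>) v = c v"
    "\<And>\<pi>'. \<pi>' \<in> leaf_paths s \<Longrightarrow> indegree (leaf_along s \<pi>') v = c v \<Longrightarrow> \<pi>' = \<pi>"
    using vertex_reductions_unique_leaf[OF s(1) Cons.prems(2) v(2) Cons.prems(5)]
    by (auto elim!: ex1E)
  have "ordered_to w (leaf_along s \<pi>)"
    using L[OF \<pi>(1)] by blast
  then have IH: "\<exists>!\<rho>. \<rho> \<in> leaf_paths (f \<pi>) \<and> (\<forall>x\<in>set vs. indegree (leaf_along (f \<pi>) \<rho>) x = c x)"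
    by (rule Cons.IH[OF f(1)[OF \<pi>(1)] _ sorted ready[OF _ \<pi>(1)] bound[OF _ \<pi>(1)]])
  from ex1_conjE[OF IH] obtain \<rho> where \<rho>: "\<rho> \<in> leaf_paths (f \<pi>)"
      "\<forall>x\<in>set vs. indegree (leaf_along (f \<pi>) \<rho>) x = c x"
      "\<forall>\<rho>'. \<rho>' \<in> leaf_paths (f \<pi>) \<longrightarrow> (\<forall>x\<in>set vs. indegree (leaf_along (f \<pi>) \<rho>') x = c x) \<longrightarrow> \<rho>' = \<rho>"
    by (elim exE conjE)
  show ?case
  proof (rule ex1I[of _ "\<pi> @ \<rho>"])
    have "indegree (leaf_along t (\<pi> @ \<rho>)) v = c v"
      using f(3)[OF \<pi>(1), of \<rho>] unchanged[OF \<pi>(1) \<rho>(1)] \<pi>(2) by simp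
    moreover have "\<forall>x\<in>set vs. indegree (leaf_along t (\<pi> @ \<rho>)) x = c x"
      using f(3)[OF \<pi>(1), of \<rho>] \<rho>(2) by simp
    moreover have "\<pi> @ \<rho> \<in> leaf_paths t"
      unfolding f(2) using \<pi>(1) \<rho>(1) by blast
    ultimately show "\<pi> @ \<rho> \<in> leaf_paths t \<and> (\<forall>x\<in>set (v # vs). indegree (leaf_along t (\<pi> @ \<rho>)) x = c x)"
      by simp
  next
    fix \<sigma> assume \<sigma>: "\<sigma> \<in> leaf_paths t \<and> (\<forall>x\<in>set (v # vs). indegree (leaf_along t \<sigma>) x = c x)"
    then obtain \<pi>' \<rho>' where *: "\<sigma> = \<pi>' @ \<rho>'" "\<pi>' \<in> leaf_paths s" "\<rho>' \<in> leaf_paths (f \<pi>')"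
      using f(2) by blast
    have "indegree (leaf_along s \<pi>') v = c v"
      using \<sigma> unchanged[OF *(2,3)] f(3)[OF *(2), of \<rho>'] by (simp add: *(1))
    then have eq: "\<pi>' = \<pi>"
      by (rule \<pi>(3)[OF *(2)])
    moreover have "\<rho>' = \<rho>"
    proof -
      have "\<forall>x\<in>set vs. indegree (leaf_along (f \<pi>) \<rho>') x = c x"
        using \<sigma> f(3)[OF *(2), of \<rho>'] by (simp add: *(1) eq)
      then show ?thesis
        using \<rho>(3) *(3) eq by blast
    qed
    ultimately show "\<sigma> = \<pi> @ \<rho>"
      using * by simp
  qed
qed

section \<open>Leaves of the trees of the initial graphs\<close>

definition leaf_state :: "multigraph \<Rightarrow> nat \<Rightarrow> multigraph \<Rightarrow> bool" where
  "leaf_state G i K \<longleftrightarrow> ordered_to i K \<and> verts K = {1..i} \<and>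
     size (edges K) = size (edges (initial_graph G i)) \<and> (\<forall>v. alternates_at K v)"

lemma indegree_first: "ordered_to i K \<Longrightarrow> v \<le> 1 \<Longrightarrow> indegree K v = 0"
  unfolding indegree_eq_0_iff ordered_to_def by fastforce

text \<open>
  No edge ends at the vertex 1.
\<close>

lemma sum_indegree:
  assumes "ordered_to (Suc i) K"
  shows "(\<Sum>k=1..i. indegree K (k + 1)) = size (edges K)"
proof -
  have "(\<Sum>v\<in>{2..Suc i}. indegree K v) = size (edges K)"
    using assms
  proof -
    have "(\<Sum>v\<in>{2..Suc i}. size {# e \<in># M. snd e = v #}) = size M"
      if "\<forall>(u, v)\<in>#M. 1 \<le> u \<and> u < v \<and> v \<le> Suc i" for M
      using that
    proof (induction M)
      case empty
      show ?case by simp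
    next
      case (add e M)
      have "(\<Sum>v\<in>{2..Suc i}. size {# e' \<in># add_mset e M. snd e' = v #}) =
          (\<Sum>v\<in>{2..Suc i}. (if v = snd e then 1 else 0) + size {# e' \<in># M. snd e' = v #})"
        by (intro sum.cong) auto
      also have "\<dots> = (\<Sum>v\<in>{2..Suc i}. if v = snd e then 1 else 0) + size M"
        using add by (simp add: sum.distrib)
      also have "(\<Sum>v\<in>{2..Suc i}. if v = snd e then 1 else (0::nat)) = 1"
      proof -
        have "snd e \<in> {2..Suc i}"
          using add.prems by (cases e) auto
        then show ?thesis
          by simp
      qed
      finally show ?case
        by simp
    qed
    from this[OF assms[unfolded ordered_to_def]] show ?thesis
      by (simp only: indegree_def)
  qed
  moreover have "(\<Sum>k=1..i. indegree K (k + 1)) = (\<Sum>v\<in>{2..Suc i}. indegree K v)"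
    using sum.shift_bounds_cl_nat_ivl[of "indegree K" 1 1 i] by (simp add: numeral_2_eq_2)
  ultimately show ?thesis
    by simp
qed

lemma indegree_sequence_nth:
  assumes "verts K = {1..i + 1}" "1 \<le> j" "j \<le> i"
  shows "indegree_sequence K ! (j - 1) = indegree K (j + 1)"
proof -
  have "verts K - {1} = {2..<i + 2}"
    using assms(1) by auto
  then have "sorted_list_of_set (verts K - {1}) = [2..<i + 2]"
    by (simp del: upt_Suc)
  then show ?thesis
    using assms(2,3) by (simp add: indegree_sequence_def del: upt_Suc)
qed

locale reduction_tree_setup =
  fixes G :: multigraph and n :: nat and T :: "nat \<Rightarrow> multigraph btree"
  assumes n: "n \<ge> 1" and graph: "multigraph_on {1..n + 1} G" and loopless: "loopless G"
    and multiplicity: "\<forall>i j. count (edges G) (i, j) > 1 \<longrightarrow> i = 1"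
    and construction: "tree_construction G n T"
begin

lemma edge_bounds: "(u, v) \<in># edges G \<Longrightarrow> 1 \<le> u \<and> u < v \<and> v \<le> n + 1"
  using graph loopless unfolding multigraph_on_def loopless_def by fastforce

lemma edges_initial_graph: "edges (initial_graph G i) = {# e \<in># edges G. snd e \<le> i #}"
proof -
  have "{# e \<in># edges G. fst e \<in> {1..i} \<and> snd e \<in> {1..i} #} = {# e \<in># edges G. snd e \<le> i #}"
  proof (rule filter_mset_cong[OF refl])
    fix e assume "e \<in># edges G"
    then show "fst e \<in> {1..i} \<and> snd e \<in> {1..i} \<longleftrightarrow> snd e \<le> i"
      using edge_bounds[of "fst e" "snd e"] by auto
  qed
  then show ?thesis
    by (simp add: initial_graph_def restrict_verts_def)
qed

lemma size_initial_graph_Suc: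
  "size (edges (initial_graph G (i + 1))) =
    size (edges (initial_graph G i)) + size {# e \<in># edges G. snd e = i + 1 #}"
proof -
  have "{# e \<in># M. snd e \<le> i + 1 #} = {# e \<in># M. snd e \<le> i #} + {# e \<in># M. snd e = i + 1 #}"
    for M :: "(nat \<times> nat) multiset"
    by (induction M) (auto simp: le_Suc_eq)
  then show ?thesis
    by (simp add: edges_initial_graph)
qed

lemma T_2: "T 2 = Leaf (initial_graph G 2)"
  and next_T: "2 \<le> i \<Longrightarrow> i \<le> n \<Longrightarrow> next_tree G i (T i) (T (i + 1))"
  using construction by (auto simp: tree_construction_def)

abbreviation entered :: "nat \<Rightarrow> nat list" where
  "entered i \<equiv> filter (\<lambda>v. (v, i + 1) \<in># edges G) [1..<i + 1]"

lemma sorted_entered: "sorted_wrt (<) (entered i)"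
  by (rule sorted_wrt_filter[OF sorted_wrt_upt])

text \<open>
  A vertex \<open>v\<close> with incoming edges is not 1, so its new edge \<open>(v, i + 1)\<close> is simple, and by alternation
  it has no outgoing edge in \<open>K\<close>. This is where the bound on multiplicities enters.
\<close>

lemma add_vertex_ready:
  assumes K: "leaf_state G i K"
  defines "H \<equiv> add_vertex G (i + 1) K"
  shows "ordered_to (i + 1) H" "verts H = {1..i + 1}"
    "size (edges H) = size (edges (initial_graph G (i + 1)))"
    "v \<noteq> i + 1 \<Longrightarrow> indegree H v = indegree K v"
    "v \<in> set (entered i) \<Longrightarrow> v < i + 1 \<and> (indegree H v = 0 \<or> out_edges H v = {#(v, i + 1)#})"
    "v \<notin> set (entered i) \<Longrightarrow> alternates_at H v"
proof -
  have H: "edges H = edges K + {# e \<in># edges G. snd e = i + 1 #}"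
    by (simp add: H_def add_vertex_def)
  have K': "ordered_to i K" "verts K = {1..i}" "\<And>v. alternates_at K v"
    using K by (auto simp: leaf_state_def)
  show ord: "ordered_to (i + 1) H"
    using K'(1) edge_bounds unfolding ordered_to_def H by fastforce
  show "verts H = {1..i + 1}"
    using K'(2) by (auto simp: H_def add_vertex_def)
  show "size (edges H) = size (edges (initial_graph G (i + 1)))"
    unfolding size_initial_graph_Suc using K by (simp add: H leaf_state_def)
  show deg: "indegree H v = indegree K v" if "v \<noteq> i + 1" for v
    using that by (auto simp: indegree_def H filter_filter_mset)
  have out: "out_edges H v = out_edges K v + {# e \<in># edges G. e = (v, i + 1) #}" for v
    unfolding out_edges_def H filter_union_mset filter_filter_mset
    by (intro arg_cong2[of _ _ _ _ "(+)"] filter_mset_cong) auto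
  show "v < i + 1 \<and> (indegree H v = 0 \<or> out_edges H v = {#(v, i + 1)#})" if v: "v \<in> set (entered i)"
  proof -
    have v': "1 \<le> v" "v < i + 1" "(v, i + 1) \<in># edges G"
      using v by auto
    have "out_edges H v = {#(v, i + 1)#}" if "indegree H v \<noteq> 0"
    proof -
      have "v \<noteq> 1"
        using that indegree_first[OF ord, of v] by auto
      then have "count (edges G) (v, i + 1) \<le> 1"
        using multiplicity not_less by blast
      moreover have "count (edges G) (v, i + 1) \<ge> 1"
        using v'(3) by (simp add: Suc_leI)
      ultimately have "count (edges G) (v, i + 1) = 1"
        by linarith
      moreover have "out_edges K v = {#}"
        using K'(3)[of v] that deg[of v] v' by (auto simp: alternates_at_def)
      ultimately show ?thesis
        by (simp add: out filter_eq_replicate_mset)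
    qed
    then show ?thesis
      using v' by blast
  qed
  show "alternates_at H v" if v: "v \<notin> set (entered i)"
  proof (cases "v = i + 1")
    case True
    then show ?thesis
      using out_edges_last[OF ord] by (simp add: alternates_at_def)
  next
    case False
    have "(v, i + 1) \<notin># edges G"
      using v edge_bounds[of v "i + 1"] by auto
    then have "{# e \<in># edges G. e = (v, i + 1) #} = {#}"
      by auto
    then show ?thesis
      using K'(3)[of v] deg[OF False] out[of v] unfolding alternates_at_def by simp
  qed
qed

text \<open>
  Passing from row \<open>i - 1\<close> to row \<open>i\<close> of an array: below each leaf the new indegrees of the vertices
  with an edge to \<open>i + 1\<close> can be chosen independently, and each choice occurs at one leaf.
\<close>

lemma next_tree_paths:
  assumes i: "2 \<le> i" "i \<le> n" and states: "\<And>\<pi>. \<pi> \<in> leaf_paths (T i) \<Longrightarrow> leaf_state G i (leaf_along (T i) \<pi>)"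
  obtains s where
    "leaf_paths (T (i + 1)) = {\<pi> @ \<rho> | \<pi> \<rho>. \<pi> \<in> leaf_paths (T i) \<and> \<rho> \<in> leaf_paths (s \<pi>)}"
    "\<And>\<pi> \<rho>. \<pi> \<in> leaf_paths (T i) \<Longrightarrow> leaf_along (T (i + 1)) (\<pi> @ \<rho>) = leaf_along (s \<pi>) \<rho>"
    "\<And>\<pi> \<rho>. \<pi> \<in> leaf_paths (T i) \<Longrightarrow> \<rho> \<in> leaf_paths (s \<pi>) \<Longrightarrow> leaf_state G (i + 1) (leaf_along (s \<pi>) \<rho>)"
    "\<And>\<pi> \<rho> x. \<pi> \<in> leaf_paths (T i) \<Longrightarrow> \<rho> \<in> leaf_paths (s \<pi>) \<Longrightarrow> x \<le> i \<Longrightarrow>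
       (if (x, i + 1) \<in># edges G then indegree (leaf_along (s \<pi>) \<rho>) x \<le> indegree (leaf_along (T i) \<pi>) x
        else indegree (leaf_along (s \<pi>) \<rho>) x = indegree (leaf_along (T i) \<pi>) x)"
    "\<And>\<pi> c. \<pi> \<in> leaf_paths (T i) \<Longrightarrow>
       \<forall>x. (x, i + 1) \<in># edges G \<longrightarrow> c x \<le> indegree (leaf_along (T i) \<pi>) x \<Longrightarrow>
       \<exists>!\<rho>. \<rho> \<in> leaf_paths (s \<pi>) \<and> (\<forall>x. (x, i + 1) \<in># edges G \<longrightarrow> indegree (leaf_along (s \<pi>) \<rho>) x = c x)"
proof -
  have grow: "grow (\<lambda>H t. process_verts (entered i) (Leaf H) t) (map_btree (add_vertex G (i + 1)) (T i)) (T (i + 1))"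
    using next_T[OF i] by (simp only: next_tree_def process_verts_iff_grow[symmetric])
  obtain s where s: "\<And>\<pi>. \<pi> \<in> leaf_paths (map_btree (add_vertex G (i + 1)) (T i)) \<Longrightarrow>
      process_verts (entered i) (Leaf (leaf_along (map_btree (add_vertex G (i + 1)) (T i)) \<pi>)) (s \<pi>)"
    "leaf_paths (T (i + 1)) = {\<pi> @ \<rho> | \<pi> \<rho>. \<pi> \<in> leaf_paths (map_btree (add_vertex G (i + 1)) (T i)) \<and> \<rho> \<in> leaf_paths (s \<pi>)}"
    "\<And>\<pi> \<rho>. \<pi> \<in> leaf_paths (map_btree (add_vertex G (i + 1)) (T i)) \<Longrightarrow> leaf_along (T (i + 1)) (\<pi> @ \<rho>) = leaf_along (s \<pi>) \<rho>"
    by (rule grow_paths[OF grow], rule that)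
  note s = s[unfolded leaf_paths_map leaf_along_map]
  have entered_iff: "x \<in> set (entered i) \<longleftrightarrow> (x, i + 1) \<in># edges G" for x
    using edge_bounds[of x "i + 1"] by auto
  note ready = add_vertex_ready[OF states]
  have leaf': "leaf_state G (i + 1) (leaf_along (s \<pi>) \<rho>)"
    "x \<le> i \<Longrightarrow> (if (x, i + 1) \<in># edges G then indegree (leaf_along (s \<pi>) \<rho>) x \<le> indegree (leaf_along (T i) \<pi>) x
        else indegree (leaf_along (s \<pi>) \<rho>) x = indegree (leaf_along (T i) \<pi>) x)"
    if \<pi>: "\<pi> \<in> leaf_paths (T i)" and \<rho>: "\<rho> \<in> leaf_paths (s \<pi>)" for \<pi> \<rho> x
  proof -
    define H where "H = add_vertex G (i + 1) (leaf_along (T i) \<pi>)"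
    define K where "K = leaf_along (s \<pi>) \<rho>"
    note H = ready[OF \<pi>, folded H_def]
    have leaf: "ordered_to (i + 1) K" "verts K = verts H" "size (edges K) = size (edges H)"
      "\<And>x. x \<notin> set (entered i) \<and> x \<noteq> i + 1 \<longrightarrow> indegree K x = indegree H x"
      "\<And>x. x \<in> set (entered i) \<Longrightarrow> indegree K x \<le> indegree H x"
      "\<And>x. x \<in> set (entered i) \<or> alternates_at H x \<longrightarrow> alternates_at K x"
      using process_verts_leaves[OF s(1)[OF \<pi>, folded H_def] H(1) sorted_entered H(5) \<rho> K_def] by blast+
    have alt: "alternates_at K x" for x
      using leaf(6)[of x] H(6)[of x] by blast
    show "leaf_state G (i + 1) (leaf_along (s \<pi>) \<rho>)"
      unfolding leaf_state_def K_def[symmetric]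
      by (intro conjI allI alt leaf(1) trans[OF leaf(2) H(2)] trans[OF leaf(3) H(3)])
    show "if (x, i + 1) \<in># edges G then indegree (leaf_along (s \<pi>) \<rho>) x \<le> indegree (leaf_along (T i) \<pi>) x
        else indegree (leaf_along (s \<pi>) \<rho>) x = indegree (leaf_along (T i) \<pi>) x" if "x \<le> i"
    proof (cases "(x, i + 1) \<in># edges G")
      case True
      then have "indegree K x \<le> indegree H x"
        by (intro leaf(5) iffD2[OF entered_iff])
      then show ?thesis
        using H(4)[of x] that True by (simp add: K_def)
    next
      case False
      then have "indegree K x = indegree H x"
        using leaf(4)[of x] that by (simp only: entered_iff) simp
      then show ?thesis
        using H(4)[of x] that False by (simp add: K_def)
    qed
  qed
  have unique: "\<exists>!\<rho>. \<rho> \<in> leaf_paths (s \<pi>) \<and> (\<forall>x. (x, i + 1) \<in># edges G \<longrightarrow> indegree (leaf_along (s \<pi>) \<rho>) x = c x)"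
    if \<pi>: "\<pi> \<in> leaf_paths (T i)" and c: "\<forall>x. (x, i + 1) \<in># edges G \<longrightarrow> c x \<le> indegree (leaf_along (T i) \<pi>) x"
    for \<pi> c
  proof -
    have "c x \<le> indegree (add_vertex G (i + 1) (leaf_along (T i) \<pi>)) x" if "x \<in> set (entered i)" for x
      using c[rule_format, of x] that ready(4)[OF \<pi>, of x] edge_bounds[of x "i + 1"] by auto
    from process_verts_unique_leaf[OF s(1)[OF \<pi>] ready(1)[OF \<pi>] sorted_entered ready(5)[OF \<pi>] this]
    show ?thesis
      unfolding Ball_def entered_iff .
  qed
  show ?thesis
    by (rule that[OF s(2,3) leaf' unique])
qed

lemma leaf_states: "2 \<le> i \<Longrightarrow> i \<le> n + 1 \<Longrightarrow> \<pi> \<in> leaf_paths (T i) \<Longrightarrow> leaf_state G i (leaf_along (T i) \<pi>)"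
proof (induction i arbitrary: \<pi> rule: dec_induct)
  case base
  have "\<not> ((u, v) \<in># edges (initial_graph G 2) \<and> (v, w) \<in># edges (initial_graph G 2))" for u v w
    using edge_bounds[of u v] edge_bounds[of v w] by (auto simp: edges_initial_graph)
  then have "alternates_at (initial_graph G 2) v" for v
    unfolding alternates_at_def indegree_eq_0_iff out_edges_eq_empty_iff by blast
  moreover have "ordered_to 2 (initial_graph G 2)"
    using edge_bounds by (auto simp: ordered_to_def edges_initial_graph)
  moreover have "verts (initial_graph G 2) = {1..2}"
    using graph n by (auto simp: initial_graph_def restrict_verts_def multigraph_on_def)
  ultimately show ?case
    by (simp add: T_2 leaf_state_def)
next
  case (step i)
  have i: "2 \<le> i" "i \<le> n"
    using step by auto
  have states: "\<And>\<pi>. \<pi> \<in> leaf_paths (T i) \<Longrightarrow> leaf_state G i (leaf_along (T i) \<pi>)"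
    using step i by auto
  obtain s where s: "leaf_paths (T (i + 1)) = {\<pi> @ \<rho> | \<pi> \<rho>. \<pi> \<in> leaf_paths (T i) \<and> \<rho> \<in> leaf_paths (s \<pi>)}"
    "\<And>\<pi> \<rho>. \<pi> \<in> leaf_paths (T i) \<Longrightarrow> leaf_along (T (i + 1)) (\<pi> @ \<rho>) = leaf_along (s \<pi>) \<rho>"
    "\<And>\<pi> \<rho>. \<pi> \<in> leaf_paths (T i) \<Longrightarrow> \<rho> \<in> leaf_paths (s \<pi>) \<Longrightarrow> leaf_state G (i + 1) (leaf_along (s \<pi>) \<rho>)"
    by (rule next_tree_paths[OF i states]) (assumption, rule that)
  obtain \<pi>' \<rho> where "\<pi> = \<pi>' @ \<rho>" "\<pi>' \<in> leaf_paths (T i)" "\<rho> \<in> leaf_paths (s \<pi>')"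
    using step.prems(2) s(1) by auto
  then show ?case
    using s(2,3) by simp
qed

end

section \<open>Flow counts along the reduction tree\<close>

definition negligible :: "nat \<Rightarrow> (nat \<Rightarrow> real) \<Rightarrow> bool" where
  "negligible D h \<longleftrightarrow> (\<lambda>N. h N / real N ^ D) \<longlonglongrightarrow> 0"

lemma negligible_add: "negligible D f \<Longrightarrow> negligible D g \<Longrightarrow> negligible D (\<lambda>N. f N + g N)"
  unfolding negligible_def using tendsto_add[of "\<lambda>N. f N / real N ^ D" 0 _ "\<lambda>N. g N / real N ^ D" 0]
  by (simp add: add_divide_distrib)

lemma negligible_zero: "negligible D (\<lambda>N. 0)"
  by (simp add: negligible_def)

lemma network_flows_reduction_negligible:
  assumes M: "internal n (add_mset (i, j) (add_mset (j, k) M))" and D: "D = size M + 2 + n"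
  shows "negligible D (\<lambda>N. real (card (network_flows n (add_mset (i, j) (add_mset (j, k) M)) N)) -
    (real (card (network_flows n (add_mset (i, j) (add_mset (i, k) M)) N)) +
     real (card (network_flows n (add_mset (j, k) (add_mset (i, k) M)) N))))"
proof -
  let ?c = "\<lambda>M N. real (card (network_flows n M N))"
  have "i < j \<and> j < k"
    using M by (auto simp: internal_def)
  then have M3: "internal n (add_mset (i, k) M)"
    using M by (auto simp: internal_def)
  have eq: "?c (add_mset (i, j) (add_mset (j, k) M)) N -
      (?c (add_mset (i, j) (add_mset (i, k) M)) N + ?c (add_mset (j, k) (add_mset (i, k) M)) N) =
      - ?c (add_mset (i, k) M) N" for N
    using network_flows_reduction[of n M i j k N] M by simp
  have bound: "norm (- ?c (add_mset (i, k) M) N / real N ^ D) \<le> real (n + 3) ^ (D - 1) * (1 / real N)"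
    if N: "N \<ge> 1" for N
  proof -
    have "?c (add_mset (i, k) M) N \<le> real ((N * (n + 2) + 1) ^ (D - 1))"
    proof -
      have exponent: "D - 1 = size (add_mset (i, k) M) + n"
        by (simp add: D)
      show ?thesis
        using card_network_flows_le[OF M3, of N] unfolding exponent by (simp only: of_nat_le_iff)
    qed
    also have "\<dots> \<le> real ((N * (n + 3)) ^ (D - 1))"
      using N by (intro of_nat_mono power_mono) (auto simp: algebra_simps)
    also have "\<dots> = real (n + 3) ^ (D - 1) * real N ^ (D - 1)"
      by (simp only: of_nat_power of_nat_mult power_mult_distrib mult.commute)
    finally have "?c (add_mset (i, k) M) N / real N ^ D \<le>
        real (n + 3) ^ (D - 1) * real N ^ (D - 1) / real N ^ D"
      by (rule divide_right_mono) simp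
    moreover have "real N ^ D = real N ^ (D - 1) * real N"
      by (simp add: D)
    ultimately have "?c (add_mset (i, k) M) N / real N ^ D \<le> real (n + 3) ^ (D - 1) * (1 / real N)"
      using N by simp
    then show ?thesis
      by simp
  qed
  have "(\<lambda>N. real (n + 3) ^ (D - 1) * (1 / real N)) \<longlonglongrightarrow> real (n + 3) ^ (D - 1) * 0"
    by (intro tendsto_intros lim_1_over_n)
  then have "(\<lambda>N. - ?c (add_mset (i, k) M) N / real N ^ D) \<longlonglongrightarrow> 0"
    by (intro Lim_null_comparison[OF eventually_sequentiallyI[OF bound]]) simp_all
  then show ?thesis
    unfolding negligible_def eq .
qed

text \<open>
  If the sum of \<open>\<phi>\<close> over the leaves of a small tree agrees with the value at its root up to a
  negligible error, then growing such trees at the leaves of a tree does not change the sum there.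
  The predicate \<open>P\<close> is an invariant of the labels.
\<close>

lemma grow_sum_negligible:
  fixes \<phi> :: "'a \<Rightarrow> nat \<Rightarrow> real"
  assumes "grow R T T'"
    and "\<And>x t. R x t \<Longrightarrow> P x \<Longrightarrow> negligible D (\<lambda>N. \<phi> x N - (\<Sum>y\<in>#leaves t. \<phi> y N)) \<and> (\<forall>y\<in>#leaves t. P y)"
    and "\<forall>x\<in>#leaves T. P x"
  shows "negligible D (\<lambda>N. (\<Sum>x\<in>#leaves T. \<phi> x N) - (\<Sum>y\<in>#leaves T'. \<phi> y N)) \<and> (\<forall>y\<in>#leaves T'. P y)"
  using assms
proof (induction rule: grow.induct)
  case (grow_Leaf x t)
  then show ?case by simp
next
  case (grow_Node l l' r r' x)
  have l: "negligible D (\<lambda>N. (\<Sum>x\<in>#leaves l. \<phi> x N) - (\<Sum>y\<in>#leaves l'. \<phi> y N)) \<and> (\<forall>y\<in>#leaves l'. P y)"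
    by (rule grow_Node.IH(1)[OF grow_Node.prems(1)]) (use grow_Node.prems(2) in auto)
  have r: "negligible D (\<lambda>N. (\<Sum>x\<in>#leaves r. \<phi> x N) - (\<Sum>y\<in>#leaves r'. \<phi> y N)) \<and> (\<forall>y\<in>#leaves r'. P y)"
    by (rule grow_Node.IH(2)[OF grow_Node.prems(1)]) (use grow_Node.prems(2) in auto)
  have "negligible D (\<lambda>N. (\<Sum>x\<in>#leaves (Node x l r). \<phi> x N) - (\<Sum>y\<in>#leaves (Node x l' r'). \<phi> y N))"
    using negligible_add[OF conjunct1[OF l] conjunct1[OF r]] by (simp add: algebra_simps)
  then show ?case
    using l r by auto
qed

lemma process_verts_sum_negligible:
  fixes \<phi> :: "multigraph \<Rightarrow> nat \<Rightarrow> real"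
  assumes "process_verts vs T T'"
    and "\<And>v H t. vertex_reductions v H t \<Longrightarrow> P H \<Longrightarrow>
      negligible D (\<lambda>N. \<phi> H N - (\<Sum>K\<in>#leaves t. \<phi> K N)) \<and> (\<forall>K\<in>#leaves t. P K)"
    and "\<forall>H\<in>#leaves T. P H"
  shows "negligible D (\<lambda>N. (\<Sum>H\<in>#leaves T. \<phi> H N) - (\<Sum>K\<in>#leaves T'. \<phi> K N)) \<and> (\<forall>K\<in>#leaves T'. P K)"
  using assms
proof (induction rule: process_verts.induct)
  case (process_Nil T)
  then show ?case
    by (simp add: negligible_zero)
next
  case (process_Cons v T T' vs T'')
  have 1: "negligible D (\<lambda>N. (\<Sum>H\<in>#leaves T. \<phi> H N) - (\<Sum>K\<in>#leaves T'. \<phi> K N)) \<and> (\<forall>K\<in>#leaves T'. P K)"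
    by (rule grow_sum_negligible[OF process_Cons.hyps(1) process_Cons.prems])
  then have 2: "negligible D (\<lambda>N. (\<Sum>H\<in>#leaves T'. \<phi> H N) - (\<Sum>K\<in>#leaves T''. \<phi> K N)) \<and> (\<forall>K\<in>#leaves T''. P K)"
    by (intro process_Cons.IH[OF process_Cons.prems(1)]) simp_all
  show ?case
    using negligible_add[OF conjunct1[OF 1] conjunct1[OF 2]] conjunct2[OF 2] by simp
qed

context reduction_tree_setup
begin

abbreviation dimension :: nat where
  "dimension \<equiv> size (edges G) + n"

text \<open>
  The edges of \<open>K\<close> together with those edges of \<open>G\<close> that are added after stage \<open>i\<close>. With them, adding
  the vertex \<open>i + 1\<close> becomes invisible, and the whole construction is a sequence of
  reductions of \<open>G\<close>.
\<close>

definition completed :: "nat \<Rightarrow> multigraph \<Rightarrow> (nat \<times> nat) multiset" where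
  "completed i K = edges K + {# e \<in># edges G. snd e > i #}"

definition flow_number :: "nat \<Rightarrow> multigraph \<Rightarrow> nat \<Rightarrow> real" where
  "flow_number i K N = real (card (network_flows n (completed i K) N))"

definition completable :: "nat \<Rightarrow> multigraph \<Rightarrow> bool" where
  "completable i K \<longleftrightarrow> internal n (completed i K) \<and> size (completed i K) = size (edges G)"

lemma vertex_reductions_negligible:
  assumes "vertex_reductions v H t" "completable i H"
  shows "negligible dimension (\<lambda>N. flow_number i H N - (\<Sum>K\<in>#leaves t. flow_number i K N)) \<and>
    (\<forall>K\<in>#leaves t. completable i K)"
  using assms
proof (induction rule: vertex_reductions.induct)
  case (stop H)
  then show ?case
    by (simp add: negligible_zero)
next
  case (reduce H u w T1 T2)
  obtain M where M: "edges H = add_mset (u, v) (add_mset (v, w) M)"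
    "edges (reduct1 H u v w) = add_mset (u, v) (add_mset (u, w) M)"
    "edges (reduct2 H u v w) = add_mset (v, w) (add_mset (u, w) M)"
    using reduct_splits[OF reduce.hyps(1)] by blast
  define M' where "M' = M + {# e \<in># edges G. snd e > i #}"
  have c: "completed i H = add_mset (u, v) (add_mset (v, w) M')"
    "completed i (reduct1 H u v w) = add_mset (u, v) (add_mset (u, w) M')"
    "completed i (reduct2 H u v w) = add_mset (v, w) (add_mset (u, w) M')"
    by (simp_all add: completed_def M M'_def)
  have H: "internal n (add_mset (u, v) (add_mset (v, w) M'))" "dimension = size M' + 2 + n"
    using reduce.prems unfolding completable_def c by auto
  have "completable i (reduct1 H u v w)" "completable i (reduct2 H u v w)"
    using H reduce.prems unfolding completable_def c by (auto simp: internal_def)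
  then have IH: "negligible dimension (\<lambda>N. flow_number i (reduct1 H u v w) N - (\<Sum>K\<in>#leaves T1. flow_number i K N))"
    "negligible dimension (\<lambda>N. flow_number i (reduct2 H u v w) N - (\<Sum>K\<in>#leaves T2. flow_number i K N))"
    "\<forall>K\<in>#leaves T1. completable i K" "\<forall>K\<in>#leaves T2. completable i K"
    using reduce.IH by blast+
  have "negligible dimension (\<lambda>N. flow_number i H N - (flow_number i (reduct1 H u v w) N + flow_number i (reduct2 H u v w) N))"
    using network_flows_reduction_negligible[OF H] by (simp only: flow_number_def c)
  from negligible_add[OF this negligible_add[OF IH(1,2)]]
  have "negligible dimension (\<lambda>N. flow_number i H N - (\<Sum>K\<in>#leaves (Node H T1 T2). flow_number i K N))"
    by (simp add: algebra_simps)
  then show ?case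
    using IH(3,4) by auto
qed

lemma completed_add_vertex: "completed (i + 1) (add_vertex G (i + 1) K) = completed i K"
proof -
  have "{# e \<in># M. snd e = i + 1 #} + {# e \<in># M. snd e > i + 1 #} = {# e \<in># M. snd e > i #}" for M :: "(nat \<times> nat) multiset"
    by (induction M) auto
  then show ?thesis
    by (simp add: completed_def add_vertex_def add.assoc)
qed

text \<open>
  The invariant \<open>completable\<close> keeps the number of edges, and hence the exponent, constant.
\<close>

lemma tree_negligible:
  "2 \<le> i \<Longrightarrow> i \<le> n + 1 \<Longrightarrow>
    negligible dimension (\<lambda>N. real (card (network_flows n (edges G) N)) - (\<Sum>K\<in>#leaves (T i). flow_number i K N)) \<and>
    (\<forall>K\<in>#leaves (T i). completable i K)"
proof (induction i rule: dec_induct)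
  case base
  have "{# e \<in># M. snd e \<le> 2 #} + {# e \<in># M. snd e > 2 #} = M" for M :: "(nat \<times> nat) multiset"
    by (induction M) auto
  then have "completed 2 (initial_graph G 2) = edges G"
    by (simp add: completed_def edges_initial_graph)
  then show ?case
    using edge_bounds by (auto simp: T_2 flow_number_def completable_def negligible_zero internal_def)
next
  case (step i)
  have i: "2 \<le> i" "i \<le> n"
    using step by auto
  let ?T = "map_btree (add_vertex G (i + 1)) (T i)"
  have IH: "negligible dimension (\<lambda>N. real (card (network_flows n (edges G) N)) - (\<Sum>K\<in>#leaves (T i). flow_number i K N))"
    "\<forall>K\<in>#leaves (T i). completable i K"
    using step by auto
  have "(\<Sum>K\<in>#leaves ?T. flow_number (i + 1) K N) = (\<Sum>K\<in>#leaves (T i). flow_number i K N)" for N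
    by (simp only: leaves_map multiset.map_comp comp_def flow_number_def completed_add_vertex)
  moreover have "\<forall>K\<in>#leaves ?T. completable (i + 1) K"
    using IH(2) unfolding completable_def leaves_map by (auto simp: completed_add_vertex[simplified])
  moreover have "process_verts (entered i) ?T (T (i + 1))"
    using next_T[OF i] by (simp only: next_tree_def)
  ultimately have
    2: "negligible dimension (\<lambda>N. (\<Sum>K\<in>#leaves (T i). flow_number i K N) - (\<Sum>K\<in>#leaves (T (i + 1)). flow_number (i + 1) K N)) \<and>
      (\<forall>K\<in>#leaves (T (i + 1)). completable (i + 1) K)"
    using process_verts_sum_negligible[of "entered i" ?T "T (i + 1)" "completable (i + 1)" dimension "flow_number (i + 1)"]
      vertex_reductions_negligible by simp
  from negligible_add[OF IH(1) conjunct1[OF this]] conjunct2[OF this] show ?case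
    by simp
qed

lemma flow_count_limit:
  "(\<lambda>N. real (card (network_flows n (edges G) N)) / real N ^ dimension) \<longlonglongrightarrow>
    real (size (leaves (T (n + 1)))) / fact dimension"
proof -
  have i: "2 \<le> n + 1" "n + 1 \<le> n + 1"
    using n by auto
  note tree = tree_negligible[OF i]
  have "flow_number (n + 1) K N = real ((dimension + N) choose N)" if K: "K \<in># leaves (T (n + 1))" for K N
  proof -
    obtain \<pi> where "\<pi> \<in> leaf_paths (T (n + 1))" "K = leaf_along (T (n + 1)) \<pi>"
      using K by (auto simp: leaves_conv_paths finite_leaf_paths)
    then have "leaf_state G (n + 1) K"
      using leaf_states[OF i] by simp
    then have "alternating (edges K)"
      unfolding leaf_state_def alternating_def alternates_at_def indegree_eq_0_iff out_edges_eq_empty_iff by blast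
    moreover have "{# e \<in># edges G. snd e > n + 1 #} = {#}"
      using edge_bounds by fastforce
    then have "completed (n + 1) K = edges K"
      by (simp add: completed_def)
    moreover have "completable (n + 1) K"
      using tree K by blast
    ultimately show ?thesis
      using card_network_flows_alternating[of n "edges K" N] by (simp add: flow_number_def completable_def)
  qed
  then have sum: "(\<Sum>K\<in>#leaves (T (n + 1)). flow_number (n + 1) K N) =
      real (size (leaves (T (n + 1)))) * real ((dimension + N) choose N)" for N
    by (subst image_mset_cong[where g = "\<lambda>_. real ((dimension + N) choose N)"]) (auto simp: sum_mset_constant)
  have "(\<lambda>N. real (size (leaves (T (n + 1)))) * (real ((dimension + N) choose N) / real N ^ dimension)) \<longlonglongrightarrow>
      real (size (leaves (T (n + 1)))) * (1 / fact dimension)"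
    by (intro tendsto_intros binomial_asymptotics)
  from tendsto_add[OF conjunct1[OF tree, unfolded sum negligible_def] this]
  show ?thesis
    by (simp add: diff_divide_distrib)
qed

section \<open>The flow polytope\<close>

abbreviation polytope_arcs :: "((nat \<times> nat) \<times> nat) set" where
  "polytope_arcs \<equiv> arcs_of (network n (edges G))"

definition net_flow :: "nat \<Rightarrow> ((nat \<times> nat) \<times> nat \<Rightarrow>\<^sub>0 real) \<Rightarrow> real" where
  "net_flow v f = (\<Sum>a\<in>polytope_arcs. lookup f a * incidence a v)"

lemma internal_G: "internal n (edges G)"
  using edge_bounds unfolding internal_def by fastforce

lemma linear_net_flow: "linear (net_flow v)"
  by (rule linearI)
    (simp_all add: net_flow_def lookup_add lookup_scaleR distrib_right sum.distrib sum_distrib_left mult.assoc)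

lemma net_flow_single: "a \<in> polytope_arcs \<Longrightarrow> net_flow v (single a x) = x * incidence a v"
proof -
  assume a: "a \<in> polytope_arcs"
  have "net_flow v (single a x) = (\<Sum>b\<in>polytope_arcs. if b = a then x * incidence a v else 0)"
    unfolding net_flow_def by (intro sum.cong) (auto simp: lookup_single)
  then show ?thesis
    using a by simp
qed

lemma arc_ends: "a \<in> polytope_arcs \<Longrightarrow> fst (fst a) < snd (fst a) \<and> snd (fst a) \<le> n + 2"
proof -
  assume a: "a \<in> polytope_arcs"
  show ?thesis
  proof (cases "a \<in> arcs_of (edges G)")
    case True
    then show ?thesis
      using arcs_of_internal[OF internal_G, of "fst (fst a)" "snd (fst a)" "snd a"] by simp
  next
    case False
    then show ?thesis
      using a unfolding arcs_of_network[OF internal_G] by auto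
  qed
qed

text \<open>
  A flow of one unit from \<open>v\<close> to the sink. For the source it runs through the vertex 1, whose source
  arc is not a free arc, so that no such route uses a free arc.
\<close>

definition route_from :: "nat \<Rightarrow> (nat \<times> nat) \<times> nat \<Rightarrow>\<^sub>0 real" where
  "route_from v = (if v = 0 then single (source_arc 1) 1 + single (sink_arc n 1) 1
     else if v \<le> n + 1 then single (sink_arc n v) 1 else 0)"

definition route_to :: "nat \<Rightarrow> (nat \<times> nat) \<times> nat \<Rightarrow>\<^sub>0 real" where
  "route_to v = (if v = 0 then 0 else single (source_arc v) 1)"

lemma source_sink_arcs: "1 \<le> i \<Longrightarrow> i \<le> n + 1 \<Longrightarrow> source_arc i \<in> polytope_arcs \<and> sink_arc n i \<in> polytope_arcs"
  unfolding arcs_of_network[OF internal_G] by auto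

lemma net_flow_route_from:
  assumes "u \<le> n + 2"
  shows "net_flow v (route_from u) = (if v = u then 1 else 0) - (if v = n + 2 then 1 else 0)"
proof -
  have 1: "source_arc 1 \<in> polytope_arcs" "sink_arc n 1 \<in> polytope_arcs"
    using source_sink_arcs[of 1] by simp_all
  consider "u = 0" | "1 \<le> u" "u \<le> n + 1" | "u = n + 2"
    using assms by linarith
  then show ?thesis
  proof cases
    case 1
    then show ?thesis
      using \<open>source_arc 1 \<in> polytope_arcs\<close> \<open>sink_arc n 1 \<in> polytope_arcs\<close>
      by (simp add: route_from_def linear_add[OF linear_net_flow] net_flow_single incidence_def)
  next
    case 2
    then show ?thesis
      using source_sink_arcs[of u] by (simp add: route_from_def net_flow_single incidence_def)
  next
    case 3
    then show ?thesis
      by (simp add: route_from_def linear_0[OF linear_net_flow])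
  qed
qed

lemma net_flow_route_to:
  assumes "u \<le> n + 1"
  shows "net_flow v (route_to u) = (if v = 0 then 1 else 0) - (if v = u then 1 else 0)"
  using assms source_sink_arcs[of u]
  by (auto simp: route_to_def linear_0[OF linear_net_flow] net_flow_single incidence_def)

lemma keys_route: "u \<le> n + 2 \<Longrightarrow> keys (route_from u) \<subseteq> polytope_arcs"
  "u \<le> n + 1 \<Longrightarrow> keys (route_to u) \<subseteq> polytope_arcs"
  using source_sink_arcs[of u] source_sink_arcs[of 1]
    keys_add[of "single (source_arc 1) (1::real)" "single (sink_arc n 1) 1"]
  by (auto simp: route_from_def route_to_def split: if_splits)

lemma lookup_route: "lookup (route_from u) a \<in> \<int> \<and> 0 \<le> lookup (route_from u) a"
  "lookup (route_to u) a \<in> \<int> \<and> 0 \<le> lookup (route_to u) a"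
  by (auto simp: route_from_def route_to_def lookup_add lookup_single when_def)

lemma route_from_free: "a \<in> free_arcs n (edges G) \<Longrightarrow> lookup (route_from u) a = 0"
proof -
  assume "a \<in> free_arcs n (edges G)"
  then have "a \<noteq> source_arc 1" "a \<noteq> sink_arc n v" if "1 \<le> v" for v
    using arcs_of_internal[OF internal_G, of "fst (fst a)" "snd (fst a)" "snd a"] that
    by (auto simp: free_arcs_def)
  from this[of u] this[of 1] show ?thesis
    by (auto simp: route_from_def lookup_add lookup_single when_def)
qed

definition through :: "(nat \<times> nat) \<times> nat \<Rightarrow> (nat \<times> nat) \<times> nat \<Rightarrow>\<^sub>0 real" where
  "through a = route_to (fst (fst a)) + single a 1 + route_from (snd (fst a))"

lemma net_flow_through: "a \<in> polytope_arcs \<Longrightarrow> net_flow v (through a) = demand n v"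
  using arc_ends[of a]
  by (auto simp: through_def linear_add[OF linear_net_flow] net_flow_single net_flow_route_from
      net_flow_route_to incidence_def demand_def)

text \<open>
  One unit is sent along a route through each arc.
\<close>

definition positive_flow :: "(nat \<times> nat) \<times> nat \<Rightarrow>\<^sub>0 real" where
  "positive_flow = (\<Sum>a\<in>polytope_arcs. through a)"

lemma keys_sum_subset: "(\<And>x. x \<in> X \<Longrightarrow> keys (f x) \<subseteq> A) \<Longrightarrow> keys (\<Sum>x\<in>X. f x) \<subseteq> A"
  for f :: "'b \<Rightarrow> 'a \<Rightarrow>\<^sub>0 real"
proof (induction X rule: infinite_finite_induct)
  case (insert x X)
  then show ?case
    using keys_add[of "f x" "\<Sum>x\<in>X. f x"] by auto
qed auto

lemma keys_through: "a \<in> polytope_arcs \<Longrightarrow> keys (through a) \<subseteq> polytope_arcs"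
proof -
  assume a: "a \<in> polytope_arcs"
  have "keys (through a) \<subseteq> keys (route_to (fst (fst a))) \<union>
      keys (single a (1::real)) \<union> keys (route_from (snd (fst a)))"
    unfolding through_def
    using keys_add[of "route_to (fst (fst a)) + single a 1" "route_from (snd (fst a))"]
      keys_add[of "route_to (fst (fst a))" "single a 1"] by blast
  moreover have "keys (route_to (fst (fst a))) \<subseteq> polytope_arcs"
    using arc_ends[OF a] by (intro keys_route) simp
  moreover have "keys (route_from (snd (fst a))) \<subseteq> polytope_arcs"
    using arc_ends[OF a] by (intro keys_route) simp
  ultimately show ?thesis
    using a by auto
qed

lemma lookup_through: "lookup (through a) b \<in> \<int> \<and> 0 \<le> lookup (through a) b"
  using lookup_route by (simp add: through_def lookup_add lookup_single when_def)

lemma dilated: "dilated_slices polytope_arcs net_flow (demand n) positive_flow (card polytope_arcs)"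
proof (rule dilated_slices.intro)
  show "finite polytope_arcs"
    by simp
  show "linear (net_flow v)" for v
    by (rule linear_net_flow)
  have "source_arc 1 \<in> polytope_arcs"
    using source_sink_arcs[of 1] by simp
  then show "0 < card polytope_arcs"
    by (auto simp: card_gt_0_iff)
  show "keys positive_flow \<subseteq> polytope_arcs"
    unfolding positive_flow_def by (intro keys_sum_subset keys_through)
  show "net_flow v positive_flow = real (card polytope_arcs) * demand n v" for v
    by (simp add: positive_flow_def linear_sum[OF linear_net_flow] net_flow_through)
  show "positive_flow \<in> integer_points"
    using lookup_through by (auto simp: positive_flow_def integer_points_def lookup_sum intro!: Ints_sum)
  show "1 \<le> lookup positive_flow a" if a: "a \<in> polytope_arcs" for a
  proof -
    have "1 \<le> lookup (through a) a"
      using lookup_route by (simp add: through_def lookup_add add_increasing add_increasing2)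
    also have "\<dots> \<le> (\<Sum>b\<in>polytope_arcs. lookup (through b) a)"
      using a lookup_through by (intro member_le_sum) auto
    finally show ?thesis
      by (simp add: positive_flow_def lookup_sum)
  qed
qed

interpretation dilated_slices polytope_arcs net_flow "demand n" positive_flow "card polytope_arcs"
  by (rule dilated)

lemma edges_augment: "edges (augment G) = network n (edges G)" "verts (augment G) = {0..n + 2}"
proof -
  have V: "verts G = {1..n + 1}"
    using graph by (simp add: multigraph_on_def)
  have "Max {1..n + 1} = n + 1"
    by (auto intro!: Max_eqI)
  then have "augment G = \<lparr>verts = {0} \<union> {1..n + 1} \<union> {n + 2}, edges = network n (edges G)\<rparr>"
    by (simp only: augment_def Let_def V network_def) simp
  moreover have "{0} \<union> {1..n + 1} \<union> {n + 2} = {0..n + 2}"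
    by auto
  ultimately show "edges (augment G) = network n (edges G)" "verts (augment G) = {0..n + 2}"
    by simp_all
qed

lemma arcs_augment: "arcs (augment G) = polytope_arcs"
  by (simp add: arcs_def arcs_of_def edges_augment)

lemma net_flow_outflow_inflow: "net_flow v f = outflow (augment G) f v - inflow (augment G) f v"
proof -
  have "net_flow v f = (\<Sum>a\<in>polytope_arcs. (if fst (fst a) = v then lookup f a else 0) -
      (if snd (fst a) = v then lookup f a else 0))"
    unfolding net_flow_def by (intro sum.cong) (auto simp: incidence_def)
  also have "\<dots> = (\<Sum>a\<in>polytope_arcs. if fst (fst a) = v then lookup f a else 0) -
      (\<Sum>a\<in>polytope_arcs. if snd (fst a) = v then lookup f a else 0)"
    by (rule sum_subtractf)
  also have "\<dots> = outflow (augment G) f v - inflow (augment G) f v"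
    unfolding outflow_def inflow_def arcs_augment by (simp add: sum.If_cases Int_def)
  finally show ?thesis .
qed

lemma flow_polytope_eq_slice: "flow_polytope (augment G) = slice 1"
proof -
  have no_in: "inflow (augment G) f 0 = 0" for f
    unfolding inflow_def arcs_augment using arc_ends by (intro sum.neutral) fastforce
  have no_out: "outflow (augment G) f v = 0" if "v \<ge> n + 2" for f v
    unfolding outflow_def arcs_augment using arc_ends that by (intro sum.neutral) fastforce
  have no_in': "inflow (augment G) f v = 0" if "v > n + 2" for f v
    unfolding inflow_def arcs_augment using arc_ends that by (intro sum.neutral) fastforce
  have ends: "Min {0..n + 2} = 0" "Max {0..n + 2} = n + 2"
    by (auto intro!: Min_eqI Max_eqI)
  have net_iff: "(\<forall>v. net_flow v f = 1 * demand n v) \<longleftrightarrow>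
      outflow (augment G) f 0 = 1 \<and> inflow (augment G) f (n + 2) = 1 \<and>
      (\<forall>v\<in>{0..n + 2} - {0, n + 2}. inflow (augment G) f v = outflow (augment G) f v)" (is "?L \<longleftrightarrow> ?R") for f
  proof
    assume L: ?L
    show ?R
    proof (intro conjI ballI)
      show "outflow (augment G) f 0 = 1"
        using spec[OF L, of 0] by (simp add: net_flow_outflow_inflow no_in demand_def)
      show "inflow (augment G) f (n + 2) = 1"
        using spec[OF L, of "n + 2"] no_out[of "n + 2" f] by (simp add: net_flow_outflow_inflow demand_def)
      show "inflow (augment G) f v = outflow (augment G) f v" if "v \<in> {0..n + 2} - {0, n + 2}" for v
        using spec[OF L, of v] that by (simp add: net_flow_outflow_inflow demand_def)
    qed
  next
    assume R: ?R
    show ?L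
    proof
      fix v
      consider "v = 0" | "v = n + 2" | "v > n + 2" | "v \<in> {0..n + 2} - {0, n + 2}"
        by fastforce
      then show "net_flow v f = 1 * demand n v"
        using R no_in[of f] no_out[of v f] no_in'[of v f]
        by cases (auto simp: net_flow_outflow_inflow demand_def)
    qed
  qed
  have slice_iff: "f \<in> slice 1 \<longleftrightarrow> keys f \<subseteq> polytope_arcs \<and>
      (\<forall>a\<in>polytope_arcs. 0 \<le> lookup f a) \<and> (\<forall>v. net_flow v f = 1 * demand n v)" for f
    by (simp only: slice_def plane_def mem_Collect_eq conj_ac)
  show ?thesis
    by (rule set_eqI)
      (simp only: slice_iff net_iff flow_polytope_def edges_augment(2) ends arcs_augment mem_Collect_eq)
qed

definition integral_flow :: "((nat \<times> nat) \<times> nat \<Rightarrow> nat) \<Rightarrow> (nat \<times> nat) \<times> nat \<Rightarrow>\<^sub>0 real" where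
  "integral_flow f = Abs_poly_mapping (\<lambda>a. real (f a))"

lemma integer_points_slice:
  "bij_betw integral_flow (network_flows n (edges G) N) (slice (real N) \<inter> integer_points)"
proof -
  have lookup: "lookup (integral_flow f) a = real (f a)" if "\<forall>a. a \<notin> polytope_arcs \<longrightarrow> f a = 0" for f a
  proof -
    have "finite {a. real (f a) \<noteq> 0}"
    proof (rule finite_subset[OF _ finite_arcs_of])
      show "{a. real (f a) \<noteq> 0} \<subseteq> polytope_arcs"
      proof
        fix a assume "a \<in> {a. real (f a) \<noteq> 0}"
        then have "f a \<noteq> 0"
          by simp
        then show "a \<in> polytope_arcs"
          using that[rule_format, of a] by (cases "a \<in> polytope_arcs") simp_all
      qed
    qed
    then show ?thesis
      by (simp add: integral_flow_def)
  qed
  have outside: "\<forall>a. a \<notin> polytope_arcs \<longrightarrow> f a = 0" if "f \<in> network_flows n (edges G) N" for f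
    by (intro allI impI network_flows_outside[OF that])
  show ?thesis
  proof (rule bij_betw_imageI)
    show "inj_on integral_flow (network_flows n (edges G) N)"
    proof (rule inj_onI, rule ext)
      fix f g a assume "f \<in> network_flows n (edges G) N" "g \<in> network_flows n (edges G) N"
        and "integral_flow f = integral_flow g"
      then have "real (f a) = real (g a)"
        using lookup[OF outside] by metis
      then show "f a = g a"
        by simp
    qed
    show "integral_flow ` network_flows n (edges G) N = slice (real N) \<inter> integer_points"
    proof
      show "integral_flow ` network_flows n (edges G) N \<subseteq> slice (real N) \<inter> integer_points"
      proof
        fix z assume "z \<in> integral_flow ` network_flows n (edges G) N"
        then obtain f where f: "f \<in> network_flows n (edges G) N" and z: "z = integral_flow f"
          by blast
        note z_lookup = lookup[OF outside[OF f], folded z]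
        have "keys z \<subseteq> polytope_arcs"
        proof
          fix a assume "a \<in> keys z"
          then have "f a \<noteq> 0"
            by (simp add: in_keys_iff z_lookup)
          then show "a \<in> polytope_arcs"
            using outside[OF f, rule_format, of a] by (cases "a \<in> polytope_arcs") simp_all
        qed
        moreover have "net_flow v z = real N * demand n v" for v
          using f by (simp add: net_flow_def z_lookup network_flows_def flows_def)
        ultimately show "z \<in> slice (real N) \<inter> integer_points"
          by (auto simp: slice_def plane_def integer_points_def z_lookup)
      qed
      show "slice (real N) \<inter> integer_points \<subseteq> integral_flow ` network_flows n (edges G) N"
      proof
        fix z assume z: "z \<in> slice (real N) \<inter> integer_points"
        define f where "f a = nat \<lfloor>lookup z a\<rfloor>" for a
        have keys_z: "keys z \<subseteq> polytope_arcs"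
          using z by (simp add: slice_def plane_def)
        have out: "lookup z a = 0" if "a \<notin> polytope_arcs" for a
        proof -
          have "a \<notin> keys z"
            using keys_z that by blast
          then show ?thesis
            by (simp add: in_keys_iff)
        qed
        have f: "real (f a) = lookup z a" for a
        proof -
          have "lookup z a \<in> \<int>"
            using z unfolding integer_points_def by blast
          then obtain k where k: "lookup z a = of_int k"
            by (rule Ints_cases)
          have "0 \<le> lookup z a"
          proof (cases "a \<in> polytope_arcs")
            case True
            then show ?thesis
              using z by (simp add: slice_def)
          next
            case False
            then show ?thesis
              by (simp add: out)
          qed
          then show ?thesis
            by (simp add: f_def k)
        qed
        have f0: "\<forall>a. a \<notin> polytope_arcs \<longrightarrow> f a = 0"
          using out by (simp add: f_def)
        moreover have "(\<Sum>a\<in>polytope_arcs. real (f a) * incidence a v) = real N * demand n v" for v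
          using z by (simp add: f slice_def plane_def net_flow_def)
        ultimately have "f \<in> network_flows n (edges G) N"
          by (simp add: network_flows_def flows_def)
        moreover have "z = integral_flow f"
          by (rule poly_mapping_eqI) (simp only: lookup[OF f0] f)
        ultimately show "z \<in> integral_flow ` network_flows n (edges G) N"
          by blast
      qed
    qed
  qed
qed

text \<open>
  The free arcs serve as coordinates. The direction that belongs to a free arc \<open>a\<close> follows \<open>a\<close> and the
  route from its head to the sink, and returns along the route from its tail.
\<close>

lemma lattice_frame_flow_polytope: "\<exists>p b. lattice_frame (slice 1) dimension p b"
proof -
  let ?B = "free_arcs n (edges G)"
  have "finite ?B" "card ?B = dimension"
    using card_free_arcs[OF internal_G] by auto
  then obtain e where e: "bij_betw e {..<dimension} ?B"
    using ex_bij_betw_nat_finite[of ?B] by (auto simp: atLeast0LessThan)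
  have B: "?B \<subseteq> polytope_arcs"
    by (rule free_arcs_subset[OF internal_G])
  define v where "v a = single a 1 + route_from (snd (fst a)) - route_from (fst (fst a))" for a
  have "lattice_frame (slice 1) dimension (route_from 0) (v \<circ> e)"
  proof (rule lattice_frame_free_coordinates[OF B e])
    show "route_from 0 \<in> plane 1 \<inter> integer_points"
      using keys_route[of 0] lookup_route
      by (auto simp: plane_def integer_points_def net_flow_route_from demand_def)
    show "lookup (route_from 0) a = 0" if "a \<in> ?B" for a
      by (rule route_from_free[OF that])
    show "v a \<in> plane 0 \<inter> integer_points" if a: "a \<in> ?B" for a
    proof -
      have a': "a \<in> polytope_arcs"
        using a B by blast
      note ends = arc_ends[OF a']
      have "net_flow w (v a) = 0" for w
        using ends
        by (simp add: v_def linear_add[OF linear_net_flow] linear_diff[OF linear_net_flow] net_flow_single[OF a']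
            net_flow_route_from incidence_def)
      moreover have "keys (v a) \<subseteq> polytope_arcs"
        using keys_add[of "single a (1::real)" "route_from (snd (fst a))"]
          keys_diff[of "single a 1 + route_from (snd (fst a))" "route_from (fst (fst a))"]
          keys_route(1)[of "snd (fst a)"] keys_route(1)[of "fst (fst a)"] ends a'
        by (fastforce simp: v_def)
      moreover have "v a \<in> integer_points"
        using lookup_route by (simp add: v_def integer_points_def lookup_add lookup_minus lookup_single when_def)
      ultimately show ?thesis
        by (simp add: plane_def)
    qed
    show "lookup (v a) a' = (if a' = a then 1 else 0)" if "a \<in> ?B" "a' \<in> ?B" for a a'
      using route_from_free[OF that(2)] by (simp add: v_def lookup_add lookup_minus lookup_single when_def)
    show "f = 0" if f: "f \<in> plane 0" and free: "\<And>a. a \<in> ?B \<Longrightarrow> lookup f a = 0" for f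
    proof (rule poly_mapping_eqI)
      fix a
      show "lookup f a = lookup 0 a"
      proof (cases "a \<in> polytope_arcs")
        case True
        have "(\<Sum>a\<in>polytope_arcs. lookup f a * incidence a v) = 0" for v
          using f by (simp add: plane_def net_flow_def)
        then show ?thesis
          using determined_by_free_arcs[OF internal_G, of "lookup f" a] free True by simp
      next
        case False
        then show ?thesis
          using f by (auto simp: plane_def in_keys_iff)
      qed
    qed
  qed
  then show ?thesis
    by blast
qed

theorem normalized_volume_flow_polytope:
  "normalized_volume (flow_polytope (augment G)) = real (size (leaves (T (n + 1))))"
proof -
  obtain p b where frame: "lattice_frame (slice 1) dimension p b"
    using lattice_frame_flow_polytope by blast
  have count: "point_count N = card (network_flows n (edges G) N)" for N
    unfolding point_count_def using bij_betw_same_card[OF integer_points_slice[of N]] by simp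
  have finite: "finite (slice (real N) \<inter> integer_points)" for N
    using bij_betw_finite[OF integer_points_slice[of N]] card_network_flows_le[OF internal_G, of N] by blast
  have "leaf_paths t \<noteq> {}" for t :: "multigraph btree"
    by (induction t) auto
  then have "size (leaves (T (n + 1))) > 0"
    by (simp add: leaves_conv_paths finite_leaf_paths card_gt_0_iff)
  then have "normalized_volume (slice 1) = fact dimension * (real (size (leaves (T (n + 1)))) / fact dimension)"
    using flow_count_limit by (intro normalized_volume_slice[OF finite _ _ frame]) (simp_all add: count)
  then show ?thesis
    by (simp add: flow_polytope_eq_slice)
qed

end

section \<open>Arrays of indegrees\<close>

context reduction_tree_setup
begin

lemma leaf_path_prefix:
  "2 \<le> i \<Longrightarrow> i \<le> k \<Longrightarrow> k \<le> n + 1 \<Longrightarrow> \<pi> \<in> leaf_paths (T k) \<Longrightarrow> \<exists>\<pi>' \<rho>. \<pi> = \<pi>' @ \<rho> \<and> \<pi>' \<in> leaf_paths (T i)"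
proof (induction k arbitrary: \<pi>)
  case 0
  then show ?case by simp
next
  case (Suc k)
  show ?case
  proof (cases "i = Suc k")
    case True
    then show ?thesis
      using Suc.prems by (intro exI[of _ \<pi>] exI[of _ "[]"]) simp
  next
    case False
    then have k: "2 \<le> k" "k \<le> n" "i \<le> k" "k \<le> n + 1"
      using Suc.prems by auto
    have states: "\<And>\<pi>. \<pi> \<in> leaf_paths (T k) \<Longrightarrow> leaf_state G k (leaf_along (T k) \<pi>)"
      using k by (intro leaf_states) auto
    have "\<exists>s :: bool list \<Rightarrow> multigraph btree. leaf_paths (T (k + 1)) = {\<pi> @ \<rho> | \<pi> \<rho>. \<pi> \<in> leaf_paths (T k) \<and> \<rho> \<in> leaf_paths (s \<pi>)}"
    proof (rule next_tree_paths[OF k(1,2) states])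
      fix s :: "bool list \<Rightarrow> multigraph btree"
      assume "leaf_paths (T (k + 1)) = {\<pi> @ \<rho> | \<pi> \<rho>. \<pi> \<in> leaf_paths (T k) \<and> \<rho> \<in> leaf_paths (s \<pi>)}"
      then show "\<exists>s :: bool list \<Rightarrow> multigraph btree. leaf_paths (T (k + 1)) = {\<pi> @ \<rho> | \<pi> \<rho>. \<pi> \<in> leaf_paths (T k) \<and> \<rho> \<in> leaf_paths (s \<pi>)}"
        by (intro exI[of _ s])
    qed
    then obtain \<pi>1 \<rho>1 where 1: "\<pi> = \<pi>1 @ \<rho>1" "\<pi>1 \<in> leaf_paths (T k)"
      using Suc.prems(4) by auto
    obtain \<pi>' \<rho> where "\<pi>1 = \<pi>' @ \<rho>" "\<pi>' \<in> leaf_paths (T i)"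
      using Suc.IH[OF Suc.prems(1) k(3,4) 1(2)] by blast
    then show ?thesis
      using 1(1) by (intro exI[of _ \<pi>'] exI[of _ "\<rho> @ \<rho>1"]) simp
  qed
qed

lemma leaf_along_extended:
  assumes "2 \<le> i" "i \<le> k" "k \<le> n + 1" "\<pi> \<in> leaf_paths (T k)"
  shows "leaf_along (T i) (\<pi> @ \<rho>) = leaf_along (T i) \<pi>" "leaf_state G i (leaf_along (T i) \<pi>)"
proof -
  obtain \<pi>' \<sigma> where *: "\<pi> = \<pi>' @ \<sigma>" "\<pi>' \<in> leaf_paths (T i)"
    using leaf_path_prefix[OF assms] by blast
  show "leaf_along (T i) (\<pi> @ \<rho>) = leaf_along (T i) \<pi>"
    by (simp add: * leaf_along_append[OF *(2)])
  have "leaf_state G i (leaf_along (T i) \<pi>')"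
    using assms by (intro leaf_states *(2)) auto
  then show "leaf_state G i (leaf_along (T i) \<pi>)"
    by (simp add: * leaf_along_append[OF *(2)])
qed

lemma leaf_array_entry:
  assumes "m \<le> n" "\<pi> \<in> leaf_paths (T (m + 1))" "1 \<le> j" "j \<le> i" "i \<le> m"
  shows "leaf_array m T \<pi> i j = int (indegree (leaf_along (T (i + 1)) \<pi>) (j + 1))"
proof -
  have "leaf_state G (i + 1) (leaf_along (T (i + 1)) \<pi>)"
    using assms by (intro leaf_along_extended(2)[of "i + 1" "m + 1"]) auto
  then have "verts (leaf_along (T (i + 1)) \<pi>) = {1..i + 1}"
    by (simp add: leaf_state_def)
  then show ?thesis
    using assms(3,4,5) indegree_sequence_nth[of _ i j] by (simp add: leaf_array_def)
qed

lemma leaf_array_outside: "\<not> (1 \<le> j \<and> j \<le> i \<and> i \<le> m) \<Longrightarrow> leaf_array m T \<pi> i j = 0"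
  unfolding leaf_array_def by (rule if_not_P)

definition truncate_rows :: "nat \<Rightarrow> (nat \<Rightarrow> nat \<Rightarrow> int) \<Rightarrow> nat \<Rightarrow> nat \<Rightarrow> int" where
  "truncate_rows m a i j = (if i \<le> m then a i j else 0)"

lemma indegree_arrays_outside: "a \<in> indegree_arrays G m \<Longrightarrow> \<not> (1 \<le> j \<and> j \<le> i \<and> i \<le> m) \<Longrightarrow> a i j = 0"
  unfolding indegree_arrays_def by blast

text \<open>
  All but the last of the \<open>m + 1\<close> rows form an array for \<open>m\<close>.
\<close>

lemma indegree_arrays_Suc:
  assumes m: "1 \<le> m"
  shows "a \<in> indegree_arrays G (m + 1) \<longleftrightarrow>
    (\<forall>i j. \<not> (1 \<le> j \<and> j \<le> i \<and> i \<le> m + 1) \<longrightarrow> a i j = 0) \<and>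
    truncate_rows m a \<in> indegree_arrays G m \<and>
    (\<forall>j. 1 \<le> j \<and> j \<le> m \<longrightarrow>
      (if (j + 1, m + 2) \<in># edges G then a (m + 1) j \<in> {0..a m j} else a (m + 1) j = a m j)) \<and>
    a (m + 1) (m + 1) = int (size (edges (initial_graph G (m + 2)))) - (\<Sum>k=1..m. a (m + 1) k)"
    (is "?L \<longleftrightarrow> ?Z \<and> ?I \<and> ?R \<and> ?D")
proof
  assume L: ?L
  then have Z: ?Z and first: "a 1 1 = int (size (edges (initial_graph G 2)))"
    and row: "\<And>i j. 1 \<le> j \<and> j < i \<and> i \<le> m + 1 \<Longrightarrow>
        (if (j + 1, i + 1) \<in># edges G then a i j \<in> {0..a (i - 1) j} else a i j = a (i - 1) j)"
    and diagonal: "\<And>i. i \<in> {2..m + 1} \<Longrightarrow> a i i = int (size (edges (initial_graph G (i + 1)))) - (\<Sum>k=1..i - 1. a i k)"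
    unfolding indegree_arrays_def by blast+
  have ?I
    unfolding indegree_arrays_def mem_Collect_eq
  proof (intro conjI allI impI ballI)
    show "truncate_rows m a i j = 0" if "\<not> (1 \<le> j \<and> j \<le> i \<and> i \<le> m)" for i j
    proof (cases "i \<le> m")
      case True
      then have "\<not> (1 \<le> j \<and> j \<le> i \<and> i \<le> m + 1)"
        using that by simp
      then have "a i j = 0"
        using Z by blast
      then show ?thesis
        by (simp add: truncate_rows_def)
    qed (simp add: truncate_rows_def)
    show "truncate_rows m a 1 1 = int (size (edges (initial_graph G 2)))"
      using m first by (simp add: truncate_rows_def)
    show "if (j + 1, i + 1) \<in># edges G then truncate_rows m a i j \<in> {0..truncate_rows m a (i - 1) j}
        else truncate_rows m a i j = truncate_rows m a (i - 1) j" if "1 \<le> j \<and> j < i \<and> i \<le> m" for i j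
    proof -
      have "truncate_rows m a i j = a i j" "truncate_rows m a (i - 1) j = a (i - 1) j"
        unfolding truncate_rows_def using that by (auto intro!: if_P)
      moreover have "j < i \<and> i \<le> m + 1"
        using that by simp
      ultimately show ?thesis
        using row[of j i] that by (simp cong: if_cong)
    qed
    show "truncate_rows m a i i = int (size (edges (initial_graph G (i + 1)))) - (\<Sum>k=1..i - 1. truncate_rows m a i k)"
      if "i \<in> {2..m}" for i
    proof -
      have "truncate_rows m a i k = a i k" for k
        using that by (simp add: truncate_rows_def)
      moreover have "i \<in> {2..m + 1}"
        using that by simp
      ultimately show ?thesis
        using diagonal[of i] by simp
    qed
  qed
  moreover have ?R
  proof (intro allI impI)
    fix j assume "1 \<le> j \<and> j \<le> m"
    then show "if (j + 1, m + 2) \<in># edges G then a (m + 1) j \<in> {0..a m j} else a (m + 1) j = a m j"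
      using row[of j "m + 1"] by (simp cong: if_cong)
  qed
  moreover have ?D
    using diagonal[of "m + 1"] m by simp
  ultimately show "?Z \<and> ?I \<and> ?R \<and> ?D"
    using Z by blast
next
  assume *: "?Z \<and> ?I \<and> ?R \<and> ?D"
  then have I: "truncate_rows m a \<in> indegree_arrays G m" and R: ?R and D: ?D
    by blast+
  from I have first: "truncate_rows m a 1 1 = int (size (edges (initial_graph G 2)))"
    and row: "\<And>i j. 1 \<le> j \<and> j < i \<and> i \<le> m \<Longrightarrow>
        (if (j + 1, i + 1) \<in># edges G then truncate_rows m a i j \<in> {0..truncate_rows m a (i - 1) j}
         else truncate_rows m a i j = truncate_rows m a (i - 1) j)"
    and diagonal: "\<And>i. i \<in> {2..m} \<Longrightarrow>
        truncate_rows m a i i = int (size (edges (initial_graph G (i + 1)))) - (\<Sum>k=1..i - 1. truncate_rows m a i k)"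
    unfolding indegree_arrays_def by blast+
  show ?L
    unfolding indegree_arrays_def mem_Collect_eq
  proof (intro conjI allI impI ballI)
    show "a i j = 0" if "\<not> (1 \<le> j \<and> j \<le> i \<and> i \<le> m + 1)" for i j
      using that * by blast
    show "a 1 1 = int (size (edges (initial_graph G 2)))"
      using m first by (simp add: truncate_rows_def)
    show "if (j + 1, i + 1) \<in># edges G then a i j \<in> {0..a (i - 1) j} else a i j = a (i - 1) j"
      if "1 \<le> j \<and> j < i \<and> i \<le> m + 1" for i j
    proof (cases "i = m + 1")
      case True
      then show ?thesis
        using R[rule_format, of j] that by (simp cong: if_cong)
    next
      case False
      then have "truncate_rows m a i j = a i j" "truncate_rows m a (i - 1) j = a (i - 1) j"
        unfolding truncate_rows_def using that False by (auto intro!: if_P)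
      then show ?thesis
        using row[of j i] that False by (simp cong: if_cong)
    qed
    show "a i i = int (size (edges (initial_graph G (i + 1)))) - (\<Sum>k=1..i - 1. a i k)" if "i \<in> {2..m + 1}" for i
    proof (cases "i = m + 1")
      case True
      then show ?thesis
        using D by simp
    next
      case False
      then have "truncate_rows m a i k = a i k" for k
        using that by (simp add: truncate_rows_def)
      moreover have "i \<in> {2..m}"
        using that False by simp
      ultimately show ?thesis
        using diagonal[of i] by simp
    qed
  qed
qed

text \<open>
  Reductions preserve the number of edges, and each edge ends at exactly one vertex.
\<close>

lemma last_indegree:
  assumes "leaf_state G (m + 2) K"
  shows "int (indegree K (m + 2)) =
    int (size (edges (initial_graph G (m + 2)))) - (\<Sum>k=1..m. int (indegree K (k + 1)))"
proof -
  have "ordered_to (Suc (m + 1)) K" "size (edges K) = size (edges (initial_graph G (m + 2)))"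
    using assms by (simp_all add: leaf_state_def)
  then have "(\<Sum>k=1..m + 1. indegree K (k + 1)) = size (edges (initial_graph G (m + 2)))"
    using sum_indegree by metis
  then have "(\<Sum>k=1..m. indegree K (k + 1)) + indegree K (m + 2) = size (edges (initial_graph G (m + 2)))"
    by simp
  then have "int ((\<Sum>k=1..m. indegree K (k + 1)) + indegree K (m + 2)) = int (size (edges (initial_graph G (m + 2))))"
    by (simp only:)
  then show ?thesis
    by simp
qed

lemma bij_betw_if_ex1:
  assumes "\<And>x. x \<in> A \<Longrightarrow> f x \<in> B" "\<And>y. y \<in> B \<Longrightarrow> \<exists>x\<in>A. f x = y \<and> (\<forall>x'\<in>A. f x' = y \<longrightarrow> x' = x)"
  shows "bij_betw f A B"
proof (rule bij_betw_imageI)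
  show "inj_on f A"
  proof (rule inj_onI)
    fix x x' assume x: "x \<in> A" "x' \<in> A" "f x = f x'"
    obtain z where z: "\<forall>x'\<in>A. f x' = f x \<longrightarrow> x' = z"
      using assms(2)[OF assms(1)[OF x(1)]] by blast
    show "x = x'"
      using bspec[OF z x(1)] bspec[OF z x(2)] x(3) by simp
  qed
  show "f ` A = B"
    using assms(1) assms(2) by blast
qed

lemma leaf_array_bij_1: "bij_betw (leaf_array 1 T) (leaf_paths (T 2)) (indegree_arrays G 1)"
proof -
  have "leaf_state G 2 (leaf_along (T 2) [])"
    using n by (intro leaf_states) (simp_all add: T_2)
  then have "ordered_to 2 (initial_graph G 2)"
    by (simp add: T_2 leaf_state_def)
  then have "indegree (initial_graph G 2) 2 = size (edges (initial_graph G 2))"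
    using sum_indegree[of 1 "initial_graph G 2"] by (simp add: numeral_2_eq_2)
  then have entry: "leaf_array 1 T [] 1 1 = int (size (edges (initial_graph G 2)))"
    using leaf_array_entry[of 1 "[]" 1 1] n by (simp add: T_2 one_add_one del: One_nat_def)
  have "indegree_arrays G 1 = {leaf_array 1 T []}"
  proof (intro set_eqI iffI)
    fix a assume a: "a \<in> indegree_arrays G 1"
    have "a i j = leaf_array 1 T [] i j" for i j
    proof (cases "i = 1 \<and> j = 1")
      case True
      then show ?thesis
        using a entry by (simp add: indegree_arrays_def)
    next
      case False
      then have *: "\<not> (1 \<le> j \<and> j \<le> i \<and> i \<le> 1)"
        by auto
      show ?thesis
        using indegree_arrays_outside[OF a *] leaf_array_outside[OF *, of "[]"] by simp
    qed
    then show "a \<in> {leaf_array 1 T []}"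
      by (simp add: fun_eq_iff)
  next
    fix a assume "a \<in> {leaf_array 1 T []}"
    then show "a \<in> indegree_arrays G 1"
      using entry leaf_array_outside[of _ _ 1 "[]"] by (simp add: indegree_arrays_def)
  qed
  then show ?thesis
    by (simp add: T_2 bij_betw_def)
qed

text \<open>
  The first \<open>m\<close> rows of an array determine the leaf of \<open>T (m + 1)\<close> by induction, and the last row
  determines the path from there.
\<close>

lemma leaf_array_bij_Suc:
  assumes m: "1 \<le> m" "m + 1 \<le> n"
    and IH: "bij_betw (leaf_array m T) (leaf_paths (T (m + 1))) (indegree_arrays G m)"
  shows "bij_betw (leaf_array (m + 1) T) (leaf_paths (T (m + 2))) (indegree_arrays G (m + 1))"
proof -
  have i: "2 \<le> m + 1" "m + 1 \<le> n"
    using m by auto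
  have states: "\<And>\<pi>. \<pi> \<in> leaf_paths (T (m + 1)) \<Longrightarrow> leaf_state G (m + 1) (leaf_along (T (m + 1)) \<pi>)"
    using i by (intro leaf_states) auto
  obtain s where s: "leaf_paths (T (m + 1 + 1)) = {\<pi> @ \<rho> | \<pi> \<rho>. \<pi> \<in> leaf_paths (T (m + 1)) \<and> \<rho> \<in> leaf_paths (s \<pi>)}"
    "\<And>\<pi> \<rho>. \<pi> \<in> leaf_paths (T (m + 1)) \<Longrightarrow> leaf_along (T (m + 1 + 1)) (\<pi> @ \<rho>) = leaf_along (s \<pi>) \<rho>"
    "\<And>\<pi> \<rho>. \<pi> \<in> leaf_paths (T (m + 1)) \<Longrightarrow> \<rho> \<in> leaf_paths (s \<pi>) \<Longrightarrow> leaf_state G (m + 1 + 1) (leaf_along (s \<pi>) \<rho>)"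
    "\<And>\<pi> \<rho> x. \<pi> \<in> leaf_paths (T (m + 1)) \<Longrightarrow> \<rho> \<in> leaf_paths (s \<pi>) \<Longrightarrow> x \<le> m + 1 \<Longrightarrow>
       (if (x, m + 1 + 1) \<in># edges G then indegree (leaf_along (s \<pi>) \<rho>) x \<le> indegree (leaf_along (T (m + 1)) \<pi>) x
        else indegree (leaf_along (s \<pi>) \<rho>) x = indegree (leaf_along (T (m + 1)) \<pi>) x)"
    "\<And>\<pi> c. \<pi> \<in> leaf_paths (T (m + 1)) \<Longrightarrow>
       \<forall>x. (x, m + 1 + 1) \<in># edges G \<longrightarrow> c x \<le> indegree (leaf_along (T (m + 1)) \<pi>) x \<Longrightarrow>
       \<exists>!\<rho>. \<rho> \<in> leaf_paths (s \<pi>) \<and> (\<forall>x. (x, m + 1 + 1) \<in># edges G \<longrightarrow> indegree (leaf_along (s \<pi>) \<rho>) x = c x)"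
    by (rule next_tree_paths[OF i states], assumption, rule that)
  have m2: "m + 1 + 1 = m + 2"
    by simp
  note s = s[unfolded m2]
  have path: "\<pi> @ \<rho> \<in> leaf_paths (T (m + 2))"
    if "\<pi> \<in> leaf_paths (T (m + 1))" "\<rho> \<in> leaf_paths (s \<pi>)" for \<pi> \<rho>
    unfolding s(1) using that by blast
  have top: "leaf_array (m + 1) T (\<pi> @ \<rho>) (m + 1) j = int (indegree (leaf_along (s \<pi>) \<rho>) (j + 1))"
    if "\<pi> \<in> leaf_paths (T (m + 1))" "\<rho> \<in> leaf_paths (s \<pi>)" "1 \<le> j" "j \<le> m + 1" for \<pi> \<rho> j
    using leaf_array_entry[of "m + 1" "\<pi> @ \<rho>" j "m + 1"] path[OF that(1,2)] s(2)[OF that(1)] that(3,4) i(2) m2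
    by simp
  have lower: "truncate_rows m (leaf_array (m + 1) T (\<pi> @ \<rho>)) = leaf_array m T \<pi>"
    if \<pi>: "\<pi> \<in> leaf_paths (T (m + 1))" for \<pi> \<rho>
  proof (intro ext)
    fix i j
    show "truncate_rows m (leaf_array (m + 1) T (\<pi> @ \<rho>)) i j = leaf_array m T \<pi> i j"
    proof (cases "1 \<le> j \<and> j \<le> i \<and> i \<le> m")
      case True
      then have "leaf_along (T (i + 1)) (\<pi> @ \<rho>) = leaf_along (T (i + 1)) \<pi>"
        using m by (intro leaf_along_extended(1)[OF _ _ _ \<pi>]) auto
      then show ?thesis
        using True by (simp add: truncate_rows_def leaf_array_def)
    next
      case False
      then show ?thesis
        by (auto simp: truncate_rows_def leaf_array_def)
    qed
  qed
  have last_row: "leaf_array m T \<pi> m j = int (indegree (leaf_along (T (m + 1)) \<pi>) (j + 1))"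
    if "\<pi> \<in> leaf_paths (T (m + 1))" "1 \<le> j" "j \<le> m" for \<pi> j
    using leaf_array_entry[of m \<pi> j m] that m by simp
  have diagonal: "leaf_array (m + 1) T (\<pi> @ \<rho>) (m + 1) (m + 1) =
      int (size (edges (initial_graph G (m + 2)))) - (\<Sum>k=1..m. leaf_array (m + 1) T (\<pi> @ \<rho>) (m + 1) k)"
    if "\<pi> \<in> leaf_paths (T (m + 1))" "\<rho> \<in> leaf_paths (s \<pi>)" for \<pi> \<rho>
  proof -
    have "(\<Sum>k=1..m. leaf_array (m + 1) T (\<pi> @ \<rho>) (m + 1) k) =
        (\<Sum>k=1..m. int (indegree (leaf_along (s \<pi>) \<rho>) (k + 1)))"
      using top[OF that] by (intro sum.cong) auto
    then show ?thesis
      using last_indegree[OF s(3)[OF that]] top[OF that, of "m + 1"] by simp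
  qed
  show ?thesis
  proof (rule bij_betw_if_ex1)
    fix \<sigma> assume "\<sigma> \<in> leaf_paths (T (m + 2))"
    then obtain \<pi> \<rho> where \<sigma>: "\<sigma> = \<pi> @ \<rho>" and \<pi>: "\<pi> \<in> leaf_paths (T (m + 1))" and \<rho>: "\<rho> \<in> leaf_paths (s \<pi>)"
      unfolding s(1) by blast
    have "leaf_array (m + 1) T \<sigma> m j = leaf_array m T \<pi> m j" for j
      using fun_cong[OF fun_cong[OF lower[OF \<pi>, of \<rho>], of m], of j] by (simp add: truncate_rows_def \<sigma>)
    then have "if (j + 1, m + 2) \<in># edges G then leaf_array (m + 1) T \<sigma> (m + 1) j \<in> {0..leaf_array (m + 1) T \<sigma> m j}
        else leaf_array (m + 1) T \<sigma> (m + 1) j = leaf_array (m + 1) T \<sigma> m j" if "1 \<le> j \<and> j \<le> m" for j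
      using s(4)[OF \<pi> \<rho>, of "j + 1"] top[OF \<pi> \<rho>, of j] last_row[OF \<pi>, of j] that \<sigma> by (auto split: if_splits)
    moreover have "truncate_rows m (leaf_array (m + 1) T \<sigma>) \<in> indegree_arrays G m"
      unfolding \<sigma> lower[OF \<pi>] by (rule bij_betwE[OF IH, rule_format, OF \<pi>])
    moreover have "leaf_array (m + 1) T \<sigma> i j = 0" if "\<not> (1 \<le> j \<and> j \<le> i \<and> i \<le> m + 1)" for i j
      by (rule leaf_array_outside[OF that])
    ultimately show "leaf_array (m + 1) T \<sigma> \<in> indegree_arrays G (m + 1)"
      unfolding indegree_arrays_Suc[OF m(1)] using diagonal[OF \<pi> \<rho>] unfolding \<sigma>[symmetric] by blast
  next
    fix a assume a: "a \<in> indegree_arrays G (m + 1)"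
    have trunc: "truncate_rows m a \<in> indegree_arrays G m"
      and row: "\<And>j. 1 \<le> j \<and> j \<le> m \<Longrightarrow>
        (if (j + 1, m + 2) \<in># edges G then a (m + 1) j \<in> {0..a m j} else a (m + 1) j = a m j)"
      and diag: "a (m + 1) (m + 1) = int (size (edges (initial_graph G (m + 2)))) - (\<Sum>k=1..m. a (m + 1) k)"
      using a unfolding indegree_arrays_Suc[OF m(1)] by blast+
    obtain \<pi> where \<pi>: "\<pi> \<in> leaf_paths (T (m + 1))" "leaf_array m T \<pi> = truncate_rows m a"
      using IH trunc unfolding bij_betw_def by (metis imageE)
    have am: "a m j = int (indegree (leaf_along (T (m + 1)) \<pi>) (j + 1))" if "1 \<le> j" "j \<le> m" for j
      using last_row[OF \<pi>(1) that] by (simp add: \<pi>(2) truncate_rows_def)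
    \<comment> \<open>Column \<open>j\<close> belongs to the vertex \<open>j + 1\<close>; for \<open>x = 1\<close> this is the entry in column 0, which is 0.\<close>
    define c where "c x = nat (a (m + 1) (x - 1))" for x
    have c_entry: "int (c (j + 1)) = a (m + 1) j" if "1 \<le> j" "j \<le> m" for j
      using row[of j] am[OF that] that by (auto simp: c_def split: if_splits)
    have c_le: "c x \<le> indegree (leaf_along (T (m + 1)) \<pi>) x" if "(x, m + 2) \<in># edges G" for x
    proof (cases "x = 1")
      case True
      have "a (m + 1) 0 = 0"
        by (rule indegree_arrays_outside[OF a]) simp
      then show ?thesis
        using True by (simp add: c_def)
    next
      case False
      then have x: "1 \<le> x - 1" "x - 1 \<le> m" "x - 1 + 1 = x"
        using edge_bounds[OF that] by auto
      then show ?thesis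
        using row[of "x - 1"] am[OF x(1,2)] x that by (simp add: c_def nat_le_iff)
    qed
    have "\<forall>x. (x, m + 2) \<in># edges G \<longrightarrow> c x \<le> indegree (leaf_along (T (m + 1)) \<pi>) x"
      using c_le by blast
    from ex1_conjE[OF s(5)[OF \<pi>(1) this]] obtain \<rho> where \<rho>: "\<rho> \<in> leaf_paths (s \<pi>)"
      "\<forall>x. (x, m + 2) \<in># edges G \<longrightarrow> indegree (leaf_along (s \<pi>) \<rho>) x = c x"
      "\<forall>\<rho>'. \<rho>' \<in> leaf_paths (s \<pi>) \<longrightarrow> (\<forall>x. (x, m + 2) \<in># edges G \<longrightarrow> indegree (leaf_along (s \<pi>) \<rho>') x = c x) \<longrightarrow> \<rho>' = \<rho>"
      by (elim exE conjE)
    have top_row: "leaf_array (m + 1) T (\<pi> @ \<rho>) (m + 1) j = a (m + 1) j" if j: "1 \<le> j" "j \<le> m" for j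
    proof (cases "(j + 1, m + 2) \<in># edges G")
      case True
      then show ?thesis
        using top[OF \<pi>(1) \<rho>(1), of j] \<rho>(2) c_entry[OF j] j by simp
    next
      case False
      then show ?thesis
        using top[OF \<pi>(1) \<rho>(1), of j] s(4)[OF \<pi>(1) \<rho>(1), of "j + 1"] row[of j] am[OF j] j by simp
    qed
    have "leaf_array (m + 1) T (\<pi> @ \<rho>) = a"
    proof (intro ext)
      fix i j
      consider "\<not> (1 \<le> j \<and> j \<le> i \<and> i \<le> m + 1)" | "i \<le> m" | "i = m + 1" "1 \<le> j" "j \<le> m" | "i = m + 1" "j = m + 1"
        by linarith
      then show "leaf_array (m + 1) T (\<pi> @ \<rho>) i j = a i j"
      proof cases
        case 1
        then show ?thesis
          using leaf_array_outside[OF 1] indegree_arrays_outside[OF a 1] by simp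
      next
        case 2
        have "truncate_rows m (leaf_array (m + 1) T (\<pi> @ \<rho>)) i j = truncate_rows m a i j"
          by (simp only: lower[OF \<pi>(1)] \<pi>(2))
        then show ?thesis
          using 2 by (simp add: truncate_rows_def)
      next
        case 3
        then show ?thesis
          using top_row by simp
      next
        case 4
        have "(\<Sum>k=1..m. leaf_array (m + 1) T (\<pi> @ \<rho>) (m + 1) k) = (\<Sum>k=1..m. a (m + 1) k)"
          using top_row by (intro sum.cong) auto
        then show ?thesis
          using diagonal[OF \<pi>(1) \<rho>(1)] diag 4 by simp
      qed
    qed
    moreover have "\<sigma> = \<pi> @ \<rho>" if \<sigma>: "\<sigma> \<in> leaf_paths (T (m + 2))" "leaf_array (m + 1) T \<sigma> = a" for \<sigma>
    proof -
      obtain \<pi>' \<rho>' where *: "\<sigma> = \<pi>' @ \<rho>'" "\<pi>' \<in> leaf_paths (T (m + 1))" "\<rho>' \<in> leaf_paths (s \<pi>')"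
        using \<sigma>(1) unfolding s(1) by blast
      have "leaf_array m T \<pi>' = leaf_array m T \<pi>"
        using lower[OF *(2), of \<rho>'] \<sigma>(2) \<pi>(2) by (simp add: *(1))
      then have \<pi>': "\<pi>' = \<pi>"
        using inj_onD[OF bij_betw_imp_inj_on[OF IH]] *(2) \<pi>(1) by blast
      have "indegree (leaf_along (s \<pi>) \<rho>') x = c x" if x: "(x, m + 2) \<in># edges G" for x
      proof (cases "x = 1")
        case True
        have "indegree (leaf_along (s \<pi>) \<rho>') 1 = 0"
          using s(3)[OF *(2,3)] indegree_first[of "m + 2" "leaf_along (s \<pi>) \<rho>'" 1] by (simp add: leaf_state_def \<pi>')
        moreover have "a (m + 1) 0 = 0"
          by (rule indegree_arrays_outside[OF a]) simp
        ultimately show ?thesis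
          using True by (simp add: c_def)
      next
        case False
        then have x': "1 \<le> x - 1" "x - 1 \<le> m" "x - 1 + 1 = x"
          using edge_bounds[OF x] by auto
        have "int (indegree (leaf_along (s \<pi>) \<rho>') x) = a (m + 1) (x - 1)"
          using top[OF *(2,3), of "x - 1"] x' \<sigma>(2) *(1) \<pi>' by simp
        from arg_cong[OF this, of nat] show ?thesis
          by (simp only: c_def nat_int)
      qed
      then have "\<rho>' = \<rho>"
        using \<rho>(3) *(3) \<pi>' by blast
      then show ?thesis
        using * \<pi>' by simp
    qed
    ultimately show "\<exists>\<sigma>\<in>leaf_paths (T (m + 2)). leaf_array (m + 1) T \<sigma> = a \<and>
        (\<forall>\<sigma>'\<in>leaf_paths (T (m + 2)). leaf_array (m + 1) T \<sigma>' = a \<longrightarrow> \<sigma>' = \<sigma>)"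
      using path[OF \<pi>(1) \<rho>(1)] by blast
  qed
qed

lemma leaf_array_bij: "1 \<le> m \<Longrightarrow> m \<le> n \<Longrightarrow> bij_betw (leaf_array m T) (leaf_paths (T (m + 1))) (indegree_arrays G m)"
proof (induction m rule: dec_induct)
  case base
  show ?case
    using leaf_array_bij_1 by (simp add: numeral_2_eq_2)
next
  case (step m)
  then show ?case
    using leaf_array_bij_Suc[of m] by simp
qed

lemma InSeq_arrays:
  "image_mset (map int) (InSeq (T (n + 1))) = {# map (a n) [1..<n + 1]. a \<in># mset_set (indegree_arrays G n) #}"
proof -
  have bij: "bij_betw (leaf_array n T) (leaf_paths (T (n + 1))) (indegree_arrays G n)"
    using leaf_array_bij n by blast
  have "map int (indegree_sequence (leaf_along (T (n + 1)) \<pi>)) = map (leaf_array n T \<pi> n) [1..<n + 1]"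
    if \<pi>: "\<pi> \<in> leaf_paths (T (n + 1))" for \<pi>
  proof -
    have "leaf_state G (n + 1) (leaf_along (T (n + 1)) \<pi>)"
      using n by (intro leaf_states \<pi>) auto
    then have "verts (leaf_along (T (n + 1)) \<pi>) - {1} = {2..<n + 2}"
      by (auto simp: leaf_state_def)
    then have "length (indegree_sequence (leaf_along (T (n + 1)) \<pi>)) = n"
      by (simp add: indegree_sequence_def del: upt_Suc)
    then show ?thesis
      by (intro nth_equalityI) (simp_all add: leaf_array_def del: upt_Suc)
  qed
  then have "image_mset (map int) (InSeq (T (n + 1))) =
      image_mset (\<lambda>\<pi>. map (leaf_array n T \<pi> n) [1..<n + 1]) (mset_set (leaf_paths (T (n + 1))))"
    unfolding InSeq_def leaves_conv_paths multiset.map_comp comp_def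
    by (intro image_mset_cong) (simp add: finite_leaf_paths)
  also have "\<dots> = image_mset (\<lambda>a. map (a n) [1..<n + 1]) (image_mset (leaf_array n T) (mset_set (leaf_paths (T (n + 1)))))"
    by (simp only: multiset.map_comp comp_def)
  also have "image_mset (leaf_array n T) (mset_set (leaf_paths (T (n + 1)))) = mset_set (indegree_arrays G n)"
    using bij by (simp add: bij_betw_def image_mset_mset_set)
  finally show ?thesis .
qed

end

section \<open>The volume, the tree and the arrays\<close>

theorem theorem4:
  fixes n :: nat and G :: multigraph and T :: "nat \<Rightarrow> multigraph btree"
  assumes "n \<ge> 1"
    and "multigraph_on {1..n + 1} G" and "loopless G"
    and "\<forall>i j. count (edges G) (i, j) > 1 \<longrightarrow> i = 1"
    and "tree_construction G n T"
  shows "normalized_volume (flow_polytope (augment G)) = real (size (InSeq (T (n + 1)))) \<and>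
    bij_betw (leaf_array n T) (leaf_paths (T (n + 1))) (indegree_arrays G n) \<and>
    image_mset (map int) (InSeq (T (n + 1))) =
      {# map (a n) [1..<n + 1]. a \<in># mset_set (indegree_arrays G n) #} \<and>
    finite (indegree_arrays G n) \<and>
    normalized_volume (flow_polytope (augment G)) = real (card (indegree_arrays G n))"
proof -
  interpret reduction_tree_setup G n T
    using assms by unfold_locales
  have bij: "bij_betw (leaf_array n T) (leaf_paths (T (n + 1))) (indegree_arrays G n)"
    using leaf_array_bij assms(1) by blast
  have size: "size (InSeq (T (n + 1))) = size (leaves (T (n + 1)))"
    by (simp add: InSeq_def)
  also have "\<dots> = card (leaf_paths (T (n + 1)))"
    by (simp only: leaves_conv_paths size_image_mset size_mset_set)
  also have "\<dots> = card (indegree_arrays G n)"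
    by (rule bij_betw_same_card[OF bij])
  finally have card: "size (InSeq (T (n + 1))) = card (indegree_arrays G n)" .
  have "finite (indegree_arrays G n)"
    using bij_betw_finite[OF bij] finite_leaf_paths by blast
  then show ?thesis
    using normalized_volume_flow_polytope bij InSeq_arrays card size by simp
qed

end
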